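(* Let $\varphi_1,\dots,\varphi_n,\varphi$ be formulae whose free variables are among $\vec x=x_1,\dots,x_\ell$ and $\vec X=X_1,\dots,X_p$. From an $\mathsf{SMSO}$-derivation $\mathcal D$ of $\varphi_1,\dots,\varphi_n\vdash\varphi$ one can compute a finite-state synchronous function \[F_{\mathcal D}:\ \{0,1\}^\ell\times\{0,1\}^p\times\mathbf 1^\ell\times M(\varphi_1)\times\cdots\times M(\varphi_n)\ \to\ M(\varphi)\] such that $\varphi_1,\dots,\varphi_n\Vdash_{\vec x,\vec X}F_{\mathcal D}:\varphi$, i.e. for all $\vec k\in\mathbb N^\ell$, all $\vec\sigma\in(\{0,1\}^\omega)^p$ and all runs $R_i\Vdash\mathcal I[\varphi_i](\vec k,\vec\sigma)$ ($i=1,\dots,n$), we have $F_{\mathcal D}(\vec k,\vec\sigma,\vec\ast,R_1,\dots,R_n)\Vdash\mathcal I[\varphi](\vec k,\vec\sigma)$.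
   Context: \emph{Formulae and $\mathsf{SMSO}$.} Two-sorted language with individual variables $x,y,z$ and predicate variables $X,Y$; atoms $x\doteq y$, $x\leq y$, $\mathsf S(x,y)$, $\mathsf{Zero}(x)$, $x\in X$, $\top,\bot$; deterministic formulae $\delta::=\alpha\mid\delta\wedge\delta'\mid\lnot\varphi$; formulae $\varphi::=\delta\mid\varphi\wedge\psi\mid\exists x\varphi\mid\exists X\varphi$. $\mathsf{SMSO}$ is the intuitionistic sequent system with: axiom, cut, $\lnot$-intro/elim into $\bot$, $\wedge$-rules, $\exists$-intro/elim for both sorts (eigenvariable conditions); arithmetic rules ($\doteq$ reflexive with substitution of equals; $\leq$ reflexive, transitive, antisymmetric; $\vdash\exists y\mathsf{Zero}(y)$; uniqueness of $\mathsf{Zero}$; $\vdash\exists y\mathsf S(x,y)$; $\mathsf S$ functional and injective; $\mathsf S(x,y),\mathsf{Zero}(y)\vdash\bot$; $\mathsf S(x,y)\vdash x\leq y$; from $\mathsf S(y,y'),x\leq y',\lnot(x\doteq y')$ infer $x\leq y$); negative comprehension (from $\vec\varphi\vdash\varphi[\psi[y]/X]$ infer $\vec\varphi\vdash\lnot\lnot\exists X\varphi$, where $\varphi[\psi[y]/X]$ replaces each atom $t\in X$ by $\psi[t/y]$); induction for deterministic formulae (from $\vec\varphi,\mathsf{Zero}(z)\vdash\delta[z/x]$ and $\vec\varphi,\mathsf S(y,z),\delta[y/x]\vdash\delta[z/x]$ infer $\vec\varphi\vdash\delta$, $y,z$ fresh); double negation elimination for deterministic formulae; synchronous comprehension (from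 $\vec\varphi\vdash\psi[\hat\varphi[y]/X]$ infer $\vec\varphi\vdash\exists X\psi$ when $\hat\varphi$ has the form $\chi|(u\leq y)[u]$ with $y$ its only free individual variable, where relativization $\chi|\theta[u]$ fixes atoms, commutes with $\wedge,\lnot,\exists X$ and sends $\exists x\chi$ to $\exists x(\theta[x/u]\wedge\chi|\theta[u])$). \emph{Synchronous functions.} For alphabets (finite nonempty sets), $F:\Sigma^\omega\to\Gamma^\omega$ is finite-state synchronous if induced by a deterministic Mealy machine (states $Q$, initial state, $\partial:Q\times\Sigma\to Q\times\Gamma$, output at step $n$ computed from the state after reading the first $n$ letters and the $n$-th letter). Products of alphabets are identified with tuples of streams; $\mathbf 1=\{\ast\}$. \emph{Uniform automata.} A uniform automaton over $\Sigma$ is $(Q,q_0,M,\partial,\Omega)$ with $Q$ finite, $M$ a finite nonempty set of moves, $\partial:Q\times\Sigma\times M\to Q$, $\Omega\subseteq Q^\omega$ $\omega$-regular. A run on $\sigma\in\Sigma^\omega$ is $R\in M^\omega$; it is accepting ($R\Vdash\mathcal A(\sigma)$) if the state sequence $q_{k+1}=\partial(q_k,\sigma(k),R(k))$ lies in $\Omega$; $\mathcal L(\mathcal A)$ is the set of accepted words. $\mathcal A$ is deterministic if $M$ is a singleton. \emph{Interpretation.} A natural number $k$ is identified with the stream in $\{0,1\}^\omega$ which is $1$ exactly at position $k$. For $\varphi$ with free variables among $\vec x,\vec X$, $\mathcal I[\varphi]=\mathcal I[\varphi]_{\vec x,\vec X}$ is a uniform automaton over $\{0,1\}^\ell\times\{0,1\}^p$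 with move set $M(\varphi)$, defined by: for an atom, a deterministic automaton (moves $\mathbf 1$) accepting, on inputs whose individual components are singletons $\vec k$, exactly those satisfying the atom in the standard model; $\mathcal I[\psi_1\wedge\psi_2]$ is the synchronous product (moves $M(\psi_1)\times M(\psi_2)$, states pairs, acceptance iff both components accept), so a pair of runs is accepting iff each is; $\mathcal I[\lnot\psi]$ is a deterministic uniform automaton (moves $\mathbf 1$) recognizing the complement of $\mathcal L(\mathcal I[\psi])$; $\mathcal I[\exists X\psi]$ is the projection of $\mathcal I[\psi]_{\vec x,\vec X,X}$ with moves $\{0,1\}\times M(\psi)$, a run $(\beta,R)$ on $(\vec k,\vec\sigma)$ being accepting iff $R\Vdash\mathcal I[\psi](\vec k,\vec\sigma,\beta)$; $\mathcal I[\exists x\psi]$ has moves $\{0,1\}\times(\mathbf 1\times M(\psi))$, a run $(\beta,(\ast,R))$ on $(\vec k,\vec\sigma)$ being accepting iff $\beta$ is a singleton stream $k$ and $R\Vdash\mathcal I[\psi]_{\vec x,x,\vec X}(\vec k,k,\vec\sigma)$. *)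

theory Defs
  imports Main "HOL-Library.Nat_Bijection"
begin

section \<open>Formulae\<close>

text \<open>
  Formulae up to renaming of bound variables, in de Bruijn style, with one index space for
  individual and one for predicate variables.  \<open>ExI\<close> binds the individual index 0 and \<open>ExP\<close> the
  predicate index 0 of its body.  \<open>Sc x y\<close> is the atom S(x,y) and \<open>Mem x X\<close> is the atom x \<in> X.
\<close>

datatype form =
    Eq nat nat
  | Le nat nat
  | Sc nat nat
  | Zero nat
  | Mem nat nat
  | Top
  | Bot
  | And form form
  | Neg form
  | ExI form
  | ExP form

primrec deterministic :: "form \<Rightarrow> bool" where
  "deterministic (Eq x y) = True"
| "deterministic (Le x y) = True"
| "deterministic (Sc x y) = True"
| "deterministic (Zero x) = True"
| "deterministic (Mem x X) = True"
| "deterministic Top = True"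
| "deterministic Bot = True"
| "deterministic (And \<phi> \<psi>) = (deterministic \<phi> \<and> deterministic \<psi>)"
| "deterministic (Neg \<phi>) = True"
| "deterministic (ExI \<phi>) = False"
| "deterministic (ExP \<phi>) = False"

primrec fvi :: "form \<Rightarrow> nat set" where
  "fvi (Eq x y) = {x, y}"
| "fvi (Le x y) = {x, y}"
| "fvi (Sc x y) = {x, y}"
| "fvi (Zero x) = {x}"
| "fvi (Mem x X) = {x}"
| "fvi Top = {}"
| "fvi Bot = {}"
| "fvi (And \<phi> \<psi>) = fvi \<phi> \<union> fvi \<psi>"
| "fvi (Neg \<phi>) = fvi \<phi>"
| "fvi (ExI \<phi>) = {x. Suc x \<in> fvi \<phi>}"
| "fvi (ExP \<phi>) = fvi \<phi>"

primrec fvp :: "form \<Rightarrow> nat set" where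
  "fvp (Eq x y) = {}"
| "fvp (Le x y) = {}"
| "fvp (Sc x y) = {}"
| "fvp (Zero x) = {}"
| "fvp (Mem x X) = {X}"
| "fvp Top = {}"
| "fvp Bot = {}"
| "fvp (And \<phi> \<psi>) = fvp \<phi> \<union> fvp \<psi>"
| "fvp (Neg \<phi>) = fvp \<phi>"
| "fvp (ExI \<phi>) = fvp \<phi>"
| "fvp (ExP \<phi>) = {X. Suc X \<in> fvp \<phi>}"

text \<open>Extension of a renaming under a binder.\<close>

definition up :: "(nat \<Rightarrow> nat) \<Rightarrow> nat \<Rightarrow> nat" where
  "up f = case_nat 0 (\<lambda>i. Suc (f i))"

primrec ren :: "(nat \<Rightarrow> nat) \<Rightarrow> (nat \<Rightarrow> nat) \<Rightarrow> form \<Rightarrow> form" where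
  "ren f g (Eq x y) = Eq (f x) (f y)"
| "ren f g (Le x y) = Le (f x) (f y)"
| "ren f g (Sc x y) = Sc (f x) (f y)"
| "ren f g (Zero x) = Zero (f x)"
| "ren f g (Mem x X) = Mem (f x) (g X)"
| "ren f g Top = Top"
| "ren f g Bot = Bot"
| "ren f g (And \<phi> \<psi>) = And (ren f g \<phi>) (ren f g \<psi>)"
| "ren f g (Neg \<phi>) = Neg (ren f g \<phi>)"
| "ren f g (ExI \<phi>) = ExI (ren (up f) g \<phi>)"
| "ren f g (ExP \<phi>) = ExP (ren f (up g) \<phi>)"

text \<open>
  \<open>substi x t \<phi>\<close> is \<phi>[t/x] for a free individual variable x.  \<open>insti t\<close> and \<open>instp Y\<close> act on the
  body of a quantifier: they replace the bound index 0 and lower the remaining indices by one.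
\<close>

definition substi :: "nat \<Rightarrow> nat \<Rightarrow> form \<Rightarrow> form" where
  "substi x t = ren (id(x := t)) id"

definition insti :: "nat \<Rightarrow> form \<Rightarrow> form" where
  "insti t = ren (case_nat t id) id"

definition instp :: "nat \<Rightarrow> form \<Rightarrow> form" where
  "instp Y = ren id (case_nat Y id)"

text \<open>
  \<open>substp X \<psi> \<phi>\<close> is \<phi>[\<psi>[y]/X], where \<psi> is given as a body whose individual index 0 is y.  The
  predicate variable X disappears, so that larger predicate indices are lowered by one.
  Shifting \<psi> under binders makes the substitution capture-avoiding.
\<close>

primrec substp :: "nat \<Rightarrow> form \<Rightarrow> form \<Rightarrow> form" where
  "substp X \<psi> (Eq x y) = Eq x y"
| "substp X \<psi> (Le x y) = Le x y"
| "substp X \<psi> (Sc x y) = Sc x y"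
| "substp X \<psi> (Zero x) = Zero x"
| "substp X \<psi> (Mem t Y) =
     (if Y = X then insti t \<psi> else if Y < X then Mem t Y else Mem t (Y - 1))"
| "substp X \<psi> Top = Top"
| "substp X \<psi> Bot = Bot"
| "substp X \<psi> (And \<phi>1 \<phi>2) = And (substp X \<psi> \<phi>1) (substp X \<psi> \<phi>2)"
| "substp X \<psi> (Neg \<phi>) = Neg (substp X \<psi> \<phi>)"
| "substp X \<psi> (ExI \<phi>) = ExI (substp X (ren (up Suc) id \<psi>) \<phi>)"
| "substp X \<psi> (ExP \<phi>) = ExP (substp (Suc X) (ren id Suc \<psi>) \<phi>)"

text \<open>
  \<open>relativize \<theta> \<chi>\<close> is \<chi>|\<theta>[u], where \<theta> is given as a body whose individual index 0 is u.  Hence \<theta>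
  itself, placed directly below \<open>ExI\<close>, is \<theta>[x/u] for the variable x bound there.
\<close>

primrec relativize :: "form \<Rightarrow> form \<Rightarrow> form" where
  "relativize \<theta> (Eq x y) = Eq x y"
| "relativize \<theta> (Le x y) = Le x y"
| "relativize \<theta> (Sc x y) = Sc x y"
| "relativize \<theta> (Zero x) = Zero x"
| "relativize \<theta> (Mem x X) = Mem x X"
| "relativize \<theta> Top = Top"
| "relativize \<theta> Bot = Bot"
| "relativize \<theta> (And \<chi>1 \<chi>2) = And (relativize \<theta> \<chi>1) (relativize \<theta> \<chi>2)"
| "relativize \<theta> (Neg \<chi>) = Neg (relativize \<theta> \<chi>)"
| "relativize \<theta> (ExI \<chi>) = ExI (And \<theta> (relativize (ren (up Suc) id \<theta>) \<chi>))"
| "relativize \<theta> (ExP \<chi>) = ExP (relativize (ren id Suc \<theta>) \<chi>)"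


section \<open>The deduction system SMSO\<close>

type_synonym sequent = "form list \<times> form"

text \<open>
  Names of inference rules, with the data of an instance that cannot be read off its conclusion
  and premises.
\<close>

datatype rule =
    Ax | Cut | NegI | NegE | AndI | AndE1 | AndE2
  | ExII nat | ExIE nat | ExPI nat | ExPE nat
  | EqRefl | EqSubst nat nat nat form
  | LeRefl | LeTrans | LeAntisym
  | ZeroEx | ZeroUnique
  | ScEx | ScFun | ScInj | ScZero | ScLe | LeSc
  | NegCompr form
  | Induct nat nat nat
  | DNE
  | SyncCompr form

definition fresh_i :: "nat \<Rightarrow> form list \<Rightarrow> bool" where
  "fresh_i z \<Gamma> \<longleftrightarrow> (\<forall>\<phi>\<in>set \<Gamma>. z \<notin> fvi \<phi>)"

definition fresh_p :: "nat \<Rightarrow> form list \<Rightarrow> bool" where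
  "fresh_p Z \<Gamma> \<longleftrightarrow> (\<forall>\<phi>\<in>set \<Gamma>. Z \<notin> fvp \<phi>)"

text \<open>
  In the existential eliminations, the induction rule and wherever bodies are instantiated, free
  variables are indices like any others; eigenvariable conditions are freshness conditions.
  In \<open>SyncCompr \<chi>\<close> the variable y is index 0 of \<chi>, and in the body \<open>Le 0 1\<close> of the
  relativization u is index 0 and y is index 1.
\<close>

inductive rule_instance :: "rule \<Rightarrow> sequent list \<Rightarrow> sequent \<Rightarrow> bool" where
  "\<phi> \<in> set \<Gamma> \<Longrightarrow> rule_instance Ax [] (\<Gamma>, \<phi>)"
| "rule_instance Cut [(\<Gamma>, \<phi>), (\<Gamma> @ [\<phi>], \<psi>)] (\<Gamma>, \<psi>)"
| "rule_instance NegI [(\<Gamma> @ [\<phi>], Bot)] (\<Gamma>, Neg \<phi>)"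
| "rule_instance NegE [(\<Gamma>, \<phi>), (\<Gamma>, Neg \<phi>)] (\<Gamma>, Bot)"
| "rule_instance AndI [(\<Gamma>, \<phi>), (\<Gamma>, \<psi>)] (\<Gamma>, And \<phi> \<psi>)"
| "rule_instance AndE1 [(\<Gamma>, And \<phi> \<psi>)] (\<Gamma>, \<phi>)"
| "rule_instance AndE2 [(\<Gamma>, And \<phi> \<psi>)] (\<Gamma>, \<psi>)"
| "rule_instance (ExII t) [(\<Gamma>, insti t \<phi>)] (\<Gamma>, ExI \<phi>)"
| "fresh_i z (ExI \<phi> # \<psi> # \<Gamma>) \<Longrightarrow>
     rule_instance (ExIE z) [(\<Gamma>, ExI \<phi>), (\<Gamma> @ [insti z \<phi>], \<psi>)] (\<Gamma>, \<psi>)"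
| "rule_instance (ExPI Y) [(\<Gamma>, instp Y \<phi>)] (\<Gamma>, ExP \<phi>)"
| "fresh_p Z (ExP \<phi> # \<psi> # \<Gamma>) \<Longrightarrow>
     rule_instance (ExPE Z) [(\<Gamma>, ExP \<phi>), (\<Gamma> @ [instp Z \<phi>], \<psi>)] (\<Gamma>, \<psi>)"
| "rule_instance EqRefl [] (\<Gamma>, Eq x x)"
| "rule_instance (EqSubst x y z \<phi>) [(\<Gamma>, substi x y \<phi>), (\<Gamma>, Eq y z)] (\<Gamma>, substi x z \<phi>)"
| "rule_instance LeRefl [] (\<Gamma>, Le x x)"
| "rule_instance LeTrans [(\<Gamma>, Le x y), (\<Gamma>, Le y z)] (\<Gamma>, Le x z)"
| "rule_instance LeAntisym [(\<Gamma>, Le x y), (\<Gamma>, Le y x)] (\<Gamma>, Eq x y)"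
| "rule_instance ZeroEx [] (\<Gamma>, ExI (Zero 0))"
| "rule_instance ZeroUnique [(\<Gamma>, Zero x), (\<Gamma>, Zero y)] (\<Gamma>, Eq x y)"
| "rule_instance ScEx [] (\<Gamma>, ExI (Sc (Suc x) 0))"
| "rule_instance ScFun [(\<Gamma>, Sc x y), (\<Gamma>, Sc x z)] (\<Gamma>, Eq y z)"
| "rule_instance ScInj [(\<Gamma>, Sc x z), (\<Gamma>, Sc y z)] (\<Gamma>, Eq x y)"
| "rule_instance ScZero [(\<Gamma>, Sc x y), (\<Gamma>, Zero y)] (\<Gamma>, Bot)"
| "rule_instance ScLe [(\<Gamma>, Sc x y)] (\<Gamma>, Le x y)"
| "rule_instance LeSc [(\<Gamma>, Sc y y'), (\<Gamma>, Le x y'), (\<Gamma>, Neg (Eq x y'))] (\<Gamma>, Le x y)"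
| "rule_instance (NegCompr \<psi>) [(\<Gamma>, substp 0 \<psi> \<phi>)] (\<Gamma>, Neg (Neg (ExP \<phi>)))"
| "deterministic \<delta> \<Longrightarrow> y \<noteq> z \<Longrightarrow> fresh_i y (\<delta> # \<Gamma>) \<Longrightarrow> fresh_i z (\<delta> # \<Gamma>) \<Longrightarrow>
     rule_instance (Induct x y z)
       [(\<Gamma> @ [Zero z], substi x z \<delta>), (\<Gamma> @ [Sc y z, substi x y \<delta>], substi x z \<delta>)] (\<Gamma>, \<delta>)"
| "deterministic \<delta> \<Longrightarrow> rule_instance DNE [(\<Gamma>, Neg (Neg \<delta>))] (\<Gamma>, \<delta>)"
| "fvi (relativize (Le 0 1) \<chi>) \<subseteq> {0} \<Longrightarrow>
     rule_instance (SyncCompr \<chi>) [(\<Gamma>, substp 0 (relativize (Le 0 1) \<chi>) \<psi>)] (\<Gamma>, ExP \<psi>)"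

datatype deriv = Infer rule sequent "deriv list"

primrec endsequent :: "deriv \<Rightarrow> sequent" where
  "endsequent (Infer r s ds) = s"

inductive smso_derivation :: "deriv \<Rightarrow> bool" where
  "(\<forall>d\<in>set ds. smso_derivation d) \<Longrightarrow> rule_instance r (map endsequent ds) s \<Longrightarrow>
     smso_derivation (Infer r s ds)"


section \<open>Uniform automata\<close>

text \<open>Omega-regular languages over the alphabet \<open>Q\<close>: nondeterministic Buchi automata.\<close>

definition omega_regular :: "'a set \<Rightarrow> (nat \<Rightarrow> 'a) set \<Rightarrow> bool" where
  "omega_regular Q L \<longleftrightarrow>
     (\<exists>(S :: nat set) I T F. finite S \<and> I \<subseteq> S \<and> T \<subseteq> S \<times> Q \<times> S \<and> F \<subseteq> S \<and>
        L = {w. range w \<subseteq> Q \<and>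
               (\<exists>\<rho>. \<rho> 0 \<in> I \<and> (\<forall>n. (\<rho> n, w n, \<rho> (Suc n)) \<in> T) \<and> infinite {n. \<rho> n \<in> F})})"

text \<open>Elements of the move sets, which are built from 1 and {0,1} by products.\<close>

datatype move = Star | Bit bool | MPair move move

record 'a uaut =
  states :: "nat set"
  init :: nat
  moves :: "move set"
  step :: "nat \<Rightarrow> 'a \<Rightarrow> move \<Rightarrow> nat"
  accepting :: "(nat \<Rightarrow> nat) set"

definition uniform_automaton :: "'a set \<Rightarrow> 'a uaut \<Rightarrow> bool" where
  "uniform_automaton \<Sigma> A \<longleftrightarrow>
     finite (states A) \<and> init A \<in> states A \<and> finite (moves A) \<and> moves A \<noteq> {} \<and>
     (\<forall>q\<in>states A. \<forall>a\<in>\<Sigma>. \<forall>m\<in>moves A. step A q a m \<in> states A) \<and>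
     omega_regular (states A) (accepting A)"

primrec state_seq :: "'a uaut \<Rightarrow> (nat \<Rightarrow> 'a) \<Rightarrow> (nat \<Rightarrow> move) \<Rightarrow> nat \<Rightarrow> nat" where
  "state_seq A w R 0 = init A"
| "state_seq A w R (Suc k) = step A (state_seq A w R k) (w k) (R k)"

definition accepting_run :: "(nat \<Rightarrow> move) \<Rightarrow> 'a uaut \<Rightarrow> (nat \<Rightarrow> 'a) \<Rightarrow> bool" where
  "accepting_run R A w \<longleftrightarrow> range R \<subseteq> moves A \<and> state_seq A w R \<in> accepting A"

definition language :: "'a set \<Rightarrow> 'a uaut \<Rightarrow> (nat \<Rightarrow> 'a) set" where
  "language \<Sigma> A = {w. range w \<subseteq> \<Sigma> \<and> (\<exists>R. accepting_run R A w)}"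

definition sync_product :: "'a uaut \<Rightarrow> 'a uaut \<Rightarrow> 'a uaut" where
  "sync_product A B =
     \<lparr> states = prod_encode ` (states A \<times> states B),
       init = prod_encode (init A, init B),
       moves = {MPair m m' | m m'. m \<in> moves A \<and> m' \<in> moves B},
       step = (\<lambda>q a m. case (prod_decode q, m) of
                  ((p, p'), MPair m1 m2) \<Rightarrow> prod_encode (step A p a m1, step B p' a m2)
                | _ \<Rightarrow> q),
       accepting = {\<rho>. (\<lambda>n. fst (prod_decode (\<rho> n))) \<in> accepting A \<and>
                       (\<lambda>n. snd (prod_decode (\<rho> n))) \<in> accepting B} \<rparr>"


section \<open>Interpretation of formulae\<close>

type_synonym letter = "bool list \<times> bool list"

definition alphabet :: "nat \<Rightarrow> nat \<Rightarrow> letter set" where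
  "alphabet l p = {(xs, Xs). length xs = l \<and> length Xs = p}"

text \<open>The tuple of streams (k, \<sigma>) as a stream of tuples; a number k is the stream which is 1
  exactly at position k.\<close>

definition word :: "nat list \<Rightarrow> (nat \<Rightarrow> bool) list \<Rightarrow> nat \<Rightarrow> letter" where
  "word ks \<sigma>s n = (map (\<lambda>k. n = k) ks, map (\<lambda>\<sigma>. \<sigma> n) \<sigma>s)"

definition project_ind :: "letter uaut \<Rightarrow> letter uaut" where
  "project_ind A =
     A \<lparr> moves := {MPair (Bit b) m | b m. m \<in> moves A},
         step := (\<lambda>q (xs, Xs) m. case m of
                     MPair (Bit b) m' \<Rightarrow> step A q (b # xs, Xs) m' | _ \<Rightarrow> q) \<rparr>"

definition project_pred :: "letter uaut \<Rightarrow> letter uaut" where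
  "project_pred A =
     A \<lparr> moves := {MPair (Bit b) m | b m. m \<in> moves A},
         step := (\<lambda>q (xs, Xs) m. case m of
                     MPair (Bit b) m' \<Rightarrow> step A q (xs, b # Xs) m' | _ \<Rightarrow> q) \<rparr>"

definition det_automaton :: "nat \<Rightarrow> nat \<Rightarrow> letter uaut \<Rightarrow> bool" where
  "det_automaton l p A \<longleftrightarrow> uniform_automaton (alphabet l p) A \<and> moves A = {Star}"

definition atom_automaton ::
  "nat \<Rightarrow> nat \<Rightarrow> (nat list \<Rightarrow> (nat \<Rightarrow> bool) list \<Rightarrow> bool) \<Rightarrow> letter uaut \<Rightarrow> bool" where
  "atom_automaton l p P A \<longleftrightarrow> det_automaton l p A \<and>
     (\<forall>ks \<sigma>s. length ks = l \<and> length \<sigma>s = p \<longrightarrow>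
        (word ks \<sigma>s \<in> language (alphabet l p) A \<longleftrightarrow> P ks \<sigma>s))"

definition singleton_automaton :: "nat \<Rightarrow> nat \<Rightarrow> letter uaut \<Rightarrow> bool" where
  "singleton_automaton l p A \<longleftrightarrow> det_automaton (Suc l) p A \<and>
     language (alphabet (Suc l) p) A =
       {w. range w \<subseteq> alphabet (Suc l) p \<and> (\<exists>k. \<forall>n. hd (fst (w n)) \<longleftrightarrow> n = k)}"

text \<open>
  \<open>interp \<phi> l p A\<close>: A is an automaton I[\<phi>] over {0,1}^l \<times> {0,1}^p.  The automata for atoms and
  negations are only specified up to the words they accept, so this is a relation.  Variables
  bound by a quantifier are added at the front of the context, as index 0.
\<close>

primrec interp :: "form \<Rightarrow> nat \<Rightarrow> nat \<Rightarrow> letter uaut \<Rightarrow> bool" where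
  "interp (Eq x y) l p A = atom_automaton l p (\<lambda>ks \<sigma>s. ks ! x = ks ! y) A"
| "interp (Le x y) l p A = atom_automaton l p (\<lambda>ks \<sigma>s. ks ! x \<le> ks ! y) A"
| "interp (Sc x y) l p A = atom_automaton l p (\<lambda>ks \<sigma>s. ks ! y = Suc (ks ! x)) A"
| "interp (Zero x) l p A = atom_automaton l p (\<lambda>ks \<sigma>s. ks ! x = 0) A"
| "interp (Mem x X) l p A = atom_automaton l p (\<lambda>ks \<sigma>s. (\<sigma>s ! X) (ks ! x)) A"
| "interp Top l p A = atom_automaton l p (\<lambda>ks \<sigma>s. True) A"
| "interp Bot l p A = atom_automaton l p (\<lambda>ks \<sigma>s. False) A"
| "interp (And \<phi> \<psi>) l p A = (\<exists>B C. interp \<phi> l p B \<and> interp \<psi> l p C \<and> A = sync_product B C)"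
| "interp (Neg \<phi>) l p A =
     (\<exists>B. interp \<phi> l p B \<and> det_automaton l p A \<and>
        language (alphabet l p) A =
          {w. range w \<subseteq> alphabet l p \<and> w \<notin> language (alphabet l p) B})"
| "interp (ExI \<phi>) l p A =
     (\<exists>S B. singleton_automaton l p S \<and> interp \<phi> (Suc l) p B \<and>
        A = project_ind (sync_product S B))"
| "interp (ExP \<phi>) l p A = (\<exists>B. interp \<phi> l (Suc p) B \<and> A = project_pred B)"

text \<open>The move set M(\<phi>).\<close>

primrec M :: "form \<Rightarrow> move set" where
  "M (Eq x y) = {Star}"
| "M (Le x y) = {Star}"
| "M (Sc x y) = {Star}"
| "M (Zero x) = {Star}"
| "M (Mem x X) = {Star}"
| "M Top = {Star}"
| "M Bot = {Star}"
| "M (And \<phi> \<psi>) = {MPair m m' | m m'. m \<in> M \<phi> \<and> m' \<in> M \<psi>}"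
| "M (Neg \<phi>) = {Star}"
| "M (ExI \<phi>) = {MPair (Bit b) (MPair Star m) | b m. m \<in> M \<phi>}"
| "M (ExP \<phi>) = {MPair (Bit b) m | b m. m \<in> M \<phi>}"


section \<open>Finite-state synchronous functions\<close>

text \<open>Deterministic Mealy machines as finite objects: the transition function is a finite table.\<close>

record ('a, 'b) mealy =
  mstates :: "nat list"
  minit :: nat
  mtable :: "((nat \<times> 'a) \<times> (nat \<times> 'b)) list"

definition mtrans :: "('a, 'b) mealy \<Rightarrow> nat \<Rightarrow> 'a \<Rightarrow> nat \<times> 'b" where
  "mtrans m q a = the (map_of (mtable m) (q, a))"

definition mealy_machine :: "'a set \<Rightarrow> 'b set \<Rightarrow> ('a, 'b) mealy \<Rightarrow> bool" where
  "mealy_machine \<Sigma> \<Gamma> m \<longleftrightarrow>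
     minit m \<in> set (mstates m) \<and>
     (\<forall>q\<in>set (mstates m). \<forall>a\<in>\<Sigma>.
        \<exists>q'\<in>set (mstates m). \<exists>b\<in>\<Gamma>. map_of (mtable m) (q, a) = Some (q', b))"

primrec mstate_seq :: "('a, 'b) mealy \<Rightarrow> (nat \<Rightarrow> 'a) \<Rightarrow> nat \<Rightarrow> nat" where
  "mstate_seq m w 0 = minit m"
| "mstate_seq m w (Suc n) = fst (mtrans m (mstate_seq m w n) (w n))"

definition mealy_fun :: "('a, 'b) mealy \<Rightarrow> (nat \<Rightarrow> 'a) \<Rightarrow> nat \<Rightarrow> 'b" where
  "mealy_fun m w n = snd (mtrans m (mstate_seq m w n) (w n))"


section \<open>Realizability\<close>

type_synonym input = "bool list \<times> bool list \<times> move list \<times> move list"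

text \<open>The alphabet {0,1}^l \<times> {0,1}^p \<times> 1^l \<times> M(\<phi>1) \<times> ... \<times> M(\<phi>n).\<close>

definition inputs :: "nat \<Rightarrow> nat \<Rightarrow> form list \<Rightarrow> input set" where
  "inputs l p \<Gamma> =
     {(xs, Xs, us, ms). length xs = l \<and> length Xs = p \<and> us = replicate l Star \<and>
        list_all2 (\<lambda>m \<phi>. m \<in> M \<phi>) ms \<Gamma>}"

definition input_stream ::
  "nat list \<Rightarrow> (nat \<Rightarrow> bool) list \<Rightarrow> (nat \<Rightarrow> move) list \<Rightarrow> nat \<Rightarrow> input" where
  "input_stream ks \<sigma>s Rs n =
     (map (\<lambda>k. n = k) ks, map (\<lambda>\<sigma>. \<sigma> n) \<sigma>s, replicate (length ks) Star, map (\<lambda>R. R n) Rs)"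

definition realizes ::
  "nat \<Rightarrow> nat \<Rightarrow> form list \<Rightarrow> ((nat \<Rightarrow> input) \<Rightarrow> nat \<Rightarrow> move) \<Rightarrow> form \<Rightarrow> bool" where
  "realizes l p \<Gamma> F \<phi> \<longleftrightarrow>
     (\<forall>As A. list_all2 (\<lambda>\<psi> B. interp \<psi> l p B) \<Gamma> As \<and> interp \<phi> l p A \<longrightarrow>
        (\<forall>ks \<sigma>s Rs. length ks = l \<and> length \<sigma>s = p \<and>
             list_all2 (\<lambda>R B. accepting_run R B (word ks \<sigma>s)) Rs As \<longrightarrow>
           accepting_run (F (input_stream ks \<sigma>s Rs)) A (word ks \<sigma>s)))"


section \<open>Computability\<close>

text \<open>Kleene's partial recursive functions and their graphs.\<close>

datatype recf =
    Zero_fn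
  | Suc_fn
  | Proj nat
  | Comp recf "recf list"
  | PrimRec recf recf
  | Mu recf

inductive computes :: "recf \<Rightarrow> nat list \<Rightarrow> nat \<Rightarrow> bool" where
  "computes Zero_fn xs 0"
| "computes Suc_fn [x] (Suc x)"
| "i < length xs \<Longrightarrow> computes (Proj i) xs (xs ! i)"
| "length ys = length gs \<Longrightarrow> (\<forall>i<length gs. computes (gs ! i) xs (ys ! i)) \<Longrightarrow>
     computes f ys z \<Longrightarrow> computes (Comp f gs) xs z"
| "computes f xs z \<Longrightarrow> computes (PrimRec f g) (0 # xs) z"
| "computes (PrimRec f g) (n # xs) y \<Longrightarrow> computes g (n # y # xs) z \<Longrightarrow>
     computes (PrimRec f g) (Suc n # xs) z"
| "computes f (n # xs) 0 \<Longrightarrow> (\<forall>i<n. \<exists>y. computes f (i # xs) (Suc y)) \<Longrightarrow>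
     computes (Mu f) xs n"

text \<open>Goedel numberings of derivations and of Mealy machines.\<close>

primrec code_form :: "form \<Rightarrow> nat" where
  "code_form (Eq x y) = list_encode [0, x, y]"
| "code_form (Le x y) = list_encode [1, x, y]"
| "code_form (Sc x y) = list_encode [2, x, y]"
| "code_form (Zero x) = list_encode [3, x]"
| "code_form (Mem x X) = list_encode [4, x, X]"
| "code_form Top = list_encode [5]"
| "code_form Bot = list_encode [6]"
| "code_form (And \<phi> \<psi>) = list_encode [7, code_form \<phi>, code_form \<psi>]"
| "code_form (Neg \<phi>) = list_encode [8, code_form \<phi>]"
| "code_form (ExI \<phi>) = list_encode [9, code_form \<phi>]"
| "code_form (ExP \<phi>) = list_encode [10, code_form \<phi>]"

primrec code_rule :: "rule \<Rightarrow> nat" where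
  "code_rule Ax = list_encode [0]"
| "code_rule Cut = list_encode [1]"
| "code_rule NegI = list_encode [2]"
| "code_rule NegE = list_encode [3]"
| "code_rule AndI = list_encode [4]"
| "code_rule AndE1 = list_encode [5]"
| "code_rule AndE2 = list_encode [6]"
| "code_rule (ExII t) = list_encode [7, t]"
| "code_rule (ExIE z) = list_encode [8, z]"
| "code_rule (ExPI Y) = list_encode [9, Y]"
| "code_rule (ExPE Z) = list_encode [10, Z]"
| "code_rule EqRefl = list_encode [11]"
| "code_rule (EqSubst x y z \<phi>) = list_encode [12, x, y, z, code_form \<phi>]"
| "code_rule LeRefl = list_encode [13]"
| "code_rule LeTrans = list_encode [14]"
| "code_rule LeAntisym = list_encode [15]"
| "code_rule ZeroEx = list_encode [16]"
| "code_rule ZeroUnique = list_encode [17]"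
| "code_rule ScEx = list_encode [18]"
| "code_rule ScFun = list_encode [19]"
| "code_rule ScInj = list_encode [20]"
| "code_rule ScZero = list_encode [21]"
| "code_rule ScLe = list_encode [22]"
| "code_rule LeSc = list_encode [23]"
| "code_rule (NegCompr \<psi>) = list_encode [24, code_form \<psi>]"
| "code_rule (Induct x y z) = list_encode [25, x, y, z]"
| "code_rule DNE = list_encode [26]"
| "code_rule (SyncCompr \<chi>) = list_encode [27, code_form \<chi>]"

definition code_sequent :: "sequent \<Rightarrow> nat" where
  "code_sequent s = list_encode [list_encode (map code_form (fst s)), code_form (snd s)]"

primrec code_deriv :: "deriv \<Rightarrow> nat" where
  "code_deriv (Infer r s ds) =
     list_encode [code_rule r, code_sequent s, list_encode (map code_deriv ds)]"

primrec code_move :: "move \<Rightarrow> nat" where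
  "code_move Star = list_encode [0]"
| "code_move (Bit b) = list_encode [1, of_bool b]"
| "code_move (MPair m m') = list_encode [2, code_move m, code_move m']"

fun code_input :: "input \<Rightarrow> nat" where
  "code_input (xs, Xs, us, ms) =
     list_encode [list_encode (map of_bool xs), list_encode (map of_bool Xs),
                  list_encode (map code_move us), list_encode (map code_move ms)]"

definition code_mealy :: "(input, move) mealy \<Rightarrow> nat" where
  "code_mealy m =
     list_encode [list_encode (mstates m), minit m,
       list_encode (map (\<lambda>((q, a), (q', b)). list_encode [q, code_input a, q', code_move b])
                        (mtable m))]"

end

theory Submission
  imports Defs
begin

text \<open>
  A derivation is turned into a Mealy machine by recursion: the rules of intuitionistic logic
  translate into composition, pairing and projection of machines, and the rules with a deterministic
  conclusion need no computation, since deterministic formulae have only one possible run.  The only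
  rule that needs a genuine construction is synchronous comprehension.  There the witness is
  defined by a formula in which all individuals are bounded by the current position, so its value is
  computed by a finite automaton reading the word seen so far.

  Correctness does not mention automata on infinite words: whether a run of an interpretation of
  \<phi> is accepting depends only on a predicate defined by recursion on \<phi>, which says that the run
  contains true witnesses.

  For computability, a function on encoded data is computable if it has a recursive definition in
  terms of computable functions, because the value of a recursive function can be found by searching
  for a finite table of values which justify one another.
\<close>

section \<open>Recursive functions\<close>

text \<open>A derivation may pass through formulae with variables outside the given context, by cuts
  or eigenvariables. Machines are therefore not tied to a context: an environment gives a bit to
  every variable, and at the top level the variables that are not listed denote 0 or the empty set.
  One extra state component marks the first letter, the only one at which the number 0 shows a 1.

  The interpretation has two layers. Witnesses are carried by runs, but the automaton of a negation
  recognizes a complement and so speaks of classical truth. The layers are linked because every true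
  formula has some run, found by choice and possibly dependent on the future of the input.
  Induction, double negation elimination and negative comprehension can thus be verified
  classically.

  Replacing a predicate variable by a formula transports runs in one direction, from the substituted
  formula to the original one, and this is the direction that synchronous comprehension uses.

  Machines are defined for arbitrary trees of sequents, so that extraction is a total function on
  trees and never has to check a derivation.\<close>

definition prc :: "nat \<Rightarrow> (nat list \<Rightarrow> nat) \<Rightarrow> bool" where
  "prc k f \<longleftrightarrow> (\<exists>r. \<forall>xs. length xs = k \<longrightarrow> computes r xs (f xs))"

text \<open>Most of what follows uses unary functions, with several arguments packed into a pair
  code. Like \<open>prc\<close>, the notion covers every total function that has a program,
  unbounded search included.\<close>

definition trec :: "(nat \<Rightarrow> nat) \<Rightarrow> bool" where
  "trec g \<longleftrightarrow> (\<exists>r. \<forall>x. computes r [x] (g x))"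

lemma prc_0: "prc k (\<lambda>xs. 0)"
  unfolding prc_def using computes.intros(1) by blast

lemma prc_nth: "i < k \<Longrightarrow> prc k (\<lambda>xs. xs ! i)"
  unfolding prc_def using computes.intros(3) by blast

lemma prc_comp1:
  assumes "prc 1 (\<lambda>ys. f (ys ! 0))" "prc k g"
  shows "prc k (\<lambda>xs. f (g xs))"
proof -
  obtain r s where r: "\<And>xs. length xs = 1 \<Longrightarrow> computes r xs (f (xs ! 0))"
    and s: "\<And>xs. length xs = k \<Longrightarrow> computes s xs (g xs)"
    using assms unfolding prc_def by blast
  have "computes (Comp r [s]) xs (f (g xs))" if "length xs = k" for xs
    using r[of "[g xs]"] s[OF that] by (intro computes.intros(4)[of "[g xs]"]) auto
  then show ?thesis unfolding prc_def by blast
qed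

lemma prc_comp2:
  assumes "prc 2 (\<lambda>ys. f (ys ! 0) (ys ! 1))" "prc k g" "prc k h"
  shows "prc k (\<lambda>xs. f (g xs) (h xs))"
proof -
  obtain r s t where r: "\<And>xs. length xs = 2 \<Longrightarrow> computes r xs (f (xs ! 0) (xs ! 1))"
    and s: "\<And>xs. length xs = k \<Longrightarrow> computes s xs (g xs)"
    and t: "\<And>xs. length xs = k \<Longrightarrow> computes t xs (h xs)"
    using assms unfolding prc_def by blast
  have "computes (Comp r [s, t]) xs (f (g xs) (h xs))" if "length xs = k" for xs
    using r[of "[g xs, h xs]"] s[OF that] t[OF that]
    by (intro computes.intros(4)[of "[g xs, h xs]"]) (auto simp: less_Suc_eq)
  then show ?thesis unfolding prc_def by blast
qed

lemma prc_Suc: "prc k g \<Longrightarrow> prc k (\<lambda>xs. Suc (g xs))"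
proof (rule prc_comp1[where f = Suc])
  show "prc 1 (\<lambda>ys. Suc (ys ! 0))"
    unfolding prc_def
  proof (intro exI[of _ Suc_fn] allI impI)
    fix xs :: "nat list"
    assume "length xs = 1"
    then show "computes Suc_fn xs (Suc (xs ! 0))"
      using computes.intros(2) by (cases xs) auto
  qed
qed

lemma prc_const: "prc k (\<lambda>xs. c)"
  by (induction c) (auto intro: prc_0 prc_Suc)

lemma prc_rec1:
  assumes "prc 1 (\<lambda>xs. g (xs ! 0))" "prc 3 (\<lambda>xs. h (xs ! 0) (xs ! 1) (xs ! 2))"
  shows "prc 2 (\<lambda>xs. rec_nat (g (xs ! 1)) (\<lambda>n y. h n y (xs ! 1)) (xs ! 0))"
proof -
  obtain r s where r: "\<And>xs. length xs = 1 \<Longrightarrow> computes r xs (g (xs ! 0))"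
    and s: "\<And>xs. length xs = 3 \<Longrightarrow> computes s xs (h (xs ! 0) (xs ! 1) (xs ! 2))"
    using assms unfolding prc_def by blast
  have *: "computes (PrimRec r s) [n, x] (rec_nat (g x) (\<lambda>n y. h n y x) n)" for n x
  proof (induction n)
    case 0
    then show ?case using r[of "[x]"] by (auto intro: computes.intros)
  next
    case (Suc n)
    then show ?case using s[of "[n, rec_nat (g x) (\<lambda>n y. h n y x) n, x]"]
      by (auto intro: computes.intros)
  qed
  show ?thesis unfolding prc_def
  proof (intro exI[of _ "PrimRec r s"] allI impI)
    fix xs :: "nat list"
    assume "length xs = 2"
    then obtain n x where "xs = [n, x]"
      by (metis One_nat_def Suc_1 length_0_conv length_Suc_conv)
    then show "computes (PrimRec r s) xs
      (rec_nat (g (xs ! 1)) (\<lambda>n y. h n y (xs ! 1)) (xs ! 0))" using * by simp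
  qed
qed

lemma prc_add: "prc k f \<Longrightarrow> prc k g \<Longrightarrow> prc k (\<lambda>xs. f xs + g xs)"
proof (rule prc_comp2[where f = "(+)"])
  have "rec_nat x (\<lambda>n y. Suc y) m = m + x" for m x
    by (induction m) auto
  then show "prc 2 (\<lambda>ys. ys ! 0 + ys ! 1)"
    using prc_rec1[of "\<lambda>x. x" "\<lambda>n y x. Suc y"] by (simp add: prc_nth prc_Suc)
qed

lemma prc_pred: "prc k f \<Longrightarrow> prc k (\<lambda>xs. f xs - 1)"
proof (rule prc_comp1[where f = "\<lambda>x. x - 1"])
  have "rec_nat 0 (\<lambda>n y. n) m = m - 1" for m :: nat
    by (cases m) auto
  then have "prc 2 (\<lambda>ys. ys ! 0 - 1)"
    using prc_rec1[of "\<lambda>x. 0" "\<lambda>n y x. n"] by (simp add: prc_nth prc_0)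
  from prc_comp2[OF this prc_nth prc_nth, of 0 1 0]
  show "prc 1 (\<lambda>ys. ys ! 0 - 1)" by simp
qed

lemma prc_diff: "prc k f \<Longrightarrow> prc k g \<Longrightarrow> prc k (\<lambda>xs. f xs - g xs)"
proof (rule prc_comp2[where f = "(-)"])
  have "rec_nat x (\<lambda>n y. y - 1) m = x - m" for m x :: nat
    by (induction m) auto
  then have "prc 2 (\<lambda>ys. ys ! 1 - ys ! 0)"
    using prc_rec1[of "\<lambda>x. x" "\<lambda>n y x. y - 1"] prc_pred[OF prc_nth, of 1 3]
    by (simp add: prc_nth)
  from prc_comp2[OF this prc_nth prc_nth, of 1 2 0]
  show "prc 2 (\<lambda>ys. ys ! 0 - ys ! 1)" by simp
qed

lemma prc_triangle: "prc k f \<Longrightarrow> prc k (\<lambda>xs. triangle (f xs))"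
proof (rule prc_comp1[where f = triangle])
  have "rec_nat 0 (\<lambda>n y. y + Suc n) m = triangle m" for m
    by (induction m) auto
  then have "prc 2 (\<lambda>ys. triangle (ys ! 0))"
    using prc_rec1[of "\<lambda>x. 0" "\<lambda>n y x. y + Suc n"]
      prc_add[OF prc_nth prc_Suc[OF prc_nth], of 1 3 0]
    by (simp add: prc_0)
  from prc_comp2[OF this prc_nth prc_nth, of 0 1 0]
  show "prc 1 (\<lambda>ys. triangle (ys ! 0))" by simp
qed

lemma trec_prc: "trec f \<longleftrightarrow> prc 1 (\<lambda>xs. f (xs ! 0))"
proof
  assume "trec f"
  then obtain r where r: "\<And>x. computes r [x] (f x)" unfolding trec_def by blast
  show "prc 1 (\<lambda>xs. f (xs ! 0))" unfolding prc_def
  proof (intro exI[of _ r] allI impI)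
    fix xs :: "nat list"
    assume "length xs = 1"
    then show "computes r xs (f (xs ! 0))" using r by (cases xs) auto
  qed
next
  assume "prc 1 (\<lambda>xs. f (xs ! 0))"
  then obtain r where "\<And>xs. length xs = 1 \<Longrightarrow> computes r xs (f (xs ! 0))"
    unfolding prc_def by blast
  from this[of "[_]"] show "trec f" unfolding trec_def by auto
qed

section \<open>Pairing and total unary functions\<close>

abbreviation pair_code :: "nat \<Rightarrow> nat \<Rightarrow> nat" ("\<langle>_,/ _\<rangle>") where
  "\<langle>a, b\<rangle> \<equiv> prod_encode (a, b)"

definition pfst :: "nat \<Rightarrow> nat" where "pfst n = fst (prod_decode n)"

definition psnd :: "nat \<Rightarrow> nat" where "psnd n = snd (prod_decode n)"

lemma pfst_pair [simp]: "pfst \<langle>a, b\<rangle> = a" by (simp add: pfst_def)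

lemma psnd_pair [simp]: "psnd \<langle>a, b\<rangle> = b" by (simp add: psnd_def)

lemma pair_pfst_psnd [simp]: "\<langle>pfst n, psnd n\<rangle> = n" by (simp add: pfst_def psnd_def)

lemma prc_pair: "prc k f \<Longrightarrow> prc k g \<Longrightarrow> prc k (\<lambda>xs. \<langle>f xs, g xs\<rangle>)"
  unfolding prod_encode_def by (simp add: prc_add prc_triangle)

lemma trec_pair: "trec f \<Longrightarrow> trec g \<Longrightarrow> trec (\<lambda>x. \<langle>f x, g x\<rangle>)"
  unfolding trec_prc by (rule prc_pair)

text \<open>The number \<open>\<langle>a, b\<rangle>\<close> lies on the diagonal \<open>a + b\<close>, which is found by unbounded search.\<close>

lemma trec_diagonal: "trec (\<lambda>n. pfst n + psnd n)"
proof -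
  \<comment> \<open>\<open>Suc n - triangle (Suc i)\<close> vanishes exactly when
    \<open>n < triangle (Suc i)\<close>, and the least such \<open>i\<close> is the diagonal of
    \<open>n\<close>.\<close>
  have "prc 2 (\<lambda>xs. Suc (xs ! 1) - triangle (Suc (xs ! 0)))"
    by (intro prc_diff prc_Suc prc_triangle prc_nth) auto
  then obtain r where r: "\<And>xs. length xs = 2 \<Longrightarrow>
      computes r xs (Suc (xs ! 1) - triangle (Suc (xs ! 0)))"
    unfolding prc_def by blast
  have "computes (Mu r) [n] (pfst n + psnd n)" for n
  proof (rule computes.intros(7))
    obtain a b where n: "n = \<langle>a, b\<rangle>" by (metis pair_pfst_psnd)
    have "Suc n - triangle (Suc (a + b)) = 0" by (simp add: n prod_encode_def)
    then show "computes r [pfst n + psnd n, n] 0" using r[of "[a + b, n]"] by (simp add: n)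
    have "Suc n - triangle (Suc i) > 0" if "i < a + b" for i
    proof -
      have "triangle (Suc i) \<le> triangle (a + b)"
        unfolding triangle_def using that by (intro div_le_mono mult_le_mono) auto
      then show ?thesis by (simp add: n prod_encode_def)
    qed
    then have "\<exists>y. computes r [i, n] (Suc y)" if "i < a + b" for i
      using r[of "[i, n]"] gr0_implies_Suc[of "Suc n - triangle (Suc i)"] that by fastforce
    then show "\<forall>i<pfst n + psnd n. \<exists>y. computes r [i, n] (Suc y)"
      by (simp add: n)
  qed
  then show ?thesis unfolding trec_def by blast
qed

lemma trec_id: "trec (\<lambda>x. x)"
  by (simp add: trec_prc prc_nth)

lemma trec_const: "trec (\<lambda>x. c)"
  by (simp add: trec_prc prc_const)

lemma trec_Suc: "trec f \<Longrightarrow> trec (\<lambda>x. Suc (f x))"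
  by (simp add: trec_prc prc_Suc)

lemma trec_comp: "trec g \<Longrightarrow> trec f \<Longrightarrow> trec (\<lambda>x. g (f x))"
  unfolding trec_prc by (rule prc_comp1)

lemma trec_add: "trec f \<Longrightarrow> trec g \<Longrightarrow> trec (\<lambda>x. f x + g x)"
  unfolding trec_prc by (rule prc_add)

lemma trec_diff: "trec f \<Longrightarrow> trec g \<Longrightarrow> trec (\<lambda>x. f x - g x)"
  unfolding trec_prc by (rule prc_diff)

lemma trec_pfst: "trec f \<Longrightarrow> trec (\<lambda>x. pfst (f x))"
proof (rule trec_comp[where g = pfst])
  have "pfst = (\<lambda>n. n - triangle (pfst n + psnd n))"
  proof
    fix n
    have "n = triangle (pfst n + psnd n) + pfst n"
      by (subst (1) pair_pfst_psnd[of n, symmetric]) (simp only: prod_encode_def prod.case)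
    then show "pfst n = n - triangle (pfst n + psnd n)" by linarith
  qed
  moreover have "trec (\<lambda>n. n - triangle (pfst n + psnd n))"
    using trec_diagonal unfolding trec_prc by (intro prc_diff prc_triangle prc_nth) auto
  ultimately show "trec pfst" by metis
qed

lemma trec_psnd: "trec f \<Longrightarrow> trec (\<lambda>x. psnd (f x))"
proof (rule trec_comp[where g = psnd])
  have "trec (\<lambda>n. (pfst n + psnd n) - pfst n)"
    by (intro trec_diff trec_diagonal trec_pfst trec_id)
  then show "trec psnd" by simp
qed

text \<open>The parameter \<open>e x\<close> may itself be a pair code, so a single parameter serves
  closures over several values.\<close>

lemma trec_rec:
  assumes "trec g" "trec (\<lambda>x. h (pfst x) (pfst (psnd x)) (psnd (psnd x)))" "trec c" "trec e"
  shows "trec (\<lambda>x. rec_nat (g (e x)) (\<lambda>n y. h n y (e x)) (c x))"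
proof -
  have "prc 3 (\<lambda>xs. h (xs ! 0) (xs ! 1) (xs ! 2))"
    using prc_comp1[OF assms(2)[unfolded trec_prc]
        prc_pair[OF prc_nth prc_pair[OF prc_nth prc_nth]], of 0 3 1 2]
    by simp
  from prc_rec1[OF assms(1)[unfolded trec_prc] this]
  have "prc 2 (\<lambda>xs. rec_nat (g (xs ! 1)) (\<lambda>n y. h n y (xs ! 1)) (xs ! 0))" .
  from prc_comp2[OF this assms(3,4)[unfolded trec_prc]] show ?thesis
    unfolding trec_prc by simp
qed

lemma trec_if0:
  assumes "trec c" "trec f" "trec g"
  shows "trec (\<lambda>x. if c x = 0 then f x else g x)"
proof -
  \<comment> \<open>A case distinction is a recursion whose step ignores the previous value.\<close>
  have "trec (\<lambda>x. rec_nat (pfst (\<langle>f x, g x\<rangle>)) (\<lambda>n y. psnd (\<langle>f x, g x\<rangle>)) (c x))"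
    by (rule trec_rec[of pfst "\<lambda>n y e. psnd e"])
      (intro trec_pfst trec_psnd trec_id trec_pair assms)+
  moreover have "rec_nat a (\<lambda>n y. b) n = (if n = 0 then a else b)" for a b n :: nat
    by (cases n) auto
  ultimately show ?thesis by simp
qed

lemma trec_if_eq:
  assumes "trec a" "trec b" "trec f" "trec g"
  shows "trec (\<lambda>x. if a x = b x then f x else g x)"
proof -
  have "trec (\<lambda>x. if (a x - b x) + (b x - a x) = 0 then f x else g x)"
    by (intro trec_if0 trec_add trec_diff assms)
  moreover have "(m - n) + (n - m) = 0 \<longleftrightarrow> m = n" for m n :: nat by auto
  ultimately show ?thesis by simp
qed

lemmas trec_intros = trec_id trec_const trec_Suc trec_pair trec_pfst trec_psnd trec_if_eq

section \<open>Loops over coded lists\<close>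

text \<open>The step function sees the code of the whole remaining list, not only of its head.\<close>

fun lfold :: "(nat \<Rightarrow> nat \<Rightarrow> nat) \<Rightarrow> nat \<Rightarrow> nat list \<Rightarrow> nat" where
  "lfold f a [] = a"
| "lfold f a (x # xs) = lfold f (f (list_encode (x # xs)) a) xs"

lemma length_le_list_encode: "length xs \<le> list_encode xs"
  by (induction xs) (auto intro: order_trans le_prod_encode_2)

text \<open>The loop runs for as many rounds as the code of the list, which bounds its length by
  \<open>length_le_list_encode\<close>. Its state \<open>st\<close> pairs the code of the remaining
  list with the accumulator and no longer changes once the list is exhausted, so surplus rounds are
  harmless.\<close>

lemma trec_lfold:
  assumes f: "trec (\<lambda>x. f (pfst x) (pfst (psnd x)) (psnd (psnd x)))"
    and a: "trec a" and l: "trec l" and e: "trec e"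
  shows "trec (\<lambda>x. lfold (\<lambda>xs y. f xs y (e x)) (a x) (list_decode (l x)))"
proof -
  define st where "st e s = (if pfst s = 0 then s else
      \<langle>psnd (pfst s - 1), f (pfst s) (psnd s) e\<rangle>)" for e s
  have pred: "trec (\<lambda>x. g x - 1)" if "trec g" for g
    using that by (intro trec_diff trec_const)
  have st: "trec (\<lambda>x. st (psnd x) (pfst x))" unfolding st_def
    using trec_comp[OF f, of "\<lambda>x. \<langle>pfst (pfst x), \<langle>psnd (pfst x), psnd x\<rangle>\<rangle>"]
    by (intro trec_intros pred trec_if0) (simp_all add: trec_intros)
  have "trec (\<lambda>x. rec_nat (pfst (\<langle>\<langle>l x, a x\<rangle>, e x\<rangle>))
    (\<lambda>n y. st (psnd (\<langle>\<langle>l x, a x\<rangle>, e x\<rangle>)) y) (l x))"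
    using trec_comp[OF st, of "\<lambda>x. \<langle>pfst (psnd x), psnd (psnd (psnd x))\<rangle>"]
    by (intro trec_rec[of pfst "\<lambda>n y e. st (psnd e) y"] trec_intros l a e) (simp_all add: trec_intros)
  then have "trec (\<lambda>x. psnd (rec_nat \<langle>l x, a x\<rangle> (\<lambda>n y. st (e x) y) (l x)))"
    by (auto intro: trec_psnd)
  moreover have "psnd (rec_nat \<langle>list_encode xs, b\<rangle> (\<lambda>n y. st d y) n) = lfold (\<lambda>xs y. f xs y d) b xs"
    if "length xs \<le> n" for n xs b d
  proof -
    have shift: "rec_nat s (\<lambda>n y. st d y) (Suc n) = rec_nat (st d s) (\<lambda>n y. st d y) n" for s n
      by (induction n) auto
    have end_: "rec_nat \<langle>0, b\<rangle> (\<lambda>n y. st d y) n = \<langle>0, b\<rangle>" for n b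
      by (induction n) (auto simp: st_def)
    show ?thesis using that
    proof (induction n arbitrary: xs b)
      case 0
      then show ?case by simp
    next
      case (Suc n)
      show ?case
      proof (cases xs)
        case Nil
        then show ?thesis by (simp only: list_encode.simps end_ psnd_pair lfold.simps)
      next
        case (Cons y ys)
        then have "length ys \<le> n" using Suc.prems by simp
        moreover have "st d \<langle>list_encode xs, b\<rangle> = \<langle>list_encode ys, f (list_encode xs) b d\<rangle>"
          by (simp add: st_def Cons)
        ultimately show ?thesis unfolding shift by (simp only: Cons Suc.IH lfold.simps)
      qed
    qed
  qed
  from this[OF length_le_list_encode, of "list_decode (l _)" "a _" "e _"]
  have "psnd (rec_nat \<langle>l x, a x\<rangle> (\<lambda>n y. st (e x) y) (l x)) =
    lfold (\<lambda>xs y. f xs y (e x)) (a x) (list_decode (l x))" for x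
    by (metis list_decode_inverse)
  ultimately show ?thesis by simp
qed

section \<open>Computability on encoded datatypes\<close>

text \<open>
  An encoding of a datatype need not be surjective, and a recursion started at a number that is not
  a code need not terminate.  Computability is therefore expressed by total approximations: with
  fuel \<open>n\<close>, the approximation returns either 0 or the successor of the code of the value, and the
  latter whenever \<open>n\<close> is large enough.
\<close>

class enc =
  fixes enc :: "'a \<Rightarrow> nat"

instantiation nat :: enc begin
definition enc_nat :: "nat \<Rightarrow> nat" where [simp]: "enc_nat n = n"
instance ..
end

instantiation bool :: enc begin
definition enc_bool :: "bool \<Rightarrow> nat" where [simp]: "enc_bool b = of_bool b"
instance ..
end

instantiation prod :: (enc, enc) enc begin
definition enc_prod :: "'a \<times> 'b \<Rightarrow> nat" where [simp]: "enc_prod x = \<langle>enc (fst x), enc (snd x)\<rangle>"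
instance ..
end

instantiation list :: (enc) enc begin
definition enc_list :: "'a list \<Rightarrow> nat" where [simp]: "enc_list xs = list_encode (map enc xs)"
instance ..
end

definition computable :: "('a::enc \<Rightarrow> 'b::enc) \<Rightarrow> bool" where
  "computable f \<longleftrightarrow> (\<exists>g. trec g \<and> (\<forall>x. \<exists>n0. \<forall>n.
     (g \<langle>n, enc x\<rangle> = 0 \<or> g \<langle>n, enc x\<rangle> = Suc (enc (f x))) \<and> (n \<ge> n0 \<longrightarrow> g \<langle>n, enc x\<rangle> \<noteq> 0)))"

lemma computable_code:
  assumes "trec g" "\<And>x. g (enc x) = enc (f x)"
  shows "computable f"
  unfolding computable_def
proof (intro exI[of _ "\<lambda>x. Suc (g (psnd x))"] conjI)
  show "trec (\<lambda>x. Suc (g (psnd x)))"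
    by (intro trec_Suc trec_comp[OF assms(1)] trec_psnd trec_id)
qed (simp add: assms(2))

lemma computable_computes:
  assumes "computable f"
  shows "\<exists>r. \<forall>x. computes r [enc x] (enc (f x))"
proof -
  obtain g where g: "trec g" and lim: "\<And>x. \<exists>n0. \<forall>n.
     (g \<langle>n, enc x\<rangle> = 0 \<or> g \<langle>n, enc x\<rangle> = Suc (enc (f x))) \<and> (n \<ge> n0 \<longrightarrow> g \<langle>n, enc x\<rangle> \<noteq> 0)"
    using assms unfolding computable_def by blast
  have *: "prc 2 (\<lambda>xs. g \<langle>xs ! 0, xs ! 1\<rangle>)"
    by (rule prc_comp1[OF g[unfolded trec_prc] prc_pair[OF prc_nth prc_nth]]) auto
  \<comment> \<open>\<open>1 - g\<close> is 0 exactly when the fuel suffices, so minimization finds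
    the least sufficient fuel; the predecessor of \<open>g\<close> at that fuel is the
    value.\<close>
  then have "prc 2 (\<lambda>xs. 1 - g \<langle>xs ! 0, xs ! 1\<rangle>)"
    by (intro prc_diff prc_const)
  then obtain r where r: "\<And>xs. length xs = 2 \<Longrightarrow> computes r xs (1 - g \<langle>xs ! 0, xs ! 1\<rangle>)"
    unfolding prc_def by blast
  obtain s where s: "\<And>xs. length xs = 2 \<Longrightarrow> computes s xs (g \<langle>xs ! 0, xs ! 1\<rangle> - 1)"
    using prc_pred[OF *] unfolding prc_def by blast
  have "computes (Comp s [Mu r, Proj 0]) [enc x] (enc (f x))" for x
  proof -
    define n where "n = (LEAST n. g \<langle>n, enc x\<rangle> \<noteq> 0)"
    have "\<exists>n. g \<langle>n, enc x\<rangle> \<noteq> 0" using lim[of x] by blast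
    then have n: "g \<langle>n, enc x\<rangle> \<noteq> 0" unfolding n_def by (rule LeastI_ex)
    have below: "g \<langle>i, enc x\<rangle> = 0" if "i < n" for i
      using not_less_Least[of i] that unfolding n_def by blast
    have "computes (Mu r) [enc x] n"
    proof (rule computes.intros(7))
      show "computes r [n, enc x] 0" using r[of "[n, enc x]"] n by simp
      have "computes r [i, enc x] (Suc 0)" if "i < n" for i
        using r[of "[i, enc x]"] below[OF that] by simp
      then show "\<forall>i<n. \<exists>y. computes r [i, enc x] (Suc y)" by blast
    qed
    moreover have "computes (Proj 0) [enc x] (enc x)"
      using computes.intros(3)[of 0 "[enc x]"] by simp
    moreover have "computes s [n, enc x] (enc (f x))"
      using s[of "[n, enc x]"] n lim[of x] by (metis One_nat_def diff_Suc_1 length_Cons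
          list.size(3) nth_Cons_0 nth_Cons_Suc numeral_2_eq_2)
    ultimately show ?thesis
      by (intro computes.intros(4)[of "[n, enc x]"]) (auto simp: less_Suc_eq)
  qed
  then show ?thesis by blast
qed

section \<open>General recursion by traces\<close>

text \<open>
  General recursion is computed by searching for a \<^emph>\<open>trace\<close>, a list of pairs (argument, value) each
  of which is justified by the recursive calls listed after it.
\<close>

fun lookup_list :: "nat list \<Rightarrow> nat \<Rightarrow> nat" where
  "lookup_list [] a = 0"
| "lookup_list (x # xs) a = (if pfst x = a then Suc (psnd x) else lookup_list xs a)"

definition lookup :: "nat \<Rightarrow> nat \<Rightarrow> nat" where
  "lookup T a = lookup_list (list_decode T) a"

lemma trec_lookup: "trec f \<Longrightarrow> trec g \<Longrightarrow> trec (\<lambda>x. lookup (f x) (g x))"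
proof -
  assume f: "trec f" and g: "trec g"
  define h where "h r y a =
    (if y = 0 then if pfst (pfst (r - 1)) = a then Suc (psnd (pfst (r - 1))) else 0 else y)" for r y a
  have "lfold (\<lambda>r y. h r y a) y xs = (if y = 0 then lookup_list xs a else y)" for xs y a
    by (induction xs arbitrary: y) (auto simp: h_def)
  moreover have "trec (\<lambda>x. lfold (\<lambda>xs y. h xs y (g x)) 0 (list_decode (f x)))"
    unfolding h_def by (intro trec_lfold trec_intros trec_diff f g)
  ultimately show ?thesis unfolding lookup_def by simp
qed

text \<open>Entries at numbers that encode no argument are left free, because a justified trace may
  contain arbitrary ones.\<close>

definition correct :: "('a::enc \<Rightarrow> 'b::enc) \<Rightarrow> nat \<Rightarrow> bool" where
  "correct F T \<longleftrightarrow> (\<forall>y v. lookup T (enc y) = Suc v \<longrightarrow> v = enc (F y))"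

text \<open>\<open>g\<close> approximates the value \<open>v\<close> at \<open>a\<close>, using finitely many values of \<open>F\<close> at arguments of
  measure less than \<open>b\<close>.\<close>

definition converges ::
  "('a::enc \<Rightarrow> 'b::enc) \<Rightarrow> ('a \<Rightarrow> nat) \<Rightarrow> nat \<Rightarrow> (nat \<Rightarrow> nat) \<Rightarrow> nat \<Rightarrow> nat \<Rightarrow> bool" where
  "converges F m b g a v \<longleftrightarrow> (\<exists>C n0. finite C \<and> (\<forall>y\<in>C. m y < b) \<and> (\<forall>n T. correct F T \<longrightarrow>
     (g \<langle>n, \<langle>T, a\<rangle>\<rangle> = 0 \<or> g \<langle>n, \<langle>T, a\<rangle>\<rangle> = Suc v) \<and>
     (n \<ge> n0 \<and> (\<forall>y\<in>C. lookup T (enc y) \<noteq> 0) \<longrightarrow> g \<langle>n, \<langle>T, a\<rangle>\<rangle> \<noteq> 0)))"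

lemma converges_pure: "(\<And>n T. g \<langle>n, \<langle>T, a\<rangle>\<rangle> = Suc v) \<Longrightarrow> converges F m b g a v"
  unfolding converges_def by (intro exI[of _ "{}"] exI[of _ 0]) auto

text \<open>Sequencing of approximations: failure of the first propagates, success hands over to the
  second. The demand sets are united and the larger fuel threshold is taken. The argument
  \<open>a2\<close> may differ from \<open>a\<close>, since \<open>g2\<close> is often already
  specialized to the value \<open>v1\<close>.\<close>

lemma converges_bind:
  assumes "converges F m b g1 a1 v1" "converges F m b g2 a2 v2"
    and "\<And>n T. g1 \<langle>n, \<langle>T, a1\<rangle>\<rangle> = 0 \<Longrightarrow> g \<langle>n, \<langle>T, a\<rangle>\<rangle> = 0"
    and "\<And>n T. g1 \<langle>n, \<langle>T, a1\<rangle>\<rangle> = Suc v1 \<Longrightarrow> g \<langle>n, \<langle>T, a\<rangle>\<rangle> = g2 \<langle>n, \<langle>T, a2\<rangle>\<rangle>"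
  shows "converges F m b g a v2"
proof -
  obtain C n0 where C: "finite C" "\<forall>y\<in>C. m y < b" and
    1: "\<And>n T. correct F T \<Longrightarrow> (g1 \<langle>n, \<langle>T, a1\<rangle>\<rangle> = 0 \<or> g1 \<langle>n, \<langle>T, a1\<rangle>\<rangle> = Suc v1) \<and>
     (n \<ge> n0 \<and> (\<forall>y\<in>C. lookup T (enc y) \<noteq> 0) \<longrightarrow> g1 \<langle>n, \<langle>T, a1\<rangle>\<rangle> \<noteq> 0)"
    using assms(1) unfolding converges_def by metis
  obtain C' n0' where C': "finite C'" "\<forall>y\<in>C'. m y < b" and
    2: "\<And>n T. correct F T \<Longrightarrow> (g2 \<langle>n, \<langle>T, a2\<rangle>\<rangle> = 0 \<or> g2 \<langle>n, \<langle>T, a2\<rangle>\<rangle> = Suc v2) \<and>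
     (n \<ge> n0' \<and> (\<forall>y\<in>C'. lookup T (enc y) \<noteq> 0) \<longrightarrow> g2 \<langle>n, \<langle>T, a2\<rangle>\<rangle> \<noteq> 0)"
    using assms(2) unfolding converges_def by metis
  show ?thesis unfolding converges_def
  proof (rule exI[of _ "C \<union> C'"], rule exI[of _ "max n0 n0'"], intro conjI allI impI ballI)
    show "finite (C \<union> C')" using C C' by simp
    show "m y < b" if "y \<in> C \<union> C'" for y using that C C' by blast
    fix n T
    assume T: "correct F T"
    show "g \<langle>n, \<langle>T, a\<rangle>\<rangle> = 0 \<or> g \<langle>n, \<langle>T, a\<rangle>\<rangle> = Suc v2"
      using 1[OF T] 2[OF T] assms(3,4) by metis
    assume "n \<ge> max n0 n0' \<and> (\<forall>y\<in>C \<union> C'. lookup T (enc y) \<noteq> 0)"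
    then show "g \<langle>n, \<langle>T, a\<rangle>\<rangle> \<noteq> 0"
      using 1[OF T, of n] 2[OF T, of n] assms(4) by fastforce
  qed
qed

lemma converges_lift:
  assumes "converges F m b g1 a1 v1"
    and "\<And>n T. g1 \<langle>n, \<langle>T, a1\<rangle>\<rangle> = 0 \<Longrightarrow> g \<langle>n, \<langle>T, a\<rangle>\<rangle> = 0"
    and "\<And>n T. g1 \<langle>n, \<langle>T, a1\<rangle>\<rangle> = Suc v1 \<Longrightarrow> g \<langle>n, \<langle>T, a\<rangle>\<rangle> = Suc v2"
  shows "converges F m b g a v2"
  by (rule converges_bind[OF assms(1) converges_pure[of "\<lambda>x. Suc v2"]]) (use assms in auto)

text \<open>
  The function \<open>h\<close> of an environment \<open>e\<close> is computable with recursive calls of \<open>F\<close> on arguments of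
  measure less than \<open>N e\<close>, provided that \<open>e\<close> satisfies the guard \<open>A\<close>.
\<close>

definition rcomputable :: "('a::enc \<Rightarrow> 'b::enc) \<Rightarrow> ('a \<Rightarrow> nat) \<Rightarrow> ('e::enc \<Rightarrow> nat) \<Rightarrow> ('e \<Rightarrow> bool) \<Rightarrow>
    ('e \<Rightarrow> 'c::enc) \<Rightarrow> bool" where
  "rcomputable F m N A h \<longleftrightarrow>
     (\<exists>g. trec g \<and> (\<forall>e. A e \<longrightarrow> converges F m (N e) g (enc e) (enc (h e))))"

lemma rcomputable_id: "rcomputable F m N A (\<lambda>e. e)"
  unfolding rcomputable_def
  by (intro exI[of _ "\<lambda>x. Suc (psnd (psnd x))"]) (auto intro!: trec_intros converges_pure)

lemma rcomputable_const: "rcomputable F m N A (\<lambda>e. c)"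
  unfolding rcomputable_def
  by (intro exI[of _ "\<lambda>x. Suc (enc c)"]) (auto intro!: trec_intros converges_pure)

lemma rcomputable_pair:
  assumes "rcomputable F m N A h1" "rcomputable F m N A h2"
  shows "rcomputable F m N A (\<lambda>e. (h1 e, h2 e))"
proof -
  obtain g1 g2 where g1: "trec g1" "\<And>e. A e \<Longrightarrow> converges F m (N e) g1 (enc e) (enc (h1 e))"
    and g2: "trec g2" "\<And>e. A e \<Longrightarrow> converges F m (N e) g2 (enc e) (enc (h2 e))"
    using assms unfolding rcomputable_def by blast
  let ?g = "\<lambda>x. if g1 x = 0 then 0 else if g2 x = 0 then 0 else Suc \<langle>g1 x - 1, g2 x - 1\<rangle>"
  have "converges F m (N e) ?g (enc e) (enc (h1 e, h2 e))" if "A e" for e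
  proof (rule converges_bind[OF g1(2)[OF that]])
    show "converges F m (N e) (\<lambda>x. if g2 x = 0 then 0 else Suc \<langle>enc (h1 e), g2 x - 1\<rangle>) (enc e)
      (enc (h1 e, h2 e))"
      by (rule converges_lift[OF g2(2)[OF that]]) auto
  qed auto
  moreover have "trec ?g" by (intro trec_if0 trec_intros trec_diff g1 g2)
  ultimately show ?thesis unfolding rcomputable_def by blast
qed

lemma rcomputable_comp:
  assumes "computable f" "rcomputable F m N A h"
  shows "rcomputable F m N A (\<lambda>e. f (h e))"
proof -
  obtain g where g: "trec g" and lim: "\<And>x. \<exists>n0. \<forall>n.
     (g \<langle>n, enc x\<rangle> = 0 \<or> g \<langle>n, enc x\<rangle> = Suc (enc (f x))) \<and> (n \<ge> n0 \<longrightarrow> g \<langle>n, enc x\<rangle> \<noteq> 0)"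
    using assms(1) unfolding computable_def by blast
  obtain g1 where g1: "trec g1" "\<And>e. A e \<Longrightarrow> converges F m (N e) g1 (enc e) (enc (h e))"
    using assms unfolding rcomputable_def by blast
  let ?g = "\<lambda>x. if g1 x = 0 then 0 else g \<langle>pfst x, g1 x - 1\<rangle>"
  have "converges F m (N e) ?g (enc e) (enc (f (h e)))" if "A e" for e
  proof (rule converges_bind[OF g1(2)[OF that]])
    obtain n0 where n0: "\<And>n. (g \<langle>n, enc (h e)\<rangle> = 0 \<or> g \<langle>n, enc (h e)\<rangle> = Suc (enc (f (h e)))) \<and>
      (n \<ge> n0 \<longrightarrow> g \<langle>n, enc (h e)\<rangle> \<noteq> 0)"
      using lim[of "h e"] by blast
    show "converges F m (N e) (\<lambda>x. g \<langle>pfst x, enc (h e)\<rangle>) 0 (enc (f (h e)))"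
      unfolding converges_def using n0
      by (intro exI[of _ "{}"] exI[of _ n0]) simp
  qed auto
  moreover have "trec ?g" by (intro trec_if0 trec_intros trec_diff trec_comp[OF g] g1)
  ultimately show ?thesis unfolding rcomputable_def by blast
qed

text \<open>Each branch is justified under the outcome of the test. This is how the measure
  condition of a recursive call learns, for instance, that a list is nonempty or that a formula is a
  conjunction.\<close>

lemma rcomputable_if:
  assumes "rcomputable F m N A c"
    and "rcomputable F m N (\<lambda>e. A e \<and> c e) h1" "rcomputable F m N (\<lambda>e. A e \<and> \<not> c e) h2"
  shows "rcomputable F m N A (\<lambda>e. if c e then h1 e else h2 e)"
proof -
  obtain g g1 g2 where g: "trec g" "\<And>e. A e \<Longrightarrow> converges F m (N e) g (enc e) (enc (c e))"
    and g1: "trec g1" "\<And>e. A e \<and> c e \<Longrightarrow> converges F m (N e) g1 (enc e) (enc (h1 e))"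
    and g2: "trec g2" "\<And>e. A e \<and> \<not> c e \<Longrightarrow> converges F m (N e) g2 (enc e) (enc (h2 e))"
    using assms unfolding rcomputable_def by blast
  \<comment> \<open>A successful test returns \<open>Suc (of_bool (c e))\<close>; hence 1 means
    \<open>False\<close> and selects \<open>g2\<close>.\<close>
  let ?g = "\<lambda>x. if g x = 0 then 0 else if g x = 1 then g2 x else g1 x"
  have "converges F m (N e) ?g (enc e) (enc (if c e then h1 e else h2 e))" if "A e" for e
  proof (rule converges_bind[OF g(2)[OF that]])
    show "converges F m (N e) (if c e then g1 else g2) (enc e) (enc (if c e then h1 e else h2 e))"
      using g1(2)[of e] g2(2)[of e] that by simp
  qed auto
  moreover have "trec ?g" by (intro trec_if0 trec_intros g g1 g2)
  ultimately show ?thesis unfolding rcomputable_def by blast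
qed

text \<open>A recursive call is a lookup in the trace. Its argument becomes an additional demand,
  and the bound on the measure keeps demands well-founded.\<close>

lemma rcomputable_rec:
  assumes "rcomputable F m N A h" and "\<And>e. A e \<Longrightarrow> m (h e) < N e"
  shows "rcomputable F m N A (\<lambda>e. F (h e))"
proof -
  obtain g1 where g1: "trec g1" "\<And>e. A e \<Longrightarrow> converges F m (N e) g1 (enc e) (enc (h e))"
    using assms unfolding rcomputable_def by blast
  let ?g = "\<lambda>x. if g1 x = 0 then 0 else lookup (pfst (psnd x)) (g1 x - 1)"
  have "converges F m (N e) ?g (enc e) (enc (F (h e)))" if "A e" for e
  proof (rule converges_bind[OF g1(2)[OF that]])
    show "converges F m (N e) (\<lambda>x. lookup (pfst (psnd x)) (enc (h e))) 0 (enc (F (h e)))"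
      unfolding converges_def
    proof (intro exI[of _ "{h e}"] exI[of _ 0] conjI allI impI)
      fix n T
      assume T: "correct F T"
      show "lookup (pfst (psnd \<langle>n, \<langle>T, 0\<rangle>\<rangle>)) (enc (h e)) = 0 \<or>
        lookup (pfst (psnd \<langle>n, \<langle>T, 0\<rangle>\<rangle>)) (enc (h e)) = Suc (enc (F (h e)))"
        using T unfolding correct_def by (cases "lookup T (enc (h e))") auto
    qed (use assms(2)[OF that] in auto)
  qed auto
  moreover have "trec ?g" by (intro trec_if0 trec_intros trec_diff trec_lookup g1)
  ultimately show ?thesis unfolding rcomputable_def by blast
qed

lemma list_decode_Suc_pair: "list_decode (Suc \<langle>a, b\<rangle>) = a # list_decode b"
  by simp

lemma trec_rev: "trec f \<Longrightarrow> trec (\<lambda>x. list_encode (rev (list_decode (f x))))"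
proof -
  assume f: "trec f"
  have "lfold (\<lambda>r y. Suc \<langle>pfst (r - 1), y\<rangle>) y xs = list_encode (rev xs @ list_decode y)" for xs y
    by (induction xs arbitrary: y) (auto simp: list_decode_Suc_pair simp del: list_decode.simps)
  moreover have "trec (\<lambda>x. lfold (\<lambda>r y. Suc \<langle>pfst (r - 1), y\<rangle>) 0 (list_decode (f x)))"
    by (rule trec_lfold[of "\<lambda>r y e. Suc \<langle>pfst (r - 1), y\<rangle>" "\<lambda>x. 0" f "\<lambda>x. x"])
      (intro trec_intros trec_diff f)+
  ultimately show ?thesis by simp
qed

text \<open>The mapped function may make recursive calls, so one missing value must abort the whole
  map: the accumulator is 0 after a failure and otherwise the successor of the code of the results
  so far. The fold collects these in reverse order, whence the final \<open>rev\<close>.\<close>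

lemma rcomputable_map:
  assumes "rcomputable F m N A xs"
    and "rcomputable F m (\<lambda>p. N (fst p)) (\<lambda>p. A (fst p) \<and> snd p \<in> set (xs (fst p)))
      (\<lambda>p. f (fst p) (snd p))"
  shows "rcomputable F m N A (\<lambda>e. map (f e) (xs e))"
proof -
  obtain g1 where g1: "trec g1" "\<And>e. A e \<Longrightarrow> converges F m (N e) g1 (enc e) (enc (xs e))"
    using assms(1) unfolding rcomputable_def by blast
  obtain g where g: "trec g" and conv: "\<And>e y. A e \<Longrightarrow> y \<in> set (xs e) \<Longrightarrow>
      converges F m (N e) g (enc (e, y)) (enc (f e y))"
    using assms(2) unfolding rcomputable_def by fastforce
  define st where "st r y x = (if y = 0 then 0 else
    if g \<langle>pfst x, \<langle>pfst (psnd x), \<langle>psnd (psnd x), pfst (r - 1)\<rangle>\<rangle>\<rangle> = 0 then 0 else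
      Suc (Suc \<langle>g \<langle>pfst x, \<langle>pfst (psnd x), \<langle>psnd (psnd x), pfst (r - 1)\<rangle>\<rangle>\<rangle> - 1, y - 1\<rangle>))" for r y x
  have st: "trec (\<lambda>x. st (pfst x) (pfst (psnd x)) (psnd (psnd x)))"
    unfolding st_def by (intro trec_if0 trec_intros trec_diff trec_comp[OF g])
  have dead: "lfold (\<lambda>r y. st r y x) 0 ys = 0" for ys x
    by (induction ys) (auto simp: st_def)
  have fold: "converges F m (N e) (\<lambda>x. lfold (\<lambda>r y. st r y x) (Suc L) (map enc ys)) (enc e)
      (list_encode (rev (map (\<lambda>y. enc (f e y)) ys) @ list_decode L))"
    if "A e" "set ys \<subseteq> set (xs e)" for e ys L
    using that(2)
  proof (induction ys arbitrary: L)
    case Nil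
    then show ?case by (intro converges_pure) simp
  next
    case (Cons y ys)
    have "y \<in> set (xs e)" using Cons.prems by simp
    have IH: "converges F m (N e) (\<lambda>x. lfold (\<lambda>r y. st r y x) (Suc (Suc \<langle>enc (f e y), L\<rangle>))
      (map enc ys)) (enc e)
      (list_encode (rev (map (\<lambda>y. enc (f e y)) (y # ys)) @ list_decode L))"
      using Cons.IH[of "Suc \<langle>enc (f e y), L\<rangle>"] Cons.prems
      by (simp add: list_decode_Suc_pair del: list_decode.simps)
    show ?case
      by (rule converges_bind[OF conv[OF that(1) \<open>y \<in> set (xs e)\<close>] IH]) (simp_all add: st_def dead[unfolded st_def])
  qed
  let ?h = "\<lambda>z. lfold (\<lambda>r y. st r y (psnd z)) 1 (list_decode (pfst z))"
  have h: "trec ?h" by (intro trec_lfold trec_intros st)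
  let ?g = "\<lambda>x. if g1 x = 0 then 0 else if ?h \<langle>g1 x - 1, x\<rangle> = 0 then 0 else
    Suc (list_encode (rev (list_decode (?h \<langle>g1 x - 1, x\<rangle> - 1))))"
  have "converges F m (N e) ?g (enc e) (enc (map (f e) (xs e)))" if "A e" for e
  proof (rule converges_bind[OF g1(2)[OF that]])
    show "converges F m (N e) (\<lambda>x. if ?h \<langle>enc (xs e), x\<rangle> = 0 then 0 else
      Suc (list_encode (rev (list_decode (?h \<langle>enc (xs e), x\<rangle> - 1))))) (enc e)
      (enc (map (f e) (xs e)))"
      by (rule converges_lift[OF fold[OF that subset_refl, of 0]]) (auto simp: rev_map comp_def)
  qed auto
  moreover have "trec ?g"
  proof -
    have "trec (\<lambda>x. ?h \<langle>g1 x - 1, x\<rangle>)"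
      by (rule trec_comp[OF h]) (intro trec_intros trec_diff g1)
    then show ?thesis by (intro trec_if0 trec_intros trec_diff trec_rev g1)
  qed
  ultimately show ?thesis unfolding rcomputable_def by blast
qed

fun justified :: "(nat \<Rightarrow> nat) \<Rightarrow> nat \<Rightarrow> nat list \<Rightarrow> bool" where
  "justified g n [] = True"
| "justified g n (x # xs) \<longleftrightarrow> g \<langle>n, \<langle>list_encode xs, pfst x\<rangle>\<rangle> = Suc (psnd x) \<and> justified g n xs"

lemma trec_justified:
  assumes "trec g" "trec n" "trec T" "trec a" "trec b"
  shows "trec (\<lambda>x. if justified g (n x) (list_decode (T x)) then a x else b x)"
proof -
  define h where "h r y k =
    (if y = 0 then if g \<langle>k, \<langle>psnd (r - 1), pfst (pfst (r - 1))\<rangle>\<rangle> = Suc (psnd (pfst (r - 1)))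
      then 0 else 1 else y)" for r y k :: nat
  have "lfold (\<lambda>r y. h r y k) y xs = 0 \<longleftrightarrow> y = 0 \<and> justified g k xs" for xs y k
    by (induction xs arbitrary: y) (auto simp: h_def)
  moreover have "trec (\<lambda>x. if lfold (\<lambda>r y. h r y (n x)) 0 (list_decode (T x)) = 0 then a x else b x)"
    unfolding h_def by (intro trec_if0 trec_lfold trec_intros trec_diff trec_comp[OF assms(1)] assms)
  ultimately show ?thesis by simp
qed

text \<open>Traces are reliable by induction along the list: each entry is computed from a table
  that is already correct. They exist by induction on the measure: only finitely many smaller values
  are demanded, and these can be listed first.\<close>

lemma computable_rec:
  assumes "rcomputable F m m (\<lambda>_. True) F"
  shows "computable F"
proof -
  obtain g where g: "trec g" and conv: "\<And>y. converges F m (m y) g (enc y) (enc (F y))"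
    using assms unfolding rcomputable_def by blast
  have correct: "correct F (list_encode xs)" if "justified g n xs" for n xs
    using that
  proof (induction xs)
    case Nil
    then show ?case by (simp add: correct_def lookup_def)
  next
    case (Cons x xs)
    then have T: "correct F (list_encode xs)" by simp
    show ?case unfolding correct_def
    proof (intro allI impI)
      fix y :: 'a and v
      assume v: "lookup (list_encode (x # xs)) (enc y) = Suc v"
      show "v = enc (F y)"
      proof (cases "pfst x = enc y")
        case True
        then have "g \<langle>n, \<langle>list_encode xs, enc y\<rangle>\<rangle> = Suc v"
          using Cons.prems v by (simp add: lookup_def del: list_encode.simps)
        moreover have "g \<langle>n, \<langle>list_encode xs, enc y\<rangle>\<rangle> \<in> {0, Suc (enc (F y))}"
          using conv[of y] T unfolding converges_def by blast
        ultimately show ?thesis by simp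
      next
        case False
        then have "lookup (list_encode xs) (enc y) = Suc v"
          using v by (simp add: lookup_def del: list_encode.simps)
        with T show ?thesis unfolding correct_def by blast
      qed
    qed
  qed
  define ext where "ext T T' \<longleftrightarrow> (\<forall>a. lookup_list T a \<noteq> 0 \<longrightarrow> lookup_list T' a \<noteq> 0)" for T T'
  \<comment> \<open>Justification for all large fuels, rather than for one, lets traces with
    different fuel thresholds be combined.\<close>
  define valid where "valid T \<longleftrightarrow> (\<exists>n0. \<forall>n\<ge>n0. justified g n T)" for T
  have ex: "\<exists>T'. valid T' \<and> ext T T' \<and> lookup_list T' (enc y) \<noteq> 0" if "valid T" for T and y :: 'a
    using that
  proof (induction "m y" arbitrary: T y rule: less_induct)
    case less
    obtain C n0 where C: "finite C" "\<forall>z\<in>C. m z < m y" and lim: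
      "\<And>n T. correct F T \<Longrightarrow> (g \<langle>n, \<langle>T, enc y\<rangle>\<rangle> = 0 \<or> g \<langle>n, \<langle>T, enc y\<rangle>\<rangle> = Suc (enc (F y))) \<and>
       (n \<ge> n0 \<and> (\<forall>y\<in>C. lookup T (enc y) \<noteq> 0) \<longrightarrow> g \<langle>n, \<langle>T, enc y\<rangle>\<rangle> \<noteq> 0)"
      using conv[of y] unfolding converges_def by metis
    \<comment> \<open>New entries are only put in front, which leaves the justification of the old
      ones intact; the demands in \<open>C\<close> can therefore be met one after another.\<close>
    from C have "\<exists>T'. valid T' \<and> ext T T' \<and> (\<forall>z\<in>C. lookup_list T' (enc z) \<noteq> 0)"
    proof (induction C)
      case empty
      then show ?case using less.prems ext_def by auto
    next
      case (insert z C)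
      then obtain T1 where T1: "valid T1" "ext T T1" "\<forall>z\<in>C. lookup_list T1 (enc z) \<noteq> 0" by auto
      obtain T2 where "valid T2" "ext T1 T2" "lookup_list T2 (enc z) \<noteq> 0"
        using less.hyps[of z T1] insert.prems T1 by auto
      then show ?case using T1 unfolding ext_def by (intro exI[of _ T2]) auto
    qed
    then obtain T' where T': "valid T'" "ext T T'" "\<forall>z\<in>C. lookup_list T' (enc z) \<noteq> 0" by blast
    then obtain n1 where n1: "\<forall>n\<ge>n1. justified g n T'" unfolding valid_def by blast
    have "justified g n (\<langle>enc y, enc (F y)\<rangle> # T')" if "n \<ge> max n0 n1" for n
      using lim[OF correct, of n T' n] n1 that T'(3) by (auto simp: lookup_def)
    then have "valid (\<langle>enc y, enc (F y)\<rangle> # T')" unfolding valid_def by blast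
    then show ?case using T'(2) unfolding ext_def
      by (intro exI[of _ "\<langle>enc y, enc (F y)\<rangle> # T'"]) auto
  qed
  define test where "test n a T =
    (if justified g n (list_decode T) then lookup T a else 0)" for n a T
  \<comment> \<open>All numbers below \<open>k\<close> are tried as traces. In the end the fuel also
    serves as \<open>k\<close>, so the search stays total.\<close>
  define srch where "srch z k = rec_nat 0 (\<lambda>T y. if y = 0 then test (pfst z) (psnd z) T else y) k"
    for z k
  have test: "trec (\<lambda>x. test (p x) (q x) (r x))" if "trec p" "trec q" "trec r" for p q r
    unfolding test_def by (intro trec_justified trec_lookup trec_const g that)
  have "trec (\<lambda>z. srch z (pfst z))" unfolding srch_def
    by (rule trec_rec[of "\<lambda>x. 0" "\<lambda>T y z. if y = 0 then test (pfst z) (psnd z) T else y"])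
      (intro trec_intros trec_if0 test)+
  moreover have test_cases: "test n (enc y) T = 0 \<or> test n (enc y) T = Suc (enc (F y))" for n y T
    using correct[of n "list_decode T"] unfolding test_def correct_def
    by (cases "lookup T (enc y)") auto
  then have "srch \<langle>n, enc y\<rangle> k = 0 \<or> srch \<langle>n, enc y\<rangle> k = Suc (enc (F y))" for n y k
    by (induction k) (auto simp: srch_def)
  moreover have "\<exists>n0. \<forall>n\<ge>n0. srch \<langle>n, enc y\<rangle> n \<noteq> 0" for y :: 'a
  proof -
    have "valid []" unfolding valid_def by simp
    from ex[OF this, of y] obtain T n0 where T: "lookup_list T (enc y) \<noteq> 0"
      and n0: "\<forall>n\<ge>n0. justified g n T" unfolding valid_def by blast
    have pos: "srch z k \<noteq> 0" if "test (pfst z) (psnd z) t \<noteq> 0" "t < k" for t k z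
      using that(2)
    proof (induction k)
      case (Suc k)
      then show ?case using that(1) by (cases "t = k") (auto simp: srch_def)
    qed simp
    have "srch \<langle>n, enc y\<rangle> n \<noteq> 0" if "n \<ge> max n0 (Suc (list_encode T))" for n
    proof (rule pos)
      show "test (pfst \<langle>n, enc y\<rangle>) (psnd \<langle>n, enc y\<rangle>) (list_encode T) \<noteq> 0"
        using T n0 that by (simp add: test_def lookup_def)
      show "list_encode T < n" using that by simp
    qed
    then show ?thesis by blast
  qed
  ultimately show ?thesis unfolding computable_def
    by (intro exI[of _ "\<lambda>z. srch z (pfst z)"]) (metis pfst_pair)
qed

text \<open>The case without recursive calls: the bound 0 forces the set of demands to be empty, so
  the empty table, whose code is 0, answers all of them.\<close>

lemma computableI:
  assumes "rcomputable (\<lambda>x::nat. x) (\<lambda>x. x) (\<lambda>_. 0) (\<lambda>_. True) h"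
  shows "computable h"
proof -
  obtain g where g: "trec g" and conv: "\<And>e. converges (\<lambda>x::nat. x) (\<lambda>x. x) 0 g (enc e) (enc (h e))"
    using assms unfolding rcomputable_def by auto
  have T: "correct (\<lambda>x::nat. x) 0" by (simp add: correct_def lookup_def)
  show ?thesis unfolding computable_def
  proof (intro exI[of _ "\<lambda>x. g \<langle>pfst x, \<langle>0, psnd x\<rangle>\<rangle>"] conjI allI)
    show "trec (\<lambda>x. g \<langle>pfst x, \<langle>0, psnd x\<rangle>\<rangle>)"
      by (rule trec_comp[OF g]) (intro trec_intros)
    show "\<exists>n0. \<forall>n. (g \<langle>pfst \<langle>n, enc x\<rangle>, \<langle>0, psnd \<langle>n, enc x\<rangle>\<rangle>\<rangle> = 0 \<or>
       g \<langle>pfst \<langle>n, enc x\<rangle>, \<langle>0, psnd \<langle>n, enc x\<rangle>\<rangle>\<rangle> = Suc (enc (h x))) \<and>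
       (n0 \<le> n \<longrightarrow> g \<langle>pfst \<langle>n, enc x\<rangle>, \<langle>0, psnd \<langle>n, enc x\<rangle>\<rangle>\<rangle> \<noteq> 0)" for x
      using conv[of x] T unfolding converges_def by fastforce
  qed
qed

section \<open>The machine of a derivation\<close>

text \<open>
  \<open>coerce \<phi>\<close> turns an arbitrary move into an element of \<open>M \<phi>\<close> and fixes the elements of \<open>M \<phi>\<close>.
  It makes the outputs of the machine below well typed for every tree of sequents, and it
  forgets the moves of a formula that has been substituted for an atom \<open>x \<in> X\<close>.
\<close>

fun mbit :: "move \<Rightarrow> bool" where
  "mbit (Bit b) = b"
| "mbit _ = False"

fun mfst :: "move \<Rightarrow> move" where
  "mfst (MPair m m') = m"
| "mfst _ = Star"

fun msnd :: "move \<Rightarrow> move" where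
  "msnd (MPair m m') = m'"
| "msnd _ = Star"

primrec coerce :: "form \<Rightarrow> move \<Rightarrow> move" where
  "coerce (Eq x y) m = Star"
| "coerce (Le x y) m = Star"
| "coerce (Sc x y) m = Star"
| "coerce (Zero x) m = Star"
| "coerce (Mem x X) m = Star"
| "coerce Top m = Star"
| "coerce Bot m = Star"
| "coerce (And \<phi> \<psi>) m = MPair (coerce \<phi> (mfst m)) (coerce \<psi> (msnd m))"
| "coerce (Neg \<phi>) m = Star"
| "coerce (ExI \<phi>) m = MPair (Bit (mbit (mfst m))) (MPair Star (coerce \<phi> (msnd (msnd m))))"
| "coerce (ExP \<phi>) m = MPair (Bit (mbit (mfst m))) (coerce \<phi> (msnd m))"

section \<open>Finite lists with a default as assignments of bits\<close>

fun bit_at :: "bool \<Rightarrow> bool list \<Rightarrow> nat \<Rightarrow> bool" where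
  "bit_at d [] i = d"
| "bit_at d (x # xs) 0 = x"
| "bit_at d (x # xs) (Suc i) = bit_at d xs i"

text \<open>Positions between the end of the list and the updated one are filled with the default,
  so that all other variables keep their bits.\<close>

fun update_at :: "bool \<Rightarrow> bool list \<Rightarrow> nat \<Rightarrow> bool \<Rightarrow> bool list" where
  "update_at d xs 0 b = b # tl xs"
| "update_at d xs (Suc i) b = (if xs = [] then d else hd xs) # update_at d (tl xs) i b"

definition pairs :: "nat list \<Rightarrow> nat list \<Rightarrow> nat list" where
  "pairs xs ys = concat (map (\<lambda>x. map (\<lambda>y. \<langle>x, y\<rangle>) ys) xs)"

definition restrict_to :: "nat list \<Rightarrow> nat list \<Rightarrow> nat list" where
  "restrict_to us xs = filter (\<lambda>u. u \<in> set xs) us"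

abbreviation atom_state :: "bool \<Rightarrow> bool \<Rightarrow> nat" where
  "atom_state h ok \<equiv> \<langle>of_bool h, of_bool ok\<rangle>"

abbreviation atom_states :: "nat list" where
  "atom_states \<equiv> pairs [0, 1] [0, 1]"

section \<open>Finite automata for formulae on initial segments\<close>

text \<open>
  A deterministic automaton deciding a formula on the finite words that encode an initial segment
  of the natural numbers.  The state of an atom consists of a history bit and a bit saying that
  the atom is not yet refuted.  For quantifiers the subset construction is used; a state of
  \<open>ExI \<phi>\<close> is a set of pairs of a state of \<open>\<phi>\<close> and the number 0, 1 or 2 (for "at least 2") of ones
  guessed so far on the new track.  States are coded as numbers, and sets of states as the sublists
  of a fixed list, so that each set has one code.
\<close>

primrec fstates :: "form \<Rightarrow> nat list" where
  "fstates (Eq x y) = atom_states"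
| "fstates (Le x y) = atom_states"
| "fstates (Sc x y) = atom_states"
| "fstates (Zero x) = atom_states"
| "fstates (Mem x X) = atom_states"
| "fstates Top = atom_states"
| "fstates Bot = atom_states"
| "fstates (And \<phi> \<psi>) = pairs (fstates \<phi>) (fstates \<psi>)"
| "fstates (Neg \<phi>) = fstates \<phi>"
| "fstates (ExI \<phi>) = map list_encode (subseqs (pairs [0, 1, 2] (fstates \<phi>)))"
| "fstates (ExP \<phi>) = map list_encode (subseqs (fstates \<phi>))"

primrec finit :: "form \<Rightarrow> nat" where
  "finit (Eq x y) = \<langle>0, 1\<rangle>"
| "finit (Le x y) = \<langle>0, 1\<rangle>"
| "finit (Sc x y) = \<langle>0, 1\<rangle>"
| "finit (Zero x) = \<langle>0, 1\<rangle>"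
| "finit (Mem x X) = \<langle>0, 1\<rangle>"
| "finit Top = \<langle>0, 1\<rangle>"
| "finit Bot = \<langle>0, 1\<rangle>"
| "finit (And \<phi> \<psi>) = \<langle>finit \<phi>, finit \<psi>\<rangle>"
| "finit (Neg \<phi>) = finit \<phi>"
| "finit (ExI \<phi>) = list_encode [\<langle>0, finit \<phi>\<rangle>]"
| "finit (ExP \<phi>) = list_encode [finit \<phi>]"

definition bump :: "nat \<Rightarrow> nat" where
  "bump c = (if c = 0 then 1 else 2)"

text \<open>The history bit records for \<open>Le\<close> that \<open>x\<close> has been seen, for
  \<open>Sc\<close> that \<open>x\<close> was at the previous position, and for \<open>Zero\<close>
  that some letter has been read; the other atoms leave it at 0.\<close>

primrec fstep :: "form \<Rightarrow> nat \<Rightarrow> bool list \<Rightarrow> bool list \<Rightarrow> nat" where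
  "fstep (Eq x y) s xs Xs = atom_state False (psnd s = 1 \<and> bit_at False xs x = bit_at False xs y)"
| "fstep (Le x y) s xs Xs = atom_state (pfst s = 1 \<or> bit_at False xs x)
     (psnd s = 1 \<and> (bit_at False xs y \<longrightarrow> pfst s = 1 \<or> bit_at False xs x))"
| "fstep (Sc x y) s xs Xs = atom_state (bit_at False xs x)
     (psnd s = 1 \<and> bit_at False xs y = (pfst s = 1))"
| "fstep (Zero x) s xs Xs = atom_state True (psnd s = 1 \<and> (bit_at False xs x \<longrightarrow> pfst s \<noteq> 1))"
| "fstep (Mem x X) s xs Xs = atom_state False (psnd s = 1 \<and> (bit_at False xs x \<longrightarrow> bit_at False Xs X))"
| "fstep Top s xs Xs = atom_state False True"
| "fstep Bot s xs Xs = atom_state False False"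
| "fstep (And \<phi> \<psi>) s xs Xs = \<langle>fstep \<phi> (pfst s) xs Xs, fstep \<psi> (psnd s) xs Xs\<rangle>"
| "fstep (Neg \<phi>) s xs Xs = fstep \<phi> s xs Xs"
| "fstep (ExI \<phi>) s xs Xs = list_encode (restrict_to (pairs [0, 1, 2] (fstates \<phi>))
     (map (\<lambda>t. \<langle>pfst t, fstep \<phi> (psnd t) (False # xs) Xs\<rangle>) (list_decode s) @
      map (\<lambda>t. \<langle>bump (pfst t), fstep \<phi> (psnd t) (True # xs) Xs\<rangle>) (list_decode s)))"
| "fstep (ExP \<phi>) s xs Xs = list_encode (restrict_to (fstates \<phi>)
     (map (\<lambda>t. fstep \<phi> t xs (False # Xs)) (list_decode s) @
      map (\<lambda>t. fstep \<phi> t xs (True # Xs)) (list_decode s)))"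

text \<open>The quantifier over the members of a state set is phrased as membership of
  \<open>True\<close> in a mapped list, a form covered by the computability rules for
  \<open>map\<close> and membership. For \<open>ExI\<close>, the count 1 demands that exactly one
  position was guessed.\<close>

primrec facc :: "form \<Rightarrow> nat \<Rightarrow> bool" where
  "facc (Eq x y) s \<longleftrightarrow> psnd s = 1"
| "facc (Le x y) s \<longleftrightarrow> psnd s = 1"
| "facc (Sc x y) s \<longleftrightarrow> psnd s = 1"
| "facc (Zero x) s \<longleftrightarrow> psnd s = 1"
| "facc (Mem x X) s \<longleftrightarrow> psnd s = 1"
| "facc Top s \<longleftrightarrow> psnd s = 1"
| "facc Bot s \<longleftrightarrow> psnd s = 1"
| "facc (And \<phi> \<psi>) s \<longleftrightarrow> facc \<phi> (pfst s) \<and> facc \<psi> (psnd s)"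
| "facc (Neg \<phi>) s \<longleftrightarrow> \<not> facc \<phi> s"
| "facc (ExI \<phi>) s \<longleftrightarrow> True \<in> set (map (\<lambda>t. pfst t = 1 \<and> facc \<phi> (psnd t)) (list_decode s))"
| "facc (ExP \<phi>) s \<longleftrightarrow> True \<in> set (map (\<lambda>t. facc \<phi> t) (list_decode s))"

section \<open>The machine of a derivation\<close>

text \<open>
  The Mealy machine of a derivation: a state consists of the states of the first two premises and
  of a local automaton.  The latter produces the witness of synchronous comprehension, of the
  existence of 0 and of the existence of successors: at time \<open>n\<close> it is asked whether its formula
  holds if the variable 0 has the value \<open>n\<close>, and it continues under the assumption that the
  variable has a later value.
\<close>

primrec drule :: "deriv \<Rightarrow> rule" where "drule (Infer r s ds) = r"

primrec dprems :: "deriv \<Rightarrow> deriv list" where "dprems (Infer r s ds) = ds"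

definition dhyps :: "deriv \<Rightarrow> form list" where "dhyps D = fst (endsequent D)"

definition dconcl :: "deriv \<Rightarrow> form" where "dconcl D = snd (endsequent D)"

fun local_form :: "rule \<Rightarrow> form" where
  "local_form (SyncCompr \<chi>) = \<chi>"
| "local_form ZeroEx = Zero 0"
| "local_form ScEx = Sc 1 0"
| "local_form _ = Top"

text \<open>The conclusion of \<open>ScEx\<close> shows the given variable below a binder, shifted
  up by one.\<close>

fun sc_var :: "form \<Rightarrow> nat" where
  "sc_var (ExI (Sc x y)) = x - 1"
| "sc_var _ = 0"

text \<open>An environment consists of a default bit for the individual variables beyond the listed ones,
  the bits of the individual and of the predicate variables, and the moves of the hypotheses.\<close>

type_synonym env = "bool \<times> bool list \<times> bool list \<times> move list"

definition local_step :: "rule \<Rightarrow> form \<Rightarrow> nat \<Rightarrow> env \<Rightarrow> bool \<Rightarrow> nat" where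
  "local_step r \<phi> s a b = fstep (local_form r) s
     [b, bit_at (fst a) (fst (snd a)) (sc_var \<phi>)] (fst (snd (snd a)))"

fun assoc_move :: "form \<Rightarrow> form list \<Rightarrow> move list \<Rightarrow> move" where
  "assoc_move \<phi> (\<psi> # \<Gamma>) (m # ms) = (if \<psi> = \<phi> then m else assoc_move \<phi> \<Gamma> ms)"
| "assoc_move \<phi> _ _ = Star"

text \<open>The second premise reads the output of the first in the same round, so the composite
  stays synchronous. For the eliminations of quantifiers, the witness bit in that output becomes the
  bit of the eigenvariable.\<close>

fun second_env :: "rule \<Rightarrow> env \<Rightarrow> move \<Rightarrow> env" where
  "second_env Cut (d, xs, Xs, ms) b = (d, xs, Xs, ms @ [b])"
| "second_env (ExIE z) (d, xs, Xs, ms) b = (d, update_at d xs z (mbit (mfst b)), Xs, ms @ [msnd (msnd b)])"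
| "second_env (ExPE Z) (d, xs, Xs, ms) b = (d, xs, update_at False Xs Z (mbit (mfst b)), ms @ [msnd b])"
| "second_env _ a b = a"

text \<open>The final catch-all covers the rules with a deterministic conclusion, where
  \<open>coerce\<close> turns \<open>Star\<close> into the only possible move. It likewise completes
  the \<open>Star\<close> of \<open>ZeroEx\<close> and \<open>ScEx\<close> to a move of the right
  shape.\<close>

fun raw_output :: "rule \<Rightarrow> form list \<Rightarrow> form \<Rightarrow> env \<Rightarrow> bool \<Rightarrow> move \<Rightarrow> move \<Rightarrow> move" where
  "raw_output Ax \<Gamma> \<phi> (d, xs, Xs, ms) w b1 b2 = assoc_move \<phi> \<Gamma> ms"
| "raw_output Cut \<Gamma> \<phi> a w b1 b2 = b2"
| "raw_output AndI \<Gamma> \<phi> a w b1 b2 = MPair b1 b2"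
| "raw_output AndE1 \<Gamma> \<phi> a w b1 b2 = mfst b1"
| "raw_output AndE2 \<Gamma> \<phi> a w b1 b2 = msnd b1"
| "raw_output (ExII t) \<Gamma> \<phi> (d, xs, Xs, ms) w b1 b2 = MPair (Bit (bit_at d xs t)) (MPair Star b1)"
| "raw_output (ExIE z) \<Gamma> \<phi> a w b1 b2 = b2"
| "raw_output (ExPI Y) \<Gamma> \<phi> (d, xs, Xs, ms) w b1 b2 = MPair (Bit (bit_at False Xs Y)) b1"
| "raw_output (ExPE Z) \<Gamma> \<phi> a w b1 b2 = b2"
| "raw_output (EqSubst x y z \<psi>) \<Gamma> \<phi> a w b1 b2 = b1"
| "raw_output ZeroEx \<Gamma> \<phi> a w b1 b2 = MPair (Bit w) Star"
| "raw_output ScEx \<Gamma> \<phi> a w b1 b2 = MPair (Bit w) Star"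
| "raw_output (SyncCompr \<chi>) \<Gamma> \<phi> a w b1 b2 = MPair (Bit w) b1"
| "raw_output _ \<Gamma> \<phi> a w b1 b2 = Star"

lemma size_hd_dprems: "dprems D \<noteq> [] \<Longrightarrow> size (hd (dprems D)) < size D"
  by (cases D; cases "dprems D") auto

lemma size_second_dprems:
  "dprems D \<noteq> [] \<Longrightarrow> tl (dprems D) \<noteq> [] \<Longrightarrow> size (hd (tl (dprems D))) < size D"
  by (cases D; cases "dprems D"; cases "tl (dprems D)") auto

text \<open>Written with selectors instead of constructor patterns, so that the defining equation
  itself has the form required by \<open>computable_recI\<close>. Two premises suffice: only
  \<open>LeSc\<close> has three, and its conclusion is deterministic.\<close>

function dstates :: "deriv \<Rightarrow> nat list" where
  "dstates D = pairs (fstates (local_form (drule D)))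
     (pairs (if dprems D = [] then [0] else dstates (hd (dprems D)))
       (if dprems D = [] then [0] else
          if tl (dprems D) = [] then [0] else dstates (hd (tl (dprems D)))))"
  by auto
termination
  by (relation "measure size") (auto simp: size_hd_dprems size_second_dprems)

function dinit :: "deriv \<Rightarrow> nat" where
  "dinit D = \<langle>finit (local_form (drule D)),
     \<langle>if dprems D = [] then 0 else dinit (hd (dprems D)),
      if dprems D = [] then 0 else if tl (dprems D) = [] then 0 else dinit (hd (tl (dprems D)))\<rangle>\<rangle>"
  by auto
termination
  by (relation "measure size") (auto simp: size_hd_dprems size_second_dprems)

definition combine :: "rule \<Rightarrow> form list \<Rightarrow> form \<Rightarrow> nat \<Rightarrow> env \<Rightarrow> nat \<times> move \<Rightarrow> nat \<times> move \<Rightarrow> nat \<times> move"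
  where "combine r \<Gamma> \<phi> s a q1 q2 =
    (\<langle>local_step r \<phi> s a False, \<langle>fst q1, fst q2\<rangle>\<rangle>,
     coerce \<phi> (raw_output r \<Gamma> \<phi> a (facc (local_form r) (local_step r \<phi> s a True)) (snd q1) (snd q2)))"

function dstep :: "deriv \<Rightarrow> nat \<Rightarrow> env \<Rightarrow> nat \<times> move" where
  "dstep D s a = combine (drule D) (dhyps D) (dconcl D) (pfst s) a
     (if dprems D = [] then (0, Star) else dstep (hd (dprems D)) (pfst (psnd s)) a)
     (if dprems D = [] then (0, Star) else if tl (dprems D) = [] then (0, Star) else
       dstep (hd (tl (dprems D))) (psnd (psnd s))
         (second_env (drule D) a (snd (dstep (hd (dprems D)) (pfst (psnd s)) a))))"
  by auto
termination
  by (relation "measure (\<lambda>(D, s, a). size D)") (auto simp: size_hd_dprems size_second_dprems)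

declare dstates.simps [simp del] dinit.simps [simp del] dstep.simps [simp del]

section \<open>The finite transition table\<close>

primrec move_list :: "form \<Rightarrow> move list" where
  "move_list (Eq x y) = [Star]"
| "move_list (Le x y) = [Star]"
| "move_list (Sc x y) = [Star]"
| "move_list (Zero x) = [Star]"
| "move_list (Mem x X) = [Star]"
| "move_list Top = [Star]"
| "move_list Bot = [Star]"
| "move_list (And \<phi> \<psi>) =
     concat (map (\<lambda>m. map (\<lambda>m'. MPair m m') (move_list \<psi>)) (move_list \<phi>))"
| "move_list (Neg \<phi>) = [Star]"
| "move_list (ExI \<phi>) =
     concat (map (\<lambda>b. map (\<lambda>m. MPair (Bit b) (MPair Star m)) (move_list \<phi>)) [False, True])"
| "move_list (ExP \<phi>) =
     concat (map (\<lambda>b. map (\<lambda>m. MPair (Bit b) m) (move_list \<phi>)) [False, True])"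

primrec bool_lists :: "nat \<Rightarrow> bool list list" where
  "bool_lists 0 = [[]]"
| "bool_lists (Suc n) = concat (map (\<lambda>b. map (\<lambda>bs. b # bs) (bool_lists n)) [False, True])"

primrec move_lists :: "form list \<Rightarrow> move list list" where
  "move_lists [] = [[]]"
| "move_lists (\<phi> # \<Gamma>) = concat (map (\<lambda>m. map (\<lambda>ms. m # ms) (move_lists \<Gamma>)) (move_list \<phi>))"

primrec stars :: "nat \<Rightarrow> move list" where
  "stars 0 = []"
| "stars (Suc n) = Star # stars n"

definition input_list :: "nat \<Rightarrow> nat \<Rightarrow> form list \<Rightarrow> input list" where
  "input_list l p \<Gamma> = concat (map (\<lambda>xs. concat (map (\<lambda>Xs.
     map (\<lambda>ms. (xs, Xs, stars l, ms)) (move_lists \<Gamma>)) (bool_lists p))) (bool_lists l))"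

text \<open>The first component of the state is 0 exactly before the first letter. Hence
  \<open>pfst q = 0\<close> is the bit of the number 0 at the current position, and it is the
  default for individual variables outside the context.\<close>

definition top_step :: "deriv \<Rightarrow> nat \<Rightarrow> input \<Rightarrow> nat \<times> move" where
  "top_step D q a = (let r = dstep D (psnd q) (pfst q = 0, fst a, fst (snd a), snd (snd (snd a)))
     in (\<langle>1, fst r\<rangle>, snd r))"

definition machine :: "deriv \<Rightarrow> nat \<Rightarrow> nat \<Rightarrow> (input, move) mealy" where
  "machine D l p =
     \<lparr> mstates = pairs [0, 1] (dstates D),
       minit = \<langle>0, dinit D\<rangle>,
       mtable = concat (map (\<lambda>q. map (\<lambda>a. ((q, a), top_step D q a)) (input_list l p (dhyps D)))
         (pairs [0, 1] (dstates D))) \<rparr>"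

section \<open>Computability of the machine\<close>

instantiation form :: enc begin
definition enc_form :: "form \<Rightarrow> nat" where [simp]: "enc_form = code_form"
instance ..
end

instantiation move :: enc begin
definition enc_move :: "move \<Rightarrow> nat" where [simp]: "enc_move = code_move"
instance ..
end

instantiation rule :: enc begin
definition enc_rule :: "rule \<Rightarrow> nat" where [simp]: "enc_rule = code_rule"
instance ..
end

instantiation deriv :: enc begin
definition enc_deriv :: "deriv \<Rightarrow> nat" where [simp]: "enc_deriv = code_deriv"
instance ..
end

named_theorems rc_intros

declare rcomputable_id [rc_intros] rcomputable_const [rc_intros] rcomputable_pair [rc_intros] rcomputable_if [rc_intros]
  rcomputable_map [rc_intros]

lemma rcomputable_comp2:
  assumes "computable (\<lambda>p. f (fst p) (snd p))" "rcomputable F m N A g" "rcomputable F m N A h"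
  shows "rcomputable F m N A (\<lambda>e. f (g e) (h e))"
  using rcomputable_comp[OF assms(1) rcomputable_pair[OF assms(2,3)]] by simp

lemma rcomputable_comp3:
  assumes "computable (\<lambda>p. f (fst p) (fst (snd p)) (snd (snd p)))" "rcomputable F m N A g"
    "rcomputable F m N A h" "rcomputable F m N A k"
  shows "rcomputable F m N A (\<lambda>e. f (g e) (h e) (k e))"
  using rcomputable_comp[OF assms(1) rcomputable_pair[OF assms(2) rcomputable_pair[OF assms(3,4)]]]
  by simp

lemma rcomputable_comp4:
  assumes "computable (\<lambda>p. f (fst p) (fst (snd p)) (fst (snd (snd p))) (snd (snd (snd p))))"
    "rcomputable F m N A g" "rcomputable F m N A h" "rcomputable F m N A k" "rcomputable F m N A l"
  shows "rcomputable F m N A (\<lambda>e. f (g e) (h e) (k e) (l e))"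
  using rcomputable_comp[OF assms(1) rcomputable_pair[OF assms(2) rcomputable_pair[OF assms(3)
        rcomputable_pair[OF assms(4,5)]]]]
  by simp

lemma rcomputable_rec2:
  fixes f
  defines "F \<equiv> \<lambda>p. f (fst p) (snd p)"
  assumes "rcomputable F m N A g" "rcomputable F m N A h" "\<And>e. A e \<Longrightarrow> m (g e, h e) < N e"
  shows "rcomputable F m N A (\<lambda>e. f (g e) (h e))"
  using rcomputable_rec[OF rcomputable_pair[OF assms(2,3)] assms(4)] by (simp add: F_def)

lemma rcomputable_rec3:
  fixes f
  defines "F \<equiv> \<lambda>p. f (fst p) (fst (snd p)) (snd (snd p))"
  assumes "rcomputable F m N A g" "rcomputable F m N A h" "rcomputable F m N A k"
    "\<And>e. A e \<Longrightarrow> m (g e, h e, k e) < N e"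
  shows "rcomputable F m N A (\<lambda>e. f (g e) (h e) (k e))"
  using rcomputable_rec[OF rcomputable_pair[OF assms(2) rcomputable_pair[OF assms(3,4)]] assms(5)]
  by (simp add: F_def)

lemma rcomputable_rec4:
  fixes f
  defines "F \<equiv> \<lambda>p. f (fst p) (fst (snd p)) (fst (snd (snd p))) (snd (snd (snd p)))"
  assumes "rcomputable F m N A g" "rcomputable F m N A h" "rcomputable F m N A k"
    "rcomputable F m N A l" "\<And>e. A e \<Longrightarrow> m (g e, h e, k e, l e) < N e"
  shows "rcomputable F m N A (\<lambda>e. f (g e) (h e) (k e) (l e))"
  using rcomputable_rec[OF rcomputable_pair[OF assms(2) rcomputable_pair[OF assms(3)
        rcomputable_pair[OF assms(4,5)]]] assms(6)]
  by (simp add: F_def)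

lemma computable_recI:
  assumes "rcomputable F m m (\<lambda>_. True) B" "\<And>x. F x = B x"
  shows "computable F"
proof -
  have "F = B" using assms(2) by blast
  then show ?thesis using assms(1) by (metis computable_rec)
qed

lemma trec_pred: "trec f \<Longrightarrow> trec (\<lambda>x. f x - 1)"
  by (intro trec_diff trec_const)

lemmas trec_rules = trec_intros trec_pred trec_if0

section \<open>Basic computable operations\<close>

lemma computable_fst: "computable fst"
  by (rule computable_code[of pfst]) (auto intro!: trec_rules)

lemma computable_snd: "computable snd"
  by (rule computable_code[of psnd]) (auto intro!: trec_rules)

lemma computable_Suc: "computable Suc"
  by (rule computable_code[of Suc]) (auto intro!: trec_rules)

lemma computable_pred: "computable (\<lambda>n::nat. n - 1)"
  by (rule computable_code[of "\<lambda>n. n - 1", OF trec_pred[OF trec_id]]) simp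

lemma computable_prod_encode: "computable prod_encode"
  by (rule computable_code[of "\<lambda>n. n"]) (auto intro!: trec_rules)

lemma computable_pfst: "computable pfst"
  by (rule computable_code[of pfst]) (auto intro!: trec_rules)

lemma computable_psnd: "computable psnd"
  by (rule computable_code[of psnd]) (auto intro!: trec_rules)

lemma map_enc_nat [simp]: "map enc xs = xs" for xs :: "nat list"
  by (induction xs) auto

lemma computable_list_encode: "computable list_encode"
  by (rule computable_code[of "\<lambda>n. n"]) (auto intro!: trec_rules)

lemma computable_list_decode: "computable list_decode"
  by (rule computable_code[of "\<lambda>n. n"]) (auto intro!: trec_rules)

lemma computable_of_bool: "computable (of_bool :: bool \<Rightarrow> nat)"
  by (rule computable_code[of "\<lambda>n. n"]) (auto intro!: trec_rules)

lemma computable_Not: "computable Not"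
  by (rule computable_code[of "\<lambda>n. if n = 0 then 1 else 0"]) (auto intro!: trec_rules)

lemma computable_eq:
  assumes "inj (enc :: 'a::enc \<Rightarrow> nat)"
  shows "computable (\<lambda>p. fst p = (snd p :: 'a))"
  by (rule computable_code[of "\<lambda>n. if pfst n = psnd n then 1 else 0"])
    (auto intro!: trec_rules simp: inj_eq[OF assms])

lemma computable_hd: "computable (hd :: 'a::enc list \<Rightarrow> 'a)"
proof (rule computable_code)
  show "trec (\<lambda>n. if n = 0 then enc (hd [] :: 'a) else pfst (n - 1))" by (intro trec_rules)
  show "(if enc x = 0 then enc (hd [] :: 'a) else pfst (enc x - 1)) = enc (hd x)" for x :: "'a list"
    by (cases x) auto
qed

lemma computable_tl: "computable (tl :: 'a::enc list \<Rightarrow> 'a list)"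
proof (rule computable_code)
  show "trec (\<lambda>n. if n = 0 then 0 else psnd (n - 1))" by (intro trec_rules)
  show "(if enc x = 0 then 0 else psnd (enc x - 1)) = enc (tl x)" for x :: "'a list"
    by (cases x) auto
qed

lemma computable_Nil: "computable (\<lambda>xs :: 'a::enc list. xs = [])"
proof (rule computable_code)
  show "trec (\<lambda>n. if n = 0 then 1 else 0)" by (intro trec_rules)
  show "(if enc x = 0 then 1 else 0) = enc (x = [])" for x :: "'a list"
    by (cases x) auto
qed

lemma computable_Cons: "computable (\<lambda>p. fst p # (snd p :: 'a::enc list))"
  by (rule computable_code[of Suc]) (auto intro!: trec_rules)

text \<open>The axiom rule looks up its conclusion among the hypotheses; injectivity allows this
  comparison to be made on codes.\<close>

lemma inj_code_form: "inj code_form"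
proof (rule injI)
  show "code_form \<phi> = code_form \<psi> \<Longrightarrow> \<phi> = \<psi>" for \<phi> \<psi>
  proof (induction \<phi> arbitrary: \<psi>)
    case (Eq x y) then show ?case by (cases \<psi>) auto
  next
    case (Le x y) then show ?case by (cases \<psi>) auto
  next
    case (Sc x y) then show ?case by (cases \<psi>) auto
  next
    case (Zero x) then show ?case by (cases \<psi>) auto
  next
    case (Mem x X) then show ?case by (cases \<psi>) auto
  next
    case Top then show ?case by (cases \<psi>) auto
  next
    case Bot then show ?case by (cases \<psi>) auto
  next
    case (And \<phi>1 \<phi>2) then show ?case by (cases \<psi>) auto
  next
    case (Neg \<phi>) then show ?case by (cases \<psi>) auto
  next
    case (ExI \<phi>) then show ?case by (cases \<psi>) auto
  next
    case (ExP \<phi>) then show ?case by (cases \<psi>) auto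
  qed
qed

lemma computable_eq_nat: "computable (\<lambda>p. fst p = (snd p :: nat))"
  by (rule computable_eq) (simp add: inj_def)

lemma computable_eq_bool: "computable (\<lambda>p. fst p = (snd p :: bool))"
  by (rule computable_eq) (simp add: inj_def)

lemma computable_eq_form: "computable (\<lambda>p. fst p = (snd p :: form))"
  by (rule computable_eq) (simp add: inj_code_form)

lemmas [rc_intros] =
  rcomputable_comp[OF computable_fst] rcomputable_comp[OF computable_snd]
  rcomputable_comp[OF computable_Suc] rcomputable_comp[OF computable_pred]
  rcomputable_comp[OF computable_prod_encode]
  rcomputable_comp[OF computable_pfst] rcomputable_comp[OF computable_psnd]
  rcomputable_comp[OF computable_list_encode] rcomputable_comp[OF computable_list_decode]
  rcomputable_comp[OF computable_of_bool] rcomputable_comp[OF computable_Not]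
  rcomputable_comp[OF computable_hd] rcomputable_comp[OF computable_tl]
  rcomputable_comp[OF computable_Nil] rcomputable_comp2[OF computable_Cons]
  rcomputable_comp2[OF computable_eq_nat] rcomputable_comp2[OF computable_eq_bool]
  rcomputable_comp2[OF computable_eq_form]

lemma rcomputable_conj [rc_intros]:
  assumes "rcomputable F m N A P" "rcomputable F m N (\<lambda>e. A e \<and> P e) Q"
  shows "rcomputable F m N A (\<lambda>e. P e \<and> Q e)"
proof -
  have "(\<lambda>e. P e \<and> Q e) = (\<lambda>e. if P e then Q e else False)" by auto
  then show ?thesis using assms by (simp only: rcomputable_if rcomputable_const)
qed

lemma rcomputable_disj [rc_intros]:
  assumes "rcomputable F m N A P" "rcomputable F m N (\<lambda>e. A e \<and> \<not> P e) Q"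
  shows "rcomputable F m N A (\<lambda>e. P e \<or> Q e)"
proof -
  have "(\<lambda>e. P e \<or> Q e) = (\<lambda>e. if P e then True else Q e)" by auto
  then show ?thesis using assms by (simp only: rcomputable_if rcomputable_const)
qed

lemma rcomputable_imp [rc_intros]:
  assumes "rcomputable F m N A P" "rcomputable F m N (\<lambda>e. A e \<and> P e) Q"
  shows "rcomputable F m N A (\<lambda>e. P e \<longrightarrow> Q e)"
proof -
  have "(\<lambda>e. P e \<longrightarrow> Q e) = (\<lambda>e. if P e then Q e else True)" by auto
  then show ?thesis using assms by (simp only: rcomputable_if rcomputable_const)
qed

text \<open>\<open>list_encode\<close> puts a \<open>Suc\<close> around every cell of the list,
  which the subtractions strip.\<close>

abbreviation code_tag :: "nat \<Rightarrow> nat" where "code_tag n \<equiv> pfst (n - 1)"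

abbreviation code_arg1 :: "nat \<Rightarrow> nat" where "code_arg1 n \<equiv> pfst (psnd (n - 1) - 1)"

abbreviation code_arg2 :: "nat \<Rightarrow> nat" where "code_arg2 n \<equiv> pfst (psnd (psnd (n - 1) - 1) - 1)"

text \<open>Recursive equations over constructors are rephrased below as tests on numeric tags, with
  selectors that take some fixed value on the wrong constructors; in this shape they fit
  \<open>computable_recI\<close>.\<close>

definition ftag :: "form \<Rightarrow> nat" where "ftag \<phi> = code_tag (code_form \<phi>)"

definition farg1 :: "form \<Rightarrow> nat" where "farg1 \<phi> = code_arg1 (code_form \<phi>)"

definition farg2 :: "form \<Rightarrow> nat" where "farg2 \<phi> = code_arg2 (code_form \<phi>)"

fun fsub1 :: "form \<Rightarrow> form" where
  "fsub1 (And \<phi> \<psi>) = \<phi>"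
| "fsub1 (Neg \<phi>) = \<phi>"
| "fsub1 (ExI \<phi>) = \<phi>"
| "fsub1 (ExP \<phi>) = \<phi>"
| "fsub1 _ = Top"

fun fsub2 :: "form \<Rightarrow> form" where
  "fsub2 (And \<phi> \<psi>) = \<psi>"
| "fsub2 _ = Top"

definition rtag :: "rule \<Rightarrow> nat" where "rtag r = code_tag (code_rule r)"

definition rarg :: "rule \<Rightarrow> nat" where "rarg r = code_arg1 (code_rule r)"

fun rform :: "rule \<Rightarrow> form" where
  "rform (SyncCompr \<chi>) = \<chi>"
| "rform _ = Top"

lemma computable_ftag: "computable ftag"
  by (rule computable_code[of "\<lambda>n. code_tag n"]) (simp_all add: ftag_def trec_rules del: One_nat_def)

lemma computable_farg1: "computable farg1"
  by (rule computable_code[of "\<lambda>n. code_arg1 n"]) (simp_all add: farg1_def trec_rules del: One_nat_def)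

lemma computable_farg2: "computable farg2"
  by (rule computable_code[of "\<lambda>n. code_arg2 n"]) (simp_all add: farg2_def trec_rules del: One_nat_def)

lemma computable_rtag: "computable rtag"
  by (rule computable_code[of "\<lambda>n. code_tag n"]) (simp_all add: rtag_def trec_rules del: One_nat_def)

lemma computable_rarg: "computable rarg"
  by (rule computable_code[of "\<lambda>n. code_arg1 n"]) (simp_all add: rarg_def trec_rules del: One_nat_def)

lemma computable_fsub1: "computable fsub1"
proof (rule computable_code)
  let ?g = "\<lambda>n. if code_tag n = 7 then code_arg1 n else if code_tag n = 8 then code_arg1 n else
    if code_tag n = 9 then code_arg1 n else if code_tag n = 10 then code_arg1 n else code_form Top"
  show "trec ?g" by (intro trec_rules)
  show "?g (enc \<phi>) = enc (fsub1 \<phi>)" for \<phi>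
    by (cases \<phi>) auto
qed

lemma computable_fsub2: "computable fsub2"
proof (rule computable_code)
  let ?g = "\<lambda>n. if code_tag n = 7 then code_arg2 n else code_form Top"
  show "trec ?g" by (intro trec_rules)
  show "?g (enc \<phi>) = enc (fsub2 \<phi>)" for \<phi>
    by (cases \<phi>) auto
qed

lemma computable_rform: "computable rform"
proof (rule computable_code)
  let ?g = "\<lambda>n. if code_tag n = 27 then code_arg1 n else code_form Top"
  show "trec ?g" by (intro trec_rules)
  show "?g (enc r) = enc (rform r)" for r
    by (cases r) auto
qed

lemma computable_mbit: "computable mbit"
proof (rule computable_code)
  let ?g = "\<lambda>n. if code_tag n = 1 then code_arg1 n else 0"
  show "trec ?g" by (intro trec_rules)
  show "?g (enc m) = enc (mbit m)" for m
    by (cases m) auto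
qed

lemma computable_mfst: "computable mfst"
proof (rule computable_code)
  let ?g = "\<lambda>n. if code_tag n = 2 then code_arg1 n else code_move Star"
  show "trec ?g" by (intro trec_rules)
  show "?g (enc m) = enc (mfst m)" for m
    by (cases m) auto
qed

lemma computable_msnd: "computable msnd"
proof (rule computable_code)
  let ?g = "\<lambda>n. if code_tag n = 2 then code_arg2 n else code_move Star"
  show "trec ?g" by (intro trec_rules)
  show "?g (enc m) = enc (msnd m)" for m
    by (cases m) auto
qed

lemma computable_Bit: "computable Bit"
  by (rule computable_code[of "\<lambda>n. Suc \<langle>1, Suc \<langle>n, 0\<rangle>\<rangle>"]) (auto intro!: trec_rules)

lemma computable_MPair: "computable (\<lambda>p. MPair (fst p) (snd p))"
  by (rule computable_code[of "\<lambda>n. Suc \<langle>2, Suc \<langle>pfst n, Suc \<langle>psnd n, 0\<rangle>\<rangle>\<rangle>"])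
    (auto intro!: trec_rules)

lemma computable_drule: "computable drule"
proof (rule computable_code)
  show "trec (\<lambda>n. code_tag n)" by (intro trec_rules)
  show "code_tag (enc D) = enc (drule D)" for D
    by (cases D) auto
qed

lemma computable_dprems: "computable dprems"
proof (rule computable_code)
  show "trec (\<lambda>n. code_arg2 n)" by (intro trec_rules)
  show "code_arg2 (enc D) = enc (dprems D)" for D
    by (cases D) auto
qed

lemma computable_dhyps: "computable dhyps"
proof (rule computable_code)
  show "trec (\<lambda>n. code_tag (code_arg1 n))" by (intro trec_rules)
  show "code_tag (code_arg1 (enc D)) = enc (dhyps D)" for D
    by (cases D) (auto simp: dhyps_def code_sequent_def)
qed

lemma computable_dconcl: "computable dconcl"
proof (rule computable_code)
  show "trec (\<lambda>n. code_arg1 (code_arg1 n))" by (intro trec_rules)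
  show "code_arg1 (code_arg1 (enc D)) = enc (dconcl D)" for D
    by (cases D) (auto simp: dconcl_def code_sequent_def)
qed

lemmas [rc_intros] =
  rcomputable_comp[OF computable_ftag] rcomputable_comp[OF computable_farg1]
  rcomputable_comp[OF computable_farg2] rcomputable_comp[OF computable_fsub1]
  rcomputable_comp[OF computable_fsub2] rcomputable_comp[OF computable_rtag]
  rcomputable_comp[OF computable_rarg] rcomputable_comp[OF computable_rform]
  rcomputable_comp[OF computable_mbit] rcomputable_comp[OF computable_mfst]
  rcomputable_comp[OF computable_msnd] rcomputable_comp[OF computable_Bit]
  rcomputable_comp2[OF computable_MPair]
  rcomputable_comp[OF computable_drule] rcomputable_comp[OF computable_dprems]
  rcomputable_comp[OF computable_dhyps] rcomputable_comp[OF computable_dconcl]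

section \<open>List operations\<close>

lemma computable_append: "computable (\<lambda>p. fst p @ (snd p :: 'a::enc list))"
proof (rule computable_recI[where m = "\<lambda>p. length (fst p)" and
      B = "\<lambda>p. if fst p = [] then snd p else hd (fst p) # (tl (fst p) @ snd p)"])
  show "fst p @ snd p = (if fst p = [] then snd p else hd (fst p) # (tl (fst p) @ snd p))"
    for p :: "'a list \<times> 'a list" by simp
qed (intro rc_intros rcomputable_rec2[where f = "(@)"]; simp)

lemmas [rc_intros] = rcomputable_comp2[OF computable_append]

lemma computable_concat: "computable (concat :: 'a::enc list list \<Rightarrow> 'a list)"
proof (rule computable_recI[where m = length and
      B = "\<lambda>xs. if xs = [] then [] else hd xs @ concat (tl xs)"])
  show "concat xs = (if xs = [] then [] else hd xs @ concat (tl xs))" for xs :: "'a list list"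
    by (cases xs) auto
qed (intro rc_intros rcomputable_rec[where F = concat]; simp)

lemmas [rc_intros] = rcomputable_comp[OF computable_concat]

lemma computable_member:
  assumes "inj (enc :: 'a::enc \<Rightarrow> nat)"
  shows "computable (\<lambda>p. (fst p :: 'a) \<in> set (snd p))"
proof (rule computable_recI[where m = "\<lambda>p. length (snd p)" and
      B = "\<lambda>p. if snd p = [] then False else fst p = hd (snd p) \<or> fst p \<in> set (tl (snd p))"])
  show "(fst p \<in> set (snd p)) =
    (if snd p = [] then False else fst p = hd (snd p) \<or> fst p \<in> set (tl (snd p)))"
    for p :: "'a \<times> 'a list" by (cases "snd p") auto
qed (intro rc_intros rcomputable_rec2[where f = "\<lambda>x xs. x \<in> set xs"]
    rcomputable_comp2[OF computable_eq[OF assms]]; simp)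

lemma computable_member_nat: "computable (\<lambda>p. (fst p :: nat) \<in> set (snd p))"
  by (rule computable_member) (simp add: inj_def)

lemma computable_member_bool: "computable (\<lambda>p. (fst p :: bool) \<in> set (snd p))"
  by (rule computable_member) (simp add: inj_def)

lemmas [rc_intros] = rcomputable_comp2[OF computable_member_nat]
  rcomputable_comp2[OF computable_member_bool]

lemma computable_restrict_to: "computable (\<lambda>p. restrict_to (fst p) (snd p))"
proof (rule computable_recI[where m = "\<lambda>p. length (fst p)" and
      B = "\<lambda>p. if fst p = [] then [] else if hd (fst p) \<in> set (snd p)
        then hd (fst p) # restrict_to (tl (fst p)) (snd p) else restrict_to (tl (fst p)) (snd p)"])
  show "restrict_to (fst p) (snd p) = (if fst p = [] then [] else if hd (fst p) \<in> set (snd p)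
    then hd (fst p) # restrict_to (tl (fst p)) (snd p) else restrict_to (tl (fst p)) (snd p))" for p
    by (cases "fst p") (auto simp: restrict_to_def)
qed (intro rc_intros rcomputable_rec2[where f = restrict_to]; simp)

lemma computable_subseqs: "computable (subseqs :: 'a::enc list \<Rightarrow> 'a list list)"
proof (rule computable_recI[where m = length and
      B = "\<lambda>xs. if xs = [] then [[]] else map (\<lambda>ys. hd xs # ys) (subseqs (tl xs)) @ subseqs (tl xs)"])
  show "subseqs xs = (if xs = [] then [[]] else
    map (\<lambda>ys. hd xs # ys) (subseqs (tl xs)) @ subseqs (tl xs))" for xs :: "'a list"
    by (cases xs) (auto simp: Let_def)
qed (intro rc_intros rcomputable_rec[where F = subseqs]; simp)

lemma computable_pairs: "computable (\<lambda>p. pairs (fst p) (snd p))"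
  unfolding pairs_def by (rule computableI) (intro rc_intros)

lemmas [rc_intros] = rcomputable_comp2[OF computable_restrict_to] rcomputable_comp[OF computable_subseqs]
  rcomputable_comp2[OF computable_pairs]

lemma computable_bit_at: "computable (\<lambda>p. bit_at (fst p) (fst (snd p)) (snd (snd p)))"
proof (rule computable_recI[where m = "\<lambda>p. snd (snd p)" and
      B = "\<lambda>p. if fst (snd p) = [] then fst p else if snd (snd p) = 0 then hd (fst (snd p)) else
        bit_at (fst p) (tl (fst (snd p))) (snd (snd p) - 1)"])
  show "bit_at (fst p) (fst (snd p)) (snd (snd p)) = (if fst (snd p) = [] then fst p else
    if snd (snd p) = 0 then hd (fst (snd p)) else
        bit_at (fst p) (tl (fst (snd p))) (snd (snd p) - 1))" for p
    by (cases "fst (snd p)"; cases "snd (snd p)") auto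
qed (intro rc_intros rcomputable_rec3[where f = bit_at]; simp)

lemma computable_update_at:
  "computable (\<lambda>p. update_at (fst p) (fst (snd p)) (fst (snd (snd p))) (snd (snd (snd p))))"
proof (rule computable_recI[where m = "\<lambda>p. fst (snd (snd p))" and
      B = "\<lambda>p. if fst (snd (snd p)) = 0 then snd (snd (snd p)) # tl (fst (snd p)) else
        (if fst (snd p) = [] then fst p else hd (fst (snd p))) #
        update_at (fst p) (tl (fst (snd p))) (fst (snd (snd p)) - 1) (snd (snd (snd p)))"])
  show "update_at (fst p) (fst (snd p)) (fst (snd (snd p))) (snd (snd (snd p))) =
    (if fst (snd (snd p)) = 0 then snd (snd (snd p)) # tl (fst (snd p)) else
        (if fst (snd p) = [] then fst p else hd (fst (snd p))) #
        update_at (fst p) (tl (fst (snd p))) (fst (snd (snd p)) - 1) (snd (snd (snd p))))" for p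
    by (cases "fst (snd (snd p))") auto
qed (intro rc_intros rcomputable_rec4[where f = update_at]; simp)

lemmas [rc_intros] = rcomputable_comp3[where f = bit_at, OF computable_bit_at]
  rcomputable_comp4[where f = update_at, OF computable_update_at]

lemma ftag_simps [simp]:
  "ftag (Eq x y) = 0" "ftag (Le x y) = 1" "ftag (Sc x y) = 2" "ftag (Zero x) = 3"
  "ftag (Mem x X) = 4" "ftag Top = 5" "ftag Bot = 6" "ftag (And \<phi> \<psi>) = 7" "ftag (Neg \<phi>) = 8"
  "ftag (ExI \<phi>) = 9" "ftag (ExP \<phi>) = 10"
  by (simp_all add: ftag_def)

lemma farg_simps [simp]:
  "farg1 (Eq x y) = x" "farg1 (Le x y) = x" "farg1 (Sc x y) = x" "farg1 (Zero x) = x"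
  "farg1 (Mem x X) = x"
  "farg2 (Eq x y) = y" "farg2 (Le x y) = y" "farg2 (Sc x y) = y" "farg2 (Mem x X) = X"
  by (simp_all add: farg1_def farg2_def)

lemma size_fsub:
  "ftag \<phi> = 7 \<Longrightarrow> size (fsub1 \<phi>) < size \<phi>" "ftag \<phi> = 7 \<Longrightarrow> size (fsub2 \<phi>) < size \<phi>"
  "ftag \<phi> = 8 \<Longrightarrow> size (fsub1 \<phi>) < size \<phi>" "ftag \<phi> = 9 \<Longrightarrow> size (fsub1 \<phi>) < size \<phi>"
  "ftag \<phi> = 10 \<Longrightarrow> size (fsub1 \<phi>) < size \<phi>"
  by (cases \<phi>; simp)+

section \<open>The automata of formulae\<close>

lemma computable_coerce: "computable (\<lambda>p. coerce (fst p) (snd p))"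
proof -
  let ?B = "\<lambda>p. if ftag (fst p) = 7 then
      MPair (coerce (fsub1 (fst p)) (mfst (snd p))) (coerce (fsub2 (fst p)) (msnd (snd p)))
    else if ftag (fst p) = 9 then
      MPair (Bit (mbit (mfst (snd p)))) (MPair Star (coerce (fsub1 (fst p)) (msnd (msnd (snd p)))))
    else if ftag (fst p) = 10 then
      MPair (Bit (mbit (mfst (snd p)))) (coerce (fsub1 (fst p)) (msnd (snd p)))
    else Star"
  show ?thesis
  proof (rule computable_recI[where m = "\<lambda>p. size (fst p)" and B = ?B])
    show "coerce (fst p) (snd p) = ?B p" for p by (cases "fst p") simp_all
  qed (intro rc_intros rcomputable_rec2[where f = coerce]; simp add: size_fsub)
qed

lemma computable_fstates: "computable fstates"
proof -
  let ?B = "\<lambda>\<phi>. if ftag \<phi> = 7 then pairs (fstates (fsub1 \<phi>)) (fstates (fsub2 \<phi>))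
    else if ftag \<phi> = 8 then fstates (fsub1 \<phi>)
    else if ftag \<phi> = 9 then map (\<lambda>t. list_encode t) (subseqs (pairs [0, 1, 2] (fstates (fsub1 \<phi>))))
    else if ftag \<phi> = 10 then map (\<lambda>t. list_encode t) (subseqs (fstates (fsub1 \<phi>)))
    else atom_states"
  show ?thesis
  proof (rule computable_recI[where m = size and B = ?B])
    show "fstates \<phi> = ?B \<phi>" for \<phi> by (cases \<phi>) simp_all
  qed (intro rc_intros rcomputable_rec[where F = fstates]; simp add: size_fsub)
qed

lemma computable_finit: "computable finit"
proof -
  let ?B = "\<lambda>\<phi>. if ftag \<phi> = 7 then \<langle>finit (fsub1 \<phi>), finit (fsub2 \<phi>)\<rangle>
    else if ftag \<phi> = 8 then finit (fsub1 \<phi>)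
    else if ftag \<phi> = 9 then list_encode [\<langle>0, finit (fsub1 \<phi>)\<rangle>]
    else if ftag \<phi> = 10 then list_encode [finit (fsub1 \<phi>)]
    else \<langle>0, 1\<rangle>"
  show ?thesis
  proof (rule computable_recI[where m = size and B = ?B])
    show "finit \<phi> = ?B \<phi>" for \<phi> by (cases \<phi>) simp_all
  qed (intro rc_intros rcomputable_rec[where F = finit]; simp add: size_fsub)
qed

lemmas [rc_intros] = rcomputable_comp2[where f = coerce, OF computable_coerce]
  rcomputable_comp[OF computable_fstates] rcomputable_comp[OF computable_finit]

text \<open>For the quantifiers the recursive calls occur inside \<open>map\<close>, one for each
  member of a state set. The measure looks at the formula alone, so these calls decrease it whatever
  the states are.\<close>

lemma computable_fstep:
  "computable (\<lambda>p. fstep (fst p) (fst (snd p)) (fst (snd (snd p))) (snd (snd (snd p))))"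
proof -
  let ?\<phi> = "\<lambda>p :: form \<times> nat \<times> bool list \<times> bool list. fst p"
  let ?s = "\<lambda>p :: form \<times> nat \<times> bool list \<times> bool list. fst (snd p)"
  let ?xs = "\<lambda>p :: form \<times> nat \<times> bool list \<times> bool list. fst (snd (snd p))"
  let ?Xs = "\<lambda>p :: form \<times> nat \<times> bool list \<times> bool list. snd (snd (snd p))"
  let ?x = "\<lambda>p. bit_at False (?xs p) (farg1 (?\<phi> p))"
  let ?y = "\<lambda>p. bit_at False (?xs p) (farg2 (?\<phi> p))"
  let ?B = "\<lambda>p. if ftag (?\<phi> p) = 0 then atom_state False (psnd (?s p) = 1 \<and> ?x p = ?y p)
    else if ftag (?\<phi> p) = 1 then atom_state (pfst (?s p) = 1 \<or> ?x p)
      (psnd (?s p) = 1 \<and> (?y p \<longrightarrow> pfst (?s p) = 1 \<or> ?x p))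
    else if ftag (?\<phi> p) = 2 then atom_state (?x p) (psnd (?s p) = 1 \<and> ?y p = (pfst (?s p) = 1))
    else if ftag (?\<phi> p) = 3 then atom_state True (psnd (?s p) = 1 \<and> (?x p \<longrightarrow> pfst (?s p) \<noteq> 1))
    else if ftag (?\<phi> p) = 4 then atom_state False
      (psnd (?s p) = 1 \<and> (?x p \<longrightarrow> bit_at False (?Xs p) (farg2 (?\<phi> p))))
    else if ftag (?\<phi> p) = 5 then atom_state False True
    else if ftag (?\<phi> p) = 6 then atom_state False False
    else if ftag (?\<phi> p) = 7 then \<langle>fstep (fsub1 (?\<phi> p)) (pfst (?s p)) (?xs p) (?Xs p),
      fstep (fsub2 (?\<phi> p)) (psnd (?s p)) (?xs p) (?Xs p)\<rangle>
    else if ftag (?\<phi> p) = 8 then fstep (fsub1 (?\<phi> p)) (?s p) (?xs p) (?Xs p)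
    else if ftag (?\<phi> p) = 9 then list_encode (restrict_to (pairs [0, 1, 2] (fstates (fsub1 (?\<phi> p))))
      (map (\<lambda>t. \<langle>pfst t, fstep (fsub1 (?\<phi> p)) (psnd t) (False # ?xs p) (?Xs p)\<rangle>)
          (list_decode (?s p)) @
       map (\<lambda>t. \<langle>if pfst t = 0 then 1 else 2, fstep (fsub1 (?\<phi> p)) (psnd t) (True # ?xs p) (?Xs p)\<rangle>)
          (list_decode (?s p))))
    else if ftag (?\<phi> p) = 10 then list_encode (restrict_to (fstates (fsub1 (?\<phi> p)))
      (map (\<lambda>t. fstep (fsub1 (?\<phi> p)) t (?xs p) (False # ?Xs p)) (list_decode (?s p)) @
       map (\<lambda>t. fstep (fsub1 (?\<phi> p)) t (?xs p) (True # ?Xs p)) (list_decode (?s p))))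
    else 0"
  show ?thesis
  proof (rule computable_recI[where m = "\<lambda>p. size (fst p)" and B = ?B])
    show "fstep (?\<phi> p) (?s p) (?xs p) (?Xs p) = ?B p" for p
      by (cases "fst p") (simp_all add: bump_def)
  qed (intro rc_intros rcomputable_rec4[where f = fstep]; simp add: size_fsub)
qed

lemma computable_facc: "computable (\<lambda>p. facc (fst p) (snd p))"
proof -
  let ?B = "\<lambda>p. if ftag (fst p) = 7 then
      facc (fsub1 (fst p)) (pfst (snd p)) \<and> facc (fsub2 (fst p)) (psnd (snd p))
    else if ftag (fst p) = 8 then \<not> facc (fsub1 (fst p)) (snd p)
    else if ftag (fst p) = 9 then
      True \<in> set (map (\<lambda>t. pfst t = 1 \<and> facc (fsub1 (fst p)) (psnd t)) (list_decode (snd p)))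
    else if ftag (fst p) = 10 then
      True \<in> set (map (\<lambda>t. facc (fsub1 (fst p)) t) (list_decode (snd p)))
    else psnd (snd p) = 1"
  show ?thesis
  proof (rule computable_recI[where m = "\<lambda>p. size (fst p)" and B = ?B])
    show "facc (fst p) (snd p) = ?B p" for p by (cases "fst p") simp_all
  qed (intro rc_intros rcomputable_rec2[where f = facc]; simp add: size_fsub)
qed

lemmas [rc_intros] = rcomputable_comp4[where f = fstep, OF computable_fstep]
  rcomputable_comp2[where f = facc, OF computable_facc]

section \<open>The data of a derivation\<close>

lemma computable_local_form: "computable local_form"
proof -
  have "local_form = (\<lambda>r. if rtag r = 16 then Zero 0 else if rtag r = 18 then Sc 1 0 else rform r)"
  proof
    show "local_form r = (if rtag r = 16 then Zero 0 else if rtag r = 18 then Sc 1 0 else rform r)" for r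
      by (cases r) (simp_all add: rtag_def)
  qed
  moreover have "computable \<dots>" by (rule computableI) (intro rc_intros)
  ultimately show ?thesis by simp
qed

lemma computable_sc_var: "computable sc_var"
proof -
  have "sc_var = (\<lambda>\<phi>. if ftag \<phi> = 9 \<and> ftag (fsub1 \<phi>) = 2 then farg1 (fsub1 \<phi>) - 1 else 0)"
  proof
    show "sc_var \<phi> = (if ftag \<phi> = 9 \<and> ftag (fsub1 \<phi>) = 2 then farg1 (fsub1 \<phi>) - 1 else 0)" for \<phi>
      by (cases \<phi> rule: sc_var.cases) simp_all
  qed
  moreover have "computable \<dots>" by (rule computableI) (intro rc_intros)
  ultimately show ?thesis by simp
qed

lemmas [rc_intros] = rcomputable_comp[OF computable_local_form] rcomputable_comp[OF computable_sc_var]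

lemma computable_assoc_move: "computable (\<lambda>p. assoc_move (fst p) (fst (snd p)) (snd (snd p)))"
proof (rule computable_recI[where m = "\<lambda>p. length (fst (snd p))" and
      B = "\<lambda>p. if fst (snd p) = [] \<or> snd (snd p) = [] then Star else
        if hd (fst (snd p)) = fst p then hd (snd (snd p)) else
        assoc_move (fst p) (tl (fst (snd p))) (tl (snd (snd p)))"])
  show "assoc_move (fst p) (fst (snd p)) (snd (snd p)) =
    (if fst (snd p) = [] \<or> snd (snd p) = [] then Star else
        if hd (fst (snd p)) = fst p then hd (snd (snd p)) else
        assoc_move (fst p) (tl (fst (snd p))) (tl (snd (snd p))))" for p
    by (cases "fst (snd p)"; cases "snd (snd p)") auto
qed (intro rc_intros rcomputable_rec3[where f = assoc_move]; simp)

lemmas [rc_intros] = rcomputable_comp3[where f = assoc_move, OF computable_assoc_move]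

lemma computable_second_env: "computable (\<lambda>p. second_env (fst p) (fst (snd p)) (snd (snd p)))"
proof -
  let ?d = "\<lambda>p :: rule \<times> env \<times> move. fst (fst (snd p))"
  let ?xs = "\<lambda>p :: rule \<times> env \<times> move. fst (snd (fst (snd p)))"
  let ?Xs = "\<lambda>p :: rule \<times> env \<times> move. fst (snd (snd (fst (snd p))))"
  let ?ms = "\<lambda>p :: rule \<times> env \<times> move. snd (snd (snd (fst (snd p))))"
  let ?b = "\<lambda>p :: rule \<times> env \<times> move. snd (snd p)"
  let ?B = "\<lambda>p. if rtag (fst p) = 1 then (?d p, ?xs p, ?Xs p, ?ms p @ [?b p])
    else if rtag (fst p) = 8 then (?d p, update_at (?d p) (?xs p) (rarg (fst p)) (mbit (mfst (?b p))), ?Xs p,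
      ?ms p @ [msnd (msnd (?b p))])
    else if rtag (fst p) = 10 then (?d p, ?xs p, update_at False (?Xs p) (rarg (fst p)) (mbit (mfst (?b p))),
      ?ms p @ [msnd (?b p)])
    else fst (snd p)"
  have "(\<lambda>p. second_env (fst p) (fst (snd p)) (snd (snd p))) = ?B"
  proof
    show "second_env (fst p) (fst (snd p)) (snd (snd p)) = ?B p" for p
      by (cases p; cases "fst p") (auto simp: rtag_def rarg_def)
  qed
  moreover have "computable ?B" by (rule computableI) (intro rc_intros)
  ultimately show ?thesis by simp
qed

lemmas [rc_intros] = rcomputable_comp3[where f = second_env, OF computable_second_env]

lemma raw_output_eq: "raw_output r \<Gamma> \<phi> a w b1 b2 =
  (if rtag r = 0 then assoc_move \<phi> \<Gamma> (snd (snd (snd a)))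
   else if rtag r = 1 \<or> rtag r = 8 \<or> rtag r = 10 then b2
   else if rtag r = 4 then MPair b1 b2
   else if rtag r = 5 then mfst b1
   else if rtag r = 6 then msnd b1
   else if rtag r = 7 then MPair (Bit (bit_at (fst a) (fst (snd a)) (rarg r))) (MPair Star b1)
   else if rtag r = 9 then MPair (Bit (bit_at False (fst (snd (snd a))) (rarg r))) b1
   else if rtag r = 12 then b1
   else if rtag r = 16 \<or> rtag r = 18 then MPair (Bit w) Star
   else if rtag r = 27 then MPair (Bit w) b1
   else Star)"
  by (cases a; cases r) (auto simp: rtag_def rarg_def)

lemma computable_combine: "computable (\<lambda>p. combine (fst p) (fst (snd p)) (fst (snd (snd p)))
    (fst (snd (snd (snd p)))) (fst (snd (snd (snd (snd p)))))
    (fst (snd (snd (snd (snd (snd p)))))) (snd (snd (snd (snd (snd (snd p)))))))"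
  unfolding combine_def local_step_def raw_output_eq by (rule computableI) (intro rc_intros)

lemma rcomputable_combine [rc_intros]:
  assumes "rcomputable F m N A r" "rcomputable F m N A \<Gamma>" "rcomputable F m N A \<phi>"
    "rcomputable F m N A s" "rcomputable F m N A a" "rcomputable F m N A q1"
    "rcomputable F m N A q2"
  shows "rcomputable F m N A (\<lambda>e. combine (r e) (\<Gamma> e) (\<phi> e) (s e) (a e) (q1 e) (q2 e))"
proof -
  have "rcomputable F m N A (\<lambda>e. (r e, \<Gamma> e, \<phi> e, s e, a e, q1 e, q2 e))"
    by (intro rcomputable_pair assms)
  from rcomputable_comp[OF computable_combine this] show ?thesis by simp
qed

lemma computable_dstates: "computable dstates"
  by (rule computable_recI[where m = size, OF _ dstates.simps])
    (intro rc_intros rcomputable_rec[where F = dstates]; simp add: size_hd_dprems size_second_dprems)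

lemma computable_dinit: "computable dinit"
  by (rule computable_recI[where m = size, OF _ dinit.simps])
    (intro rc_intros rcomputable_rec[where F = dinit]; simp add: size_hd_dprems size_second_dprems)

lemma computable_dstep: "computable (\<lambda>p. dstep (fst p) (fst (snd p)) (snd (snd p)))"
  by (rule computable_recI[where m = "\<lambda>p. size (fst p)", OF _ dstep.simps])
    (intro rc_intros rcomputable_rec3[where f = dstep]; simp add: size_hd_dprems size_second_dprems)

lemmas [rc_intros] = rcomputable_comp[OF computable_dstates] rcomputable_comp[OF computable_dinit]
  rcomputable_comp3[where f = dstep, OF computable_dstep]

lemma computable_move_list: "computable move_list"
proof -
  let ?B = "\<lambda>\<phi>. if ftag \<phi> = 7 then concat (map (\<lambda>m. map (\<lambda>m'. MPair m m')
        (move_list (fsub2 \<phi>))) (move_list (fsub1 \<phi>)))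
    else if ftag \<phi> = 9 then
      concat (map (\<lambda>b. map (\<lambda>m. MPair (Bit b) (MPair Star m)) (move_list (fsub1 \<phi>))) [False, True])
    else if ftag \<phi> = 10 then
      concat (map (\<lambda>b. map (\<lambda>m. MPair (Bit b) m) (move_list (fsub1 \<phi>))) [False, True])
    else [Star]"
  show ?thesis
  proof (rule computable_recI[where m = size and B = ?B])
    show "move_list \<phi> = ?B \<phi>" for \<phi> by (cases \<phi>) simp_all
  qed (intro rc_intros rcomputable_rec[where F = move_list]; simp add: size_fsub)
qed

lemmas [rc_intros] = rcomputable_comp[OF computable_move_list]

lemma computable_bool_lists: "computable bool_lists"
proof (rule computable_recI[where m = "\<lambda>n. n" and B = "\<lambda>n. if n = 0 then [[]] else
      concat (map (\<lambda>b. map (\<lambda>bs. b # bs) (bool_lists (n - 1))) [False, True])"])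
  show "bool_lists n = (if n = 0 then [[]] else
      concat (map (\<lambda>b. map (\<lambda>bs. b # bs) (bool_lists (n - 1))) [False, True]))" for n
    by (cases n) simp_all
qed (intro rc_intros rcomputable_rec[where F = bool_lists]; simp)

lemma computable_move_lists: "computable move_lists"
proof (rule computable_recI[where m = length and B = "\<lambda>\<Gamma>. if \<Gamma> = [] then [[]] else
      concat (map (\<lambda>m. map (\<lambda>ms. m # ms) (move_lists (tl \<Gamma>))) (move_list (hd \<Gamma>)))"])
  show "move_lists \<Gamma> = (if \<Gamma> = [] then [[]] else
      concat (map (\<lambda>m. map (\<lambda>ms. m # ms) (move_lists (tl \<Gamma>))) (move_list (hd \<Gamma>))))" for \<Gamma>
    by (cases \<Gamma>) simp_all
qed (intro rc_intros rcomputable_rec[where F = move_lists]; simp)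

lemma computable_stars: "computable stars"
proof (rule computable_recI[where m = "\<lambda>n. n" and
      B = "\<lambda>n. if n = 0 then [] else Star # stars (n - 1)"])
  show "stars n = (if n = 0 then [] else Star # stars (n - 1))" for n
    by (cases n) simp_all
qed (intro rc_intros rcomputable_rec[where F = stars]; simp)

lemmas [rc_intros] = rcomputable_comp[OF computable_bool_lists] rcomputable_comp[OF computable_move_lists]
  rcomputable_comp[OF computable_stars]

lemma computable_input_list:
  "computable (\<lambda>p. input_list (fst p) (fst (snd p)) (snd (snd p)))"
  unfolding input_list_def by (rule computableI) (intro rc_intros)

lemma computable_top_step:
  "computable (\<lambda>p. top_step (fst p) (fst (snd p)) (snd (snd p)))"
  unfolding top_step_def Let_def by (rule computableI) (intro rc_intros)

lemma computable_code_move: "computable code_move"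
  by (rule computable_code[of "\<lambda>n. n"]) (auto intro!: trec_rules)

lemmas [rc_intros] = rcomputable_comp3[where f = input_list, OF computable_input_list]
  rcomputable_comp3[where f = top_step, OF computable_top_step]
  rcomputable_comp[OF computable_code_move]

lemma computable_code_input: "computable code_input"
proof -
  have "code_input = (\<lambda>a. list_encode [list_encode (map (\<lambda>b. of_bool b) (fst a)),
    list_encode (map (\<lambda>b. of_bool b) (fst (snd a))),
    list_encode (map (\<lambda>m. code_move m) (fst (snd (snd a)))),
    list_encode (map (\<lambda>m. code_move m) (snd (snd (snd a))))])"
    by (rule ext) (auto simp del: list_encode.simps)
  moreover have "computable \<dots>" by (rule computableI) (intro rc_intros)
  ultimately show ?thesis by simp
qed

lemmas [rc_intros] = rcomputable_comp[OF computable_code_input]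

lemma computable_machine:
  "computable (\<lambda>p. code_mealy (machine (fst p) (fst (snd p)) (snd (snd p))))"
proof -
  have "(\<lambda>p. code_mealy (machine (fst p) (fst (snd p)) (snd (snd p)))) =
    (\<lambda>p. list_encode [list_encode (pairs [0, 1] (dstates (fst p))), \<langle>0, dinit (fst p)\<rangle>,
      list_encode (concat (map (\<lambda>q. map (\<lambda>a. list_encode [q, code_input a,
          fst (top_step (fst p) q a), code_move (snd (top_step (fst p) q a))])
        (input_list (fst (snd p)) (snd (snd p)) (dhyps (fst p)))) (pairs [0, 1] (dstates (fst p)))))])"
    by (rule ext) (auto simp: code_mealy_def machine_def map_concat comp_def split_beta
        simp del: list_encode.simps)
  moreover have "computable \<dots>" by (rule computableI) (intro rc_intros)
  ultimately show ?thesis by simp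
qed

lemma machine_recursive:
  "\<exists>r. \<forall>D l p. computes r [code_deriv D, l, p] (code_mealy (machine D l p))"
proof -
  obtain r where r: "\<And>x. computes r [enc x]
      (enc (code_mealy (machine (fst x) (fst (snd x)) (snd (snd x)))))"
    using computable_computes[OF computable_machine] by blast
  have "prc 3 (\<lambda>xs. \<langle>xs ! 0, \<langle>xs ! 1, xs ! 2\<rangle>\<rangle>)"
    by (intro prc_pair prc_nth) auto
  then obtain s where s: "\<And>xs. length xs = 3 \<Longrightarrow> computes s xs \<langle>xs ! 0, \<langle>xs ! 1, xs ! 2\<rangle>\<rangle>"
    unfolding prc_def by blast
  have "computes (Comp r [s]) [code_deriv D, l, p] (code_mealy (machine D l p))" for D l p
    using r[of "(D, l, p)"] s[of "[code_deriv D, l, p]"]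
    by (intro computes.intros(4)[of "[\<langle>code_deriv D, \<langle>l, p\<rangle>\<rangle>]"]) auto
  then show ?thesis by blast
qed

section \<open>Runs of interpretations\<close>

primrec sat :: "form \<Rightarrow> (nat \<Rightarrow> nat) \<Rightarrow> (nat \<Rightarrow> nat \<Rightarrow> bool) \<Rightarrow> bool" where
  "sat (Eq x y) \<kappa> \<sigma> \<longleftrightarrow> \<kappa> x = \<kappa> y"
| "sat (Le x y) \<kappa> \<sigma> \<longleftrightarrow> \<kappa> x \<le> \<kappa> y"
| "sat (Sc x y) \<kappa> \<sigma> \<longleftrightarrow> \<kappa> y = Suc (\<kappa> x)"
| "sat (Zero x) \<kappa> \<sigma> \<longleftrightarrow> \<kappa> x = 0"
| "sat (Mem x X) \<kappa> \<sigma> \<longleftrightarrow> \<sigma> X (\<kappa> x)"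
| "sat Top \<kappa> \<sigma> \<longleftrightarrow> True"
| "sat Bot \<kappa> \<sigma> \<longleftrightarrow> False"
| "sat (And \<phi> \<psi>) \<kappa> \<sigma> \<longleftrightarrow> sat \<phi> \<kappa> \<sigma> \<and> sat \<psi> \<kappa> \<sigma>"
| "sat (Neg \<phi>) \<kappa> \<sigma> \<longleftrightarrow> \<not> sat \<phi> \<kappa> \<sigma>"
| "sat (ExI \<phi>) \<kappa> \<sigma> \<longleftrightarrow> (\<exists>k. sat \<phi> (case_nat k \<kappa>) \<sigma>)"
| "sat (ExP \<phi>) \<kappa> \<sigma> \<longleftrightarrow> (\<exists>S. sat \<phi> \<kappa> (case_nat S \<sigma>))"

text \<open>Negation refers to truth instead of realizers: its automaton recognizes a complement,
  and a formula has a realizer exactly when it is true, by \<open>realizer_sat\<close> and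
  \<open>sat_realizer\<close>.\<close>

primrec realizer :: "form \<Rightarrow> (nat \<Rightarrow> move) \<Rightarrow> (nat \<Rightarrow> nat) \<Rightarrow> (nat \<Rightarrow> nat \<Rightarrow> bool) \<Rightarrow> bool" where
  "realizer (Eq x y) R \<kappa> \<sigma> \<longleftrightarrow> R = (\<lambda>n. Star) \<and> \<kappa> x = \<kappa> y"
| "realizer (Le x y) R \<kappa> \<sigma> \<longleftrightarrow> R = (\<lambda>n. Star) \<and> \<kappa> x \<le> \<kappa> y"
| "realizer (Sc x y) R \<kappa> \<sigma> \<longleftrightarrow> R = (\<lambda>n. Star) \<and> \<kappa> y = Suc (\<kappa> x)"
| "realizer (Zero x) R \<kappa> \<sigma> \<longleftrightarrow> R = (\<lambda>n. Star) \<and> \<kappa> x = 0"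
| "realizer (Mem x X) R \<kappa> \<sigma> \<longleftrightarrow> R = (\<lambda>n. Star) \<and> \<sigma> X (\<kappa> x)"
| "realizer Top R \<kappa> \<sigma> \<longleftrightarrow> R = (\<lambda>n. Star)"
| "realizer Bot R \<kappa> \<sigma> \<longleftrightarrow> False"
| "realizer (And \<phi> \<psi>) R \<kappa> \<sigma> \<longleftrightarrow>
     (\<exists>R1 R2. R = (\<lambda>n. MPair (R1 n) (R2 n)) \<and> realizer \<phi> R1 \<kappa> \<sigma> \<and> realizer \<psi> R2 \<kappa> \<sigma>)"
| "realizer (Neg \<phi>) R \<kappa> \<sigma> \<longleftrightarrow> R = (\<lambda>n. Star) \<and> \<not> sat \<phi> \<kappa> \<sigma>"
| "realizer (ExI \<phi>) R \<kappa> \<sigma> \<longleftrightarrow> (\<exists>k R'. R = (\<lambda>n. MPair (Bit (n = k)) (MPair Star (R' n))) \<and>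
     realizer \<phi> R' (case_nat k \<kappa>) \<sigma>)"
| "realizer (ExP \<phi>) R \<kappa> \<sigma> \<longleftrightarrow> (\<exists>S R'. R = (\<lambda>n. MPair (Bit (S n)) (R' n)) \<and>
     realizer \<phi> R' \<kappa> (case_nat S \<sigma>))"

abbreviation realizer_list ::
  "(nat \<Rightarrow> nat) \<Rightarrow> (nat \<Rightarrow> nat \<Rightarrow> bool) \<Rightarrow> form list \<Rightarrow> (nat \<Rightarrow> move) list \<Rightarrow> bool" where
  "realizer_list \<kappa> \<sigma> \<equiv> list_all2 (\<lambda>\<psi> R. realizer \<psi> R \<kappa> \<sigma>)"

lemma realizer_sat: "realizer \<phi> R \<kappa> \<sigma> \<Longrightarrow> sat \<phi> \<kappa> \<sigma>"
  by (induction \<phi> arbitrary: R \<kappa> \<sigma>) auto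

text \<open>The witnesses are merely chosen; nothing is claimed about their dependence on the input.
  This serves wherever a true hypothesis has to be fed to a machine whose output is only used for
  its truth.\<close>

lemma sat_realizer: "sat \<phi> \<kappa> \<sigma> \<Longrightarrow> \<exists>R. realizer \<phi> R \<kappa> \<sigma>"
proof (induction \<phi> arbitrary: \<kappa> \<sigma>)
  case (And \<phi> \<psi>)
  then obtain R1 R2 where "realizer \<phi> R1 \<kappa> \<sigma>" "realizer \<psi> R2 \<kappa> \<sigma>" by fastforce
  then have "realizer (And \<phi> \<psi>) (\<lambda>n. MPair (R1 n) (R2 n)) \<kappa> \<sigma>" by auto
  then show ?case by blast
next
  case (ExI \<phi>)
  then obtain k R where "realizer \<phi> R (case_nat k \<kappa>) \<sigma>" by fastforce
  then have "realizer (ExI \<phi>) (\<lambda>n. MPair (Bit (n = k)) (MPair Star (R n))) \<kappa> \<sigma>" by auto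
  then show ?case by blast
next
  case (ExP \<phi>)
  then obtain S R where "realizer \<phi> R \<kappa> (case_nat S \<sigma>)" by fastforce
  then have "realizer (ExP \<phi>) (\<lambda>n. MPair (Bit (S n)) (R n)) \<kappa> \<sigma>" by auto
  then show ?case by blast
qed auto

lemma realizer_coerce: "realizer \<phi> R \<kappa> \<sigma> \<Longrightarrow> coerce \<phi> (R n) = R n"
  by (induction \<phi> arbitrary: R \<kappa> \<sigma>) auto

lemma coerce_in_M: "coerce \<phi> m \<in> M \<phi>"
  by (induction \<phi> arbitrary: m) auto

text \<open>A deterministic formula has a single move, so coercing any stream \<open>f\<close>
  yields its only possible run.\<close>

lemma deterministic_realizer:
  "deterministic \<delta> \<Longrightarrow> sat \<delta> \<kappa> \<sigma> \<Longrightarrow> realizer \<delta> (\<lambda>n. coerce \<delta> (f n)) \<kappa> \<sigma>"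
proof (induction \<delta> arbitrary: f)
  case (And \<delta>1 \<delta>2)
  have "realizer \<delta>1 (\<lambda>n. coerce \<delta>1 (mfst (f n))) \<kappa> \<sigma>" "realizer \<delta>2 (\<lambda>n. coerce \<delta>2 (msnd (f n))) \<kappa> \<sigma>"
    using And by auto
  then show ?case unfolding realizer.simps coerce.simps
    by (intro exI[of _ "\<lambda>n. coerce \<delta>1 (mfst (f n))"] exI[of _ "\<lambda>n. coerce \<delta>2 (msnd (f n))"]) simp
qed auto

section \<open>Renaming and substitution\<close>

lemma case_nat_up: "(\<lambda>i. case_nat k \<kappa> (up f i)) = case_nat k (\<lambda>i. \<kappa> (f i))"
  by (auto simp: up_def fun_eq_iff split: nat.splits)

lemma sat_ren: "sat (ren f g \<phi>) \<kappa> \<sigma> \<longleftrightarrow> sat \<phi> (\<lambda>i. \<kappa> (f i)) (\<lambda>i. \<sigma> (g i))"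
  by (induction \<phi> arbitrary: f g \<kappa> \<sigma>) (auto simp: case_nat_up)

lemma realizer_ren: "realizer (ren f g \<phi>) R \<kappa> \<sigma> \<longleftrightarrow> realizer \<phi> R (\<lambda>i. \<kappa> (f i)) (\<lambda>i. \<sigma> (g i))"
  by (induction \<phi> arbitrary: f g R \<kappa> \<sigma>) (auto simp: case_nat_up sat_ren)

lemma sat_cong:
  "(\<And>i. i \<in> fvi \<phi> \<Longrightarrow> \<kappa> i = \<kappa>' i) \<Longrightarrow> (\<And>X. X \<in> fvp \<phi> \<Longrightarrow> \<sigma> X = \<sigma>' X) \<Longrightarrow>
    sat \<phi> \<kappa> \<sigma> \<longleftrightarrow> sat \<phi> \<kappa>' \<sigma>'"
proof (induction \<phi> arbitrary: \<kappa> \<kappa>' \<sigma> \<sigma>')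
  case (ExI \<phi>)
  have "sat \<phi> (case_nat k \<kappa>) \<sigma> \<longleftrightarrow> sat \<phi> (case_nat k \<kappa>') \<sigma>'" for k
    by (rule ExI.IH) (use ExI.prems in \<open>auto split: nat.splits\<close>)
  then show ?case by simp
next
  case (ExP \<phi>)
  have "sat \<phi> \<kappa> (case_nat S \<sigma>) \<longleftrightarrow> sat \<phi> \<kappa>' (case_nat S \<sigma>')" for S
    by (rule ExP.IH) (use ExP.prems in \<open>auto split: nat.splits\<close>)
  then show ?case by simp
next
  case (And \<phi> \<psi>)
  have "sat \<phi> \<kappa> \<sigma> \<longleftrightarrow> sat \<phi> \<kappa>' \<sigma>'" "sat \<psi> \<kappa> \<sigma> \<longleftrightarrow> sat \<psi> \<kappa>' \<sigma>'"
    using And.prems by (auto intro!: And.IH)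
  then show ?case by simp
next
  case (Neg \<phi>)
  have "sat \<phi> \<kappa> \<sigma> \<longleftrightarrow> sat \<phi> \<kappa>' \<sigma>'" using Neg.prems by (auto intro!: Neg.IH)
  then show ?case by simp
qed auto

lemma realizer_cong:
  "(\<And>i. i \<in> fvi \<phi> \<Longrightarrow> \<kappa> i = \<kappa>' i) \<Longrightarrow> (\<And>X. X \<in> fvp \<phi> \<Longrightarrow> \<sigma> X = \<sigma>' X) \<Longrightarrow>
    realizer \<phi> R \<kappa> \<sigma> \<longleftrightarrow> realizer \<phi> R \<kappa>' \<sigma>'"
proof (induction \<phi> arbitrary: R \<kappa> \<kappa>' \<sigma> \<sigma>')
  case (ExI \<phi>)
  have "realizer \<phi> R (case_nat k \<kappa>) \<sigma> \<longleftrightarrow> realizer \<phi> R (case_nat k \<kappa>') \<sigma>'" for k R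
    by (rule ExI.IH) (use ExI.prems in \<open>auto split: nat.splits\<close>)
  then show ?case by simp
next
  case (ExP \<phi>)
  have "realizer \<phi> R \<kappa> (case_nat S \<sigma>) \<longleftrightarrow> realizer \<phi> R \<kappa>' (case_nat S \<sigma>')" for S R
    by (rule ExP.IH) (use ExP.prems in \<open>auto split: nat.splits\<close>)
  then show ?case by simp
next
  case (And \<phi> \<psi>)
  have "realizer \<phi> R \<kappa> \<sigma> \<longleftrightarrow> realizer \<phi> R \<kappa>' \<sigma>'" "realizer \<psi> R \<kappa> \<sigma> \<longleftrightarrow> realizer \<psi> R \<kappa>' \<sigma>'" for R
    using And.prems by (auto intro!: And.IH)
  then show ?case by simp
next
  case (Neg \<phi>)
  have "sat \<phi> \<kappa> \<sigma> \<longleftrightarrow> sat \<phi> \<kappa>' \<sigma>'" using Neg.prems by (auto intro!: sat_cong)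
  then show ?case by simp
qed auto

text \<open>Semantic counterpart of the index shift in \<open>substp\<close>: the variable that was
  removed is put back with value \<open>S\<close>.\<close>

definition insert_at :: "nat \<Rightarrow> 'a \<Rightarrow> (nat \<Rightarrow> 'a) \<Rightarrow> nat \<Rightarrow> 'a" where
  "insert_at X S \<sigma> i = (if i < X then \<sigma> i else if i = X then S else \<sigma> (i - 1))"

lemma insert_at_0: "insert_at 0 S \<sigma> = case_nat S \<sigma>"
  by (auto simp: insert_at_def fun_eq_iff split: nat.splits)

lemma insert_at_Suc: "insert_at (Suc X) S (case_nat T \<sigma>) = case_nat T (insert_at X S \<sigma>)"
  by (auto simp: insert_at_def fun_eq_iff split: nat.splits)

lemma case_nat_up_Suc: "(\<lambda>i. case_nat n (case_nat k \<kappa>) (up Suc i)) = case_nat n \<kappa>"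
  by (simp add: case_nat_up)

lemma case_nat_inst: "(\<lambda>i. \<kappa> (case_nat t id i)) = case_nat (\<kappa> t) \<kappa>"
  by (auto simp: fun_eq_iff split: nat.splits)

lemma sat_substp:
  "sat (substp X \<psi> \<phi>) \<kappa> \<sigma> \<longleftrightarrow> sat \<phi> \<kappa> (insert_at X (\<lambda>n. sat \<psi> (case_nat n \<kappa>) \<sigma>) \<sigma>)"
proof (induction \<phi> arbitrary: X \<psi> \<kappa> \<sigma>)
  case (Mem x Y)
  then show ?case by (auto simp: insert_at_def insti_def sat_ren case_nat_inst)
next
  case (ExI \<phi>)
  then show ?case by (simp add: sat_ren case_nat_up_Suc)
next
  case (ExP \<phi>)
  then show ?case by (simp add: sat_ren insert_at_Suc)
qed auto

text \<open>At an atom replaced by \<open>\<psi>\<close>, a run of \<open>\<psi>\<close> is reduced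
  to the truth of \<open>\<psi>\<close> and its moves are forgotten by \<open>coerce\<close>; this
  loss is why an implication is stated. Negations carry no moves of their bodies, and there the
  equivalence \<open>sat_substp\<close> applies.\<close>

lemma realizer_substp:
  "realizer (substp X \<psi> \<phi>) R \<kappa> \<sigma> \<Longrightarrow>
    realizer \<phi> (\<lambda>n. coerce \<phi> (R n)) \<kappa> (insert_at X (\<lambda>n. sat \<psi> (case_nat n \<kappa>) \<sigma>) \<sigma>)"
proof (induction \<phi> arbitrary: X \<psi> R \<kappa> \<sigma>)
  case (Mem x Y)
  then show ?case
    by (auto simp: insert_at_def insti_def realizer_ren case_nat_inst dest: realizer_sat split: if_splits)
next
  case (And \<phi>1 \<phi>2)
  then show ?case by fastforce
next
  case (Neg \<phi>)
  then show ?case by (simp add: sat_substp)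
next
  case (ExI \<phi>)
  then obtain k R' where R: "R = (\<lambda>n. MPair (Bit (n = k)) (MPair Star (R' n)))"
    and realizer: "realizer (substp X (ren (up Suc) id \<psi>) \<phi>) R' (case_nat k \<kappa>) \<sigma>" by auto
  from ExI.IH[OF realizer] show ?case
    by (auto simp: R sat_ren case_nat_up_Suc)
next
  case (ExP \<phi>)
  then obtain S R' where R: "R = (\<lambda>n. MPair (Bit (S n)) (R' n))"
    and realizer: "realizer (substp (Suc X) (ren id Suc \<psi>) \<phi>) R' \<kappa> (case_nat S \<sigma>)" by auto
  from ExP.IH[OF realizer] show ?case
    by (auto simp: R sat_ren insert_at_Suc)
qed auto

section \<open>Accepting runs of the automata constructions\<close>

lemma det_run:
  assumes "moves A = {Star}" "range w \<subseteq> \<Sigma>"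
  shows "accepting_run R A w \<longleftrightarrow> R = (\<lambda>n. Star) \<and> w \<in> language \<Sigma> A"
proof -
  have "range R \<subseteq> {Star} \<longleftrightarrow> R = (\<lambda>n. Star)" for R :: "nat \<Rightarrow> move"
    by (auto simp: fun_eq_iff)
  then show ?thesis using assms by (auto simp: accepting_run_def language_def)
qed

lemma range_MPair: "range R \<subseteq> {MPair m m' | m m'. m \<in> A \<and> m' \<in> B} \<longleftrightarrow>
    (\<exists>R1 R2. R = (\<lambda>n. MPair (R1 n) (R2 n)) \<and> range R1 \<subseteq> A \<and> range R2 \<subseteq> B)"
proof
  assume R: "range R \<subseteq> {MPair m m' | m m'. m \<in> A \<and> m' \<in> B}"
  then have "\<exists>m m'. R n = MPair m m' \<and> m \<in> A \<and> m' \<in> B" for n by blast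
  then obtain R1 R2 where "\<And>n. R n = MPair (R1 n) (R2 n) \<and> R1 n \<in> A \<and> R2 n \<in> B" by metis
  then show "\<exists>R1 R2. R = (\<lambda>n. MPair (R1 n) (R2 n)) \<and> range R1 \<subseteq> A \<and> range R2 \<subseteq> B"
    by (intro exI[of _ R1] exI[of _ R2]) (auto simp: fun_eq_iff)
qed (auto dest: range_subsetD)

lemma sync_product_run:
  "accepting_run R (sync_product B C) w \<longleftrightarrow>
    (\<exists>R1 R2. R = (\<lambda>n. MPair (R1 n) (R2 n)) \<and> accepting_run R1 B w \<and> accepting_run R2 C w)"
proof -
  have "state_seq (sync_product B C) w (\<lambda>n. MPair (R1 n) (R2 n)) n =
    \<langle>state_seq B w R1 n, state_seq C w R2 n\<rangle>" for R1 R2 n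
    by (induction n) (auto simp: sync_product_def)
  then have *: "state_seq (sync_product B C) w (\<lambda>n. MPair (R1 n) (R2 n)) \<in> accepting (sync_product B C) \<longleftrightarrow>
    state_seq B w R1 \<in> accepting B \<and> state_seq C w R2 \<in> accepting C" for R1 R2
    by (simp add: sync_product_def)
  have moves: "moves (sync_product B C) = {MPair m m' | m m'. m \<in> moves B \<and> m' \<in> moves C}"
    by (simp add: sync_product_def)
  show ?thesis unfolding accepting_run_def moves range_MPair
  proof (intro iffI; elim exE conjE)
    fix R1 R2
    assume R: "R = (\<lambda>n. MPair (R1 n) (R2 n))" "range R1 \<subseteq> moves B" "range R2 \<subseteq> moves C"
      "state_seq (sync_product B C) w R \<in> accepting (sync_product B C)"
    with *[of R1 R2] show "\<exists>R1 R2. R = (\<lambda>n. MPair (R1 n) (R2 n)) \<and>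
      (range R1 \<subseteq> moves B \<and> state_seq B w R1 \<in> accepting B) \<and>
      (range R2 \<subseteq> moves C \<and> state_seq C w R2 \<in> accepting C)" by blast
  qed (use * in blast)
qed

lemma range_Bit_MPair: "range R \<subseteq> {MPair (Bit b) m | b m. m \<in> A} \<longleftrightarrow>
    (\<exists>S R'. R = (\<lambda>n. MPair (Bit (S n)) (R' n)) \<and> range R' \<subseteq> A)"
proof
  assume "range R \<subseteq> {MPair (Bit b) m | b m. m \<in> A}"
  then have "\<exists>b m. R n = MPair (Bit b) m \<and> m \<in> A" for n by blast
  then obtain S R' where "\<And>n. R n = MPair (Bit (S n)) (R' n) \<and> R' n \<in> A" by metis
  then show "\<exists>S R'. R = (\<lambda>n. MPair (Bit (S n)) (R' n)) \<and> range R' \<subseteq> A"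
    by (intro exI[of _ S] exI[of _ R']) (auto simp: fun_eq_iff)
qed (auto dest: range_subsetD)

lemma project_pred_run:
  "accepting_run R (project_pred B) w \<longleftrightarrow>
    (\<exists>S R'. R = (\<lambda>n. MPair (Bit (S n)) (R' n)) \<and>
      accepting_run R' B (\<lambda>n. (fst (w n), S n # snd (w n))))"
proof -
  have "state_seq (project_pred B) w (\<lambda>n. MPair (Bit (S n)) (R' n)) n =
    state_seq B (\<lambda>n. (fst (w n), S n # snd (w n))) R' n" for S R' n
    by (induction n) (auto simp: project_pred_def split: prod.splits)
  then have *: "state_seq (project_pred B) w (\<lambda>n. MPair (Bit (S n)) (R' n)) =
    state_seq B (\<lambda>n. (fst (w n), S n # snd (w n))) R'" for S R' by blast
  have moves: "moves (project_pred B) = {MPair (Bit b) m | b m. m \<in> moves B}"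
    and acc: "accepting (project_pred B) = accepting B"
    by (simp_all add: project_pred_def)
  show ?thesis unfolding accepting_run_def moves acc range_Bit_MPair
  proof (intro iffI; elim exE conjE)
    fix S R'
    assume "R = (\<lambda>n. MPair (Bit (S n)) (R' n))" "range R' \<subseteq> moves B"
      "state_seq (project_pred B) w R \<in> accepting B"
    with *[of S R'] show "\<exists>S R'. R = (\<lambda>n. MPair (Bit (S n)) (R' n)) \<and> range R' \<subseteq> moves B \<and>
      state_seq B (\<lambda>n. (fst (w n), S n # snd (w n))) R' \<in> accepting B" by auto
  next
    fix S R'
    assume "R = (\<lambda>n. MPair (Bit (S n)) (R' n))" "range R' \<subseteq> moves B"
      "state_seq B (\<lambda>n. (fst (w n), S n # snd (w n))) R' \<in> accepting B"
    with *[of S R'] show "(\<exists>S R'. R = (\<lambda>n. MPair (Bit (S n)) (R' n)) \<and> range R' \<subseteq> moves B) \<and>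
      state_seq (project_pred B) w R \<in> accepting B" by auto
  qed
qed

lemma project_ind_run:
  "accepting_run R (project_ind B) w \<longleftrightarrow>
    (\<exists>S R'. R = (\<lambda>n. MPair (Bit (S n)) (R' n)) \<and>
      accepting_run R' B (\<lambda>n. (S n # fst (w n), snd (w n))))"
proof -
  have "state_seq (project_ind B) w (\<lambda>n. MPair (Bit (S n)) (R' n)) n =
    state_seq B (\<lambda>n. (S n # fst (w n), snd (w n))) R' n" for S R' n
    by (induction n) (auto simp: project_ind_def split: prod.splits)
  then have *: "state_seq (project_ind B) w (\<lambda>n. MPair (Bit (S n)) (R' n)) =
    state_seq B (\<lambda>n. (S n # fst (w n), snd (w n))) R'" for S R' by blast
  have moves: "moves (project_ind B) = {MPair (Bit b) m | b m. m \<in> moves B}"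
    and acc: "accepting (project_ind B) = accepting B"
    by (simp_all add: project_ind_def)
  show ?thesis unfolding accepting_run_def moves acc range_Bit_MPair
  proof (intro iffI; elim exE conjE)
    fix S R'
    assume "R = (\<lambda>n. MPair (Bit (S n)) (R' n))" "range R' \<subseteq> moves B"
      "state_seq (project_ind B) w R \<in> accepting B"
    with *[of S R'] show "\<exists>S R'. R = (\<lambda>n. MPair (Bit (S n)) (R' n)) \<and> range R' \<subseteq> moves B \<and>
      state_seq B (\<lambda>n. (S n # fst (w n), snd (w n))) R' \<in> accepting B" by auto
  next
    fix S R'
    assume "R = (\<lambda>n. MPair (Bit (S n)) (R' n))" "range R' \<subseteq> moves B"
      "state_seq B (\<lambda>n. (S n # fst (w n), snd (w n))) R' \<in> accepting B"
    with *[of S R'] show "(\<exists>S R'. R = (\<lambda>n. MPair (Bit (S n)) (R' n)) \<and> range R' \<subseteq> moves B) \<and>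
      state_seq (project_ind B) w R \<in> accepting B" by auto
  qed
qed

lemma range_word: "length ks = l \<Longrightarrow> length \<sigma>s = p \<Longrightarrow> range (word ks \<sigma>s) \<subseteq> alphabet l p"
  by (auto simp: word_def alphabet_def)

lemma nth_Cons_case_nat: "(!) (x # xs) = case_nat x ((!) xs)"
  by (auto simp: fun_eq_iff split: nat.splits)

lemma atom_automaton_run:
  assumes "atom_automaton l p P A" "length ks = l" "length \<sigma>s = p"
  shows "accepting_run R A (word ks \<sigma>s) \<longleftrightarrow> R = (\<lambda>n. Star) \<and> P ks \<sigma>s"
  using assms det_run[of A "word ks \<sigma>s" "alphabet l p" R] range_word[of ks l \<sigma>s p]
  by (auto simp: atom_automaton_def det_automaton_def)

text \<open>The accepting runs on words that encode numbers and sets are the same for all automata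
  related to \<open>\<phi>\<close>, although atoms and negations leave a choice of automata: these
  have the single move \<open>Star\<close>, so their language on such words determines their
  runs.\<close>

lemma interp_accepting_run:
  assumes "interp \<phi> l p A" "length ks = l" "length \<sigma>s = p"
  shows "accepting_run R A (word ks \<sigma>s) \<longleftrightarrow> realizer \<phi> R ((!) ks) ((!) \<sigma>s)"
  using assms
proof (induction \<phi> arbitrary: l p A ks \<sigma>s R)
  case (And \<phi> \<psi>)
  then obtain B C where "interp \<phi> l p B" "interp \<psi> l p C" "A = sync_product B C" by auto
  then show ?case using And by (simp add: sync_product_run)
next
  case (Neg \<phi>)
  then obtain B where B: "interp \<phi> l p B" and A: "moves A = {Star}"
    and lang: "language (alphabet l p) A =
      {w. range w \<subseteq> alphabet l p \<and> w \<notin> language (alphabet l p) B}"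
    by (auto simp: det_automaton_def)
  have w: "range (word ks \<sigma>s) \<subseteq> alphabet l p" using Neg.prems by (simp add: range_word)
  have "word ks \<sigma>s \<in> language (alphabet l p) B \<longleftrightarrow> (\<exists>R. realizer \<phi> R ((!) ks) ((!) \<sigma>s))"
    using Neg.IH[OF B Neg.prems(2,3)] w by (auto simp: language_def)
  then have "word ks \<sigma>s \<in> language (alphabet l p) B \<longleftrightarrow> sat \<phi> ((!) ks) ((!) \<sigma>s)"
    using realizer_sat sat_realizer by blast
  then show ?case using det_run[OF A w] lang w by simp
next
  case (ExI \<phi>)
  then obtain S B where S: "singleton_automaton l p S" and B: "interp \<phi> (Suc l) p B"
    and A: "A = project_ind (sync_product S B)" by auto
  have run: "accepting_run R S w \<longleftrightarrow> R = (\<lambda>n. Star) \<and> (\<exists>k. \<forall>n. hd (fst (w n)) \<longleftrightarrow> n = k)"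
    if "range w \<subseteq> alphabet (Suc l) p" for R w
    using S det_run[OF _ that, of S R] that by (auto simp: singleton_automaton_def det_automaton_def)
  let ?ext = "\<lambda>\<beta> n. (\<beta> n # fst (word ks \<sigma>s n), snd (word ks \<sigma>s n))"
  have "range (?ext \<beta>) \<subseteq> alphabet (Suc l) p" for \<beta>
    using ExI.prems by (auto simp: word_def alphabet_def)
  from run[OF this] have S_run: "accepting_run R1 S (?ext \<beta>) \<longleftrightarrow>
      R1 = (\<lambda>n. Star) \<and> (\<exists>k. \<beta> = (\<lambda>n. n = k))" for R1 \<beta>
    by (simp add: fun_eq_iff)
  \<comment> \<open>The singleton automaton forces the guessed track to encode a number, so the
    extended word is again an encoding and the induction hypothesis applies to it.\<close>
  have ext: "?ext (\<lambda>n. n = k) = word (k # ks) \<sigma>s" for k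
    by (simp add: word_def fun_eq_iff)
  have B_run: "accepting_run R2 B (word (k # ks) \<sigma>s) \<longleftrightarrow> realizer \<phi> R2 (case_nat k ((!) ks)) ((!) \<sigma>s)" for k R2
    using ExI.IH[OF B, of "k # ks" \<sigma>s R2] ExI.prems by (simp add: nth_Cons_case_nat)
  show ?case
  proof
    assume "accepting_run R A (word ks \<sigma>s)"
    then obtain \<beta> R' where R: "R = (\<lambda>n. MPair (Bit (\<beta> n)) (R' n))"
      and "accepting_run R' (sync_product S B) (?ext \<beta>)"
      unfolding A project_ind_run by blast
    then obtain R1 R2 where R': "R' = (\<lambda>n. MPair (R1 n) (R2 n))"
      and "accepting_run R1 S (?ext \<beta>)" and R2: "accepting_run R2 B (?ext \<beta>)"
      unfolding sync_product_run by blast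
    then obtain k where "R1 = (\<lambda>n. Star)" "\<beta> = (\<lambda>n. n = k)" unfolding S_run by blast
    with R R' R2 show "realizer (ExI \<phi>) R ((!) ks) ((!) \<sigma>s)"
      unfolding realizer.simps by (intro exI[of _ k] exI[of _ R2]) (simp add: ext B_run)
  next
    assume "realizer (ExI \<phi>) R ((!) ks) ((!) \<sigma>s)"
    then obtain k R2 where R: "R = (\<lambda>n. MPair (Bit (n = k)) (MPair Star (R2 n)))"
      and "accepting_run R2 B (word (k # ks) \<sigma>s)" unfolding realizer.simps B_run by blast
    then have "accepting_run (\<lambda>n. MPair Star (R2 n)) (sync_product S B) (?ext (\<lambda>n. n = k))"
      unfolding sync_product_run S_run ext
      by (intro exI[of _ "\<lambda>n. Star"] exI[of _ R2]) (auto simp: S_run[of _ "\<lambda>n. n = k", unfolded ext])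
    then show "accepting_run R A (word ks \<sigma>s)"
      unfolding A project_ind_run R
      by (intro exI[of _ "\<lambda>n. n = k"] exI[of _ "\<lambda>n. MPair Star (R2 n)"]) simp
  qed
next
  case (ExP \<phi>)
  then obtain B where B: "interp \<phi> l (Suc p) B" and A: "A = project_pred B" by auto
  have ext: "(\<lambda>n. (fst (word ks \<sigma>s n), S n # snd (word ks \<sigma>s n))) = word ks (S # \<sigma>s)" for S
    by (simp add: word_def fun_eq_iff)
  have B_run: "accepting_run R' B (word ks (S # \<sigma>s)) \<longleftrightarrow> realizer \<phi> R' ((!) ks) (case_nat S ((!) \<sigma>s))" for S R'
    using ExP.IH[OF B, of ks "S # \<sigma>s" R'] ExP.prems by (simp add: nth_Cons_case_nat)
  show ?case unfolding A project_pred_run ext B_run realizer.simps by (rule refl)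
qed (simp only: interp.simps realizer.simps, subst atom_automaton_run, assumption+, simp)+

section \<open>Formulae on initial segments\<close>

primrec fseq :: "form \<Rightarrow> (nat \<Rightarrow> bool list \<times> bool list) \<Rightarrow> nat \<Rightarrow> nat" where
  "fseq \<phi> w 0 = finit \<phi>"
| "fseq \<phi> w (Suc n) = fstep \<phi> (fseq \<phi> w n) (fst (w n)) (snd (w n))"

lemma fseq_cong: "(\<And>i. i < n \<Longrightarrow> w i = w' i) \<Longrightarrow> fseq \<phi> w n = fseq \<phi> w' n"
  by (induction n) auto

lemma set_pairs: "set (pairs xs ys) = {\<langle>x, y\<rangle> | x y. x \<in> set xs \<and> y \<in> set ys}"
  by (auto simp: pairs_def)

lemma pair_in_pairs [simp]: "\<langle>x, y\<rangle> \<in> set (pairs xs ys) \<longleftrightarrow> x \<in> set xs \<and> y \<in> set ys"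
  by (auto simp: set_pairs)

lemma in_pairsD: "s \<in> set (pairs xs ys) \<Longrightarrow> pfst s \<in> set xs \<and> psnd s \<in> set ys"
  by (auto simp: set_pairs)

lemma filter_in_subseqs: "filter P xs \<in> set (subseqs xs)"
  by (induction xs) (auto simp: Let_def)

lemma singleton_in_subseqs: "x \<in> set xs \<Longrightarrow> [x] \<in> set (subseqs xs)"
proof (induction xs)
  case (Cons y ys)
  have "[] \<in> set (subseqs ys)" using filter_in_subseqs[of "\<lambda>_. False" ys] by simp
  then show ?case using Cons by (auto simp: Let_def)
qed simp

lemma finit_in_fstates: "finit \<phi> \<in> set (fstates \<phi>)"
  by (induction \<phi>) (auto intro!: imageI singleton_in_subseqs simp del: list_encode.simps)

lemma fstep_in_fstates: "s \<in> set (fstates \<phi>) \<Longrightarrow> fstep \<phi> s xs Xs \<in> set (fstates \<phi>)"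
  by (induction \<phi> arbitrary: s xs Xs)
    (auto simp: restrict_to_def intro!: imageI filter_in_subseqs dest: in_pairsD)

lemma fseq_in_fstates: "fseq \<phi> w n \<in> set (fstates \<phi>)"
  by (induction n) (auto simp: finit_in_fstates fstep_in_fstates)

text \<open>The subset construction follows all guesses \<open>\<beta>\<close> at once. A state
  after \<open>n\<close> letters depends on \<open>\<beta>\<close> only below \<open>n\<close>, so
  \<open>\<beta>\<close> can be altered at \<open>n\<close> to combine any old state with any new
  bit. By \<open>fseq_in_fstates\<close> the restriction to \<open>fstates \<phi>\<close> removes
  nothing; it fixes the order of the list.\<close>

lemma set_fseq_ExP:
  "set (list_decode (fseq (ExP \<phi>) w n)) =
    range (\<lambda>\<beta>. fseq \<phi> (\<lambda>i. (fst (w i), \<beta> i # snd (w i))) n)"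
proof (induction n)
  case 0
  then show ?case by (auto simp del: list_encode.simps)
next
  case (Suc n)
  let ?w = "\<lambda>\<beta> i. (fst (w i), \<beta> i # snd (w i))"
  have "set (list_decode (fseq (ExP \<phi>) w (Suc n))) = set (fstates \<phi>) \<inter>
    (\<Union>b. (\<lambda>t. fstep \<phi> t (fst (w n)) (b # snd (w n))) ` set (list_decode (fseq (ExP \<phi>) w n)))"
    by (auto simp: restrict_to_def UNIV_bool)
  also have "\<dots> = set (fstates \<phi>) \<inter>
    {fstep \<phi> (fseq \<phi> (?w \<beta>) n) (fst (w n)) (b # snd (w n)) | b \<beta>. True}"
    unfolding Suc by auto
  also have "{fstep \<phi> (fseq \<phi> (?w \<beta>) n) (fst (w n)) (b # snd (w n)) | b \<beta>. True} =
    range (\<lambda>\<beta>. fseq \<phi> (?w \<beta>) (Suc n))"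
  proof (intro equalityI subsetI)
    fix s
    assume "s \<in> {fstep \<phi> (fseq \<phi> (?w \<beta>) n) (fst (w n)) (b # snd (w n)) | b \<beta>. True}"
    then obtain b \<beta> where s: "s = fstep \<phi> (fseq \<phi> (?w \<beta>) n) (fst (w n)) (b # snd (w n))" by blast
    have "fseq \<phi> (?w (\<beta>(n := b))) n = fseq \<phi> (?w \<beta>) n" by (rule fseq_cong) simp
    then have "s = fseq \<phi> (?w (\<beta>(n := b))) (Suc n)" using s by simp
    then show "s \<in> range (\<lambda>\<beta>. fseq \<phi> (?w \<beta>) (Suc n))"
      by - (rule range_eqI[where x = "\<beta>(n := b)"])
  qed auto
  also have "set (fstates \<phi>) \<inter> range (\<lambda>\<beta>. fseq \<phi> (?w \<beta>) (Suc n)) =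
    range (\<lambda>\<beta>. fseq \<phi> (?w \<beta>) (Suc n))"
    using fseq_in_fstates by blast
  finally show ?case .
qed

primrec count :: "(nat \<Rightarrow> bool) \<Rightarrow> nat \<Rightarrow> nat" where
  "count \<beta> 0 = 0"
| "count \<beta> (Suc n) = (if \<beta> n then bump (count \<beta> n) else count \<beta> n)"

lemma count_cong: "(\<And>i. i < n \<Longrightarrow> \<beta> i = \<beta>' i) \<Longrightarrow> count \<beta> n = count \<beta>' n"
  by (induction n) auto

lemma count_in: "count \<beta> n \<in> {0, 1, 2}"
  by (induction n) (auto simp: bump_def)

lemma count_0_iff: "count \<beta> n = 0 \<longleftrightarrow> (\<forall>i<n. \<not> \<beta> i)"
  by (induction n) (auto simp: bump_def less_Suc_eq)

lemma count_1_iff: "count \<beta> n = 1 \<longleftrightarrow> (\<exists>k<n. \<forall>i<n. \<beta> i \<longleftrightarrow> i = k)"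
proof (induction n)
  case (Suc n)
  show ?case
  proof (cases "\<beta> n")
    case True
    then have "count \<beta> (Suc n) = 1 \<longleftrightarrow> count \<beta> n = 0" by (simp add: bump_def)
    also have "\<dots> \<longleftrightarrow> (\<exists>k<Suc n. \<forall>i<Suc n. \<beta> i \<longleftrightarrow> i = k)"
      unfolding count_0_iff using True by (auto simp: less_Suc_eq)
    finally show ?thesis .
  next
    case False
    then show ?thesis using Suc by (auto simp: less_Suc_eq)
  qed
qed simp

text \<open>The argument for \<open>ExP\<close>, with the saturating count of guessed ones carried
  along; altering \<open>\<beta>\<close> at \<open>n\<close> does not affect the count before
  \<open>n\<close> either.\<close>

lemma set_fseq_ExI:
  "set (list_decode (fseq (ExI \<phi>) w n)) =
    range (\<lambda>\<beta>. \<langle>count \<beta> n, fseq \<phi> (\<lambda>i. (\<beta> i # fst (w i), snd (w i))) n\<rangle>)"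
proof (induction n)
  case 0
  then show ?case by (auto simp del: list_encode.simps)
next
  case (Suc n)
  let ?w = "\<lambda>\<beta> i. (\<beta> i # fst (w i), snd (w i))"
  let ?c = "\<lambda>b c. if b then bump c else c"
  have "set (list_decode (fseq (ExI \<phi>) w (Suc n))) = set (pairs [0, 1, 2] (fstates \<phi>)) \<inter>
    (\<Union>b. (\<lambda>t. \<langle>?c b (pfst t), fstep \<phi> (psnd t) (b # fst (w n)) (snd (w n))\<rangle>) `
      set (list_decode (fseq (ExI \<phi>) w n)))"
    by (auto simp: restrict_to_def UNIV_bool)
  also have "\<dots> = set (pairs [0, 1, 2] (fstates \<phi>)) \<inter>
    {\<langle>?c b (count \<beta> n), fstep \<phi> (fseq \<phi> (?w \<beta>) n) (b # fst (w n)) (snd (w n))\<rangle> | b \<beta>. True}"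
    unfolding Suc image_image pfst_pair psnd_pair by blast
  also have "{\<langle>?c b (count \<beta> n), fstep \<phi> (fseq \<phi> (?w \<beta>) n) (b # fst (w n)) (snd (w n))\<rangle> | b \<beta>. True} =
    range (\<lambda>\<beta>. \<langle>count \<beta> (Suc n), fseq \<phi> (?w \<beta>) (Suc n)\<rangle>)"
  proof (intro equalityI subsetI)
    fix s
    assume "s \<in> {\<langle>?c b (count \<beta> n),
      fstep \<phi> (fseq \<phi> (?w \<beta>) n) (b # fst (w n)) (snd (w n))\<rangle> | b \<beta>. True}"
    then obtain b \<beta> where s: "s = \<langle>?c b (count \<beta> n),
      fstep \<phi> (fseq \<phi> (?w \<beta>) n) (b # fst (w n)) (snd (w n))\<rangle>" by blast
    have "fseq \<phi> (?w (\<beta>(n := b))) n = fseq \<phi> (?w \<beta>) n" by (rule fseq_cong) simp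
    moreover have "count (\<beta>(n := b)) n = count \<beta> n" by (rule count_cong) simp
    ultimately have "s = \<langle>count (\<beta>(n := b)) (Suc n), fseq \<phi> (?w (\<beta>(n := b))) (Suc n)\<rangle>"
      using s by (cases b) simp_all
    then show "s \<in> range (\<lambda>\<beta>. \<langle>count \<beta> (Suc n), fseq \<phi> (?w \<beta>) (Suc n)\<rangle>)"
      by - (rule range_eqI[where x = "\<beta>(n := b)"])
  next
    fix s
    assume "s \<in> range (\<lambda>\<beta>. \<langle>count \<beta> (Suc n), fseq \<phi> (?w \<beta>) (Suc n)\<rangle>)"
    then obtain \<beta> where "s = \<langle>count \<beta> (Suc n), fseq \<phi> (?w \<beta>) (Suc n)\<rangle>" by blast
    then have "s = \<langle>?c (\<beta> n) (count \<beta> n),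
      fstep \<phi> (fseq \<phi> (?w \<beta>) n) (\<beta> n # fst (w n)) (snd (w n))\<rangle>" by simp
    then show "s \<in> {\<langle>?c b (count \<beta> n),
      fstep \<phi> (fseq \<phi> (?w \<beta>) n) (b # fst (w n)) (snd (w n))\<rangle> | b \<beta>. True}" by blast
  qed
  also have "set (pairs [0, 1, 2] (fstates \<phi>)) \<inter>
    range (\<lambda>\<beta>. \<langle>count \<beta> (Suc n), fseq \<phi> (?w \<beta>) (Suc n)\<rangle>) =
    range (\<lambda>\<beta>. \<langle>count \<beta> (Suc n), fseq \<phi> (?w \<beta>) (Suc n)\<rangle>)"
  proof -
    have "\<langle>count \<beta> (Suc n), fseq \<phi> (?w \<beta>) (Suc n)\<rangle> \<in> set (pairs [0, 1, 2] (fstates \<phi>))" for \<beta>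
      using count_in[of \<beta> "Suc n"] fseq_in_fstates[of \<phi> "?w \<beta>" "Suc n"]
      by (simp del: count.simps fseq.simps)
    then show ?thesis by blast
  qed
  finally show ?case .
qed

lemma fseq_And: "fseq (And \<phi> \<psi>) w n = \<langle>fseq \<phi> w n, fseq \<psi> w n\<rangle>"
  by (induction n) auto

lemma fseq_Neg: "fseq (Neg \<phi>) w n = fseq \<phi> w n"
  by (induction n) auto

lemma fseq_Eq: "psnd (fseq (Eq x y) w n) =
    of_bool (\<forall>i<n. bit_at False (fst (w i)) x = bit_at False (fst (w i)) y)"
  by (induction n) (auto simp: less_Suc_eq)

lemma fseq_Le: "fseq (Le x y) w n = atom_state (\<exists>i<n. bit_at False (fst (w i)) x)
    (\<forall>j<n. bit_at False (fst (w j)) y \<longrightarrow> (\<exists>i\<le>j. bit_at False (fst (w i)) x))"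
  by (induction n) (auto simp: less_Suc_eq le_less)

lemma fseq_Sc: "fseq (Sc x y) w n = atom_state (0 < n \<and> bit_at False (fst (w (n - 1))) x)
    (\<forall>j<n. bit_at False (fst (w j)) y \<longleftrightarrow> 0 < j \<and> bit_at False (fst (w (j - 1))) x)"
  by (induction n) (auto simp: less_Suc_eq)

lemma fseq_Zero: "fseq (Zero x) w n = atom_state (0 < n) (\<forall>j<n. bit_at False (fst (w j)) x \<longrightarrow> j = 0)"
  by (induction n) (auto simp: less_Suc_eq)

lemma fseq_Mem: "psnd (fseq (Mem x X) w n) =
    of_bool (\<forall>i<n. bit_at False (fst (w i)) x \<longrightarrow> bit_at False (snd (w i)) X)"
  by (induction n) (auto simp: less_Suc_eq)

section \<open>Truth in an initial segment\<close>

text \<open>Truth in the initial segment \<open>{0..N}\<close>; set quantifiers need no bound, since only the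
  intersection with \<open>{0..N}\<close> matters.\<close>

primrec fsat :: "form \<Rightarrow> nat \<Rightarrow> (nat \<Rightarrow> nat) \<Rightarrow> (nat \<Rightarrow> nat \<Rightarrow> bool) \<Rightarrow> bool" where
  "fsat (Eq x y) N \<kappa> \<sigma> \<longleftrightarrow> \<kappa> x = \<kappa> y"
| "fsat (Le x y) N \<kappa> \<sigma> \<longleftrightarrow> \<kappa> x \<le> \<kappa> y"
| "fsat (Sc x y) N \<kappa> \<sigma> \<longleftrightarrow> \<kappa> y = Suc (\<kappa> x)"
| "fsat (Zero x) N \<kappa> \<sigma> \<longleftrightarrow> \<kappa> x = 0"
| "fsat (Mem x X) N \<kappa> \<sigma> \<longleftrightarrow> \<sigma> X (\<kappa> x)"
| "fsat Top N \<kappa> \<sigma> \<longleftrightarrow> True"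
| "fsat Bot N \<kappa> \<sigma> \<longleftrightarrow> False"
| "fsat (And \<phi> \<psi>) N \<kappa> \<sigma> \<longleftrightarrow> fsat \<phi> N \<kappa> \<sigma> \<and> fsat \<psi> N \<kappa> \<sigma>"
| "fsat (Neg \<phi>) N \<kappa> \<sigma> \<longleftrightarrow> \<not> fsat \<phi> N \<kappa> \<sigma>"
| "fsat (ExI \<phi>) N \<kappa> \<sigma> \<longleftrightarrow> (\<exists>k\<le>N. fsat \<phi> N (case_nat k \<kappa>) \<sigma>)"
| "fsat (ExP \<phi>) N \<kappa> \<sigma> \<longleftrightarrow> (\<exists>S. fsat \<phi> N \<kappa> (case_nat S \<sigma>))"

text \<open>The index \<open>j\<close> of the bounding variable is general because every individual
  quantifier shifts it by one; comprehension uses \<open>j = 0\<close>.\<close>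

lemma sat_relativize: "sat (relativize (Le 0 (Suc j)) \<chi>) \<kappa> \<sigma> \<longleftrightarrow> fsat \<chi> (\<kappa> j) \<kappa> \<sigma>"
  by (induction \<chi> arbitrary: j \<kappa> \<sigma>) (auto simp: up_def)

text \<open>The side condition of comprehension speaks of the relativized formula, while the
  automaton reads the original one.\<close>

lemma fvi_relativize: "fvi \<chi> \<subseteq> fvi (relativize \<theta> \<chi>)"
  by (induction \<chi> arbitrary: \<theta>) (auto, (blast+)?)

text \<open>\<open>Suc N\<close> letters cover the positions from 0 to \<open>N\<close>. As the free
  individual variables have values in this range, their ones lie among the letters read and the
  prefix decides every atom.\<close>

lemma facc_fseq:
  assumes "\<And>i. i \<in> fvi \<phi> \<Longrightarrow> \<kappa> i \<le> N"
    and "\<And>i n. i \<in> fvi \<phi> \<Longrightarrow> n \<le> N \<Longrightarrow> bit_at False (fst (w n)) i \<longleftrightarrow> n = \<kappa> i"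
    and "\<And>X n. X \<in> fvp \<phi> \<Longrightarrow> n \<le> N \<Longrightarrow> bit_at False (snd (w n)) X \<longleftrightarrow> \<sigma> X n"
  shows "facc \<phi> (fseq \<phi> w (Suc N)) \<longleftrightarrow> fsat \<phi> N \<kappa> \<sigma>"
  using assms
proof (induction \<phi> arbitrary: \<kappa> \<sigma> w)
  case (Eq x y)
  have "(\<forall>i<Suc N. (i = \<kappa> x) = (i = \<kappa> y)) \<longleftrightarrow> \<kappa> x = \<kappa> y"
    using Eq(1)[of x] Eq(1)[of y] by (auto simp: less_Suc_eq_le)
  then show ?case using Eq(2)[of x] Eq(2)[of y] unfolding facc.simps fseq_Eq
    by (auto simp: less_Suc_eq_le)
next
  case (Le x y)
  have "(\<forall>j<Suc N. j = \<kappa> y \<longrightarrow> (\<exists>i\<le>j. i = \<kappa> x)) \<longleftrightarrow> \<kappa> x \<le> \<kappa> y"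
    using Le(1)[of y] by (auto simp: less_Suc_eq_le)
  moreover have "(\<forall>j<Suc N. bit_at False (fst (w j)) y \<longrightarrow> (\<exists>i\<le>j. bit_at False (fst (w i)) x)) \<longleftrightarrow>
    (\<forall>j<Suc N. j = \<kappa> y \<longrightarrow> (\<exists>i\<le>j. i = \<kappa> x))"
    using Le(2)[of x] Le(2)[of y] by (auto simp: less_Suc_eq_le)
  ultimately show ?case unfolding facc.simps fseq_Le by simp
next
  case (Sc x y)
  \<comment> \<open>The instance \<open>j = \<kappa> y\<close>, available since
    \<open>\<kappa> y \<le> N\<close>, carries the direction from left to right.\<close>
  have "(\<forall>j<Suc N. j = \<kappa> y \<longleftrightarrow> 0 < j \<and> j - 1 = \<kappa> x) \<longleftrightarrow> \<kappa> y = Suc (\<kappa> x)"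
    using Sc(1)[of y] by (auto simp: less_Suc_eq_le)
  moreover have "(\<forall>j<Suc N. bit_at False (fst (w j)) y \<longleftrightarrow> 0 < j \<and> bit_at False (fst (w (j - 1))) x) \<longleftrightarrow>
    (\<forall>j<Suc N. j = \<kappa> y \<longleftrightarrow> 0 < j \<and> j - 1 = \<kappa> x)"
    using Sc(2)[of x] Sc(2)[of y] by (auto simp: less_Suc_eq_le)
  ultimately show ?case unfolding facc.simps fseq_Sc by simp
next
  case (Zero x)
  then show ?case unfolding facc.simps fseq_Zero by (auto simp: less_Suc_eq_le)
next
  case (Mem x X)
  then show ?case unfolding facc.simps fseq_Mem by (auto simp: less_Suc_eq_le)
next
  case (And \<phi> \<psi>)
  have "facc \<phi> (fseq \<phi> w (Suc N)) \<longleftrightarrow> fsat \<phi> N \<kappa> \<sigma>"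
    by (rule And.IH(1)) (simp_all add: And.prems)
  moreover have "facc \<psi> (fseq \<psi> w (Suc N)) \<longleftrightarrow> fsat \<psi> N \<kappa> \<sigma>"
    by (rule And.IH(2)) (simp_all add: And.prems)
  ultimately show ?case by (simp add: fseq_And del: fseq.simps)
next
  case (Neg \<phi>)
  have "facc \<phi> (fseq \<phi> w (Suc N)) \<longleftrightarrow> fsat \<phi> N \<kappa> \<sigma>"
    by (rule Neg.IH) (simp_all add: Neg.prems)
  then show ?case by (simp add: fseq_Neg del: fseq.simps)
next
  case (ExI \<phi>)
  let ?w = "\<lambda>\<beta> i. (\<beta> i # fst (w i), snd (w i))"
  have IH: "facc \<phi> (fseq \<phi> (?w \<beta>) (Suc N)) \<longleftrightarrow> fsat \<phi> N (case_nat k \<kappa>) \<sigma>"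
    if k: "k \<le> N" "\<forall>i<Suc N. \<beta> i \<longleftrightarrow> i = k" for \<beta> k
  proof (rule ExI.IH)
    show "(case i of 0 \<Rightarrow> k | Suc i \<Rightarrow> \<kappa> i) \<le> N" if "i \<in> fvi \<phi>" for i
      using that k ExI.prems(1) by (cases i) auto
    show "bit_at False (fst (?w \<beta> n)) i \<longleftrightarrow> n = (case i of 0 \<Rightarrow> k | Suc i \<Rightarrow> \<kappa> i)"
      if "i \<in> fvi \<phi>" "n \<le> N" for i n
      using that k ExI.prems(2) by (cases i) auto
    show "bit_at False (snd (?w \<beta> n)) X \<longleftrightarrow> \<sigma> X n" if "X \<in> fvp \<phi>" "n \<le> N" for X n
      using that ExI.prems(3) by simp
  qed
  have "facc (ExI \<phi>) (fseq (ExI \<phi>) w (Suc N)) \<longleftrightarrow>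
    (\<exists>t \<in> set (list_decode (fseq (ExI \<phi>) w (Suc N))). pfst t = 1 \<and> facc \<phi> (psnd t))"
    unfolding facc.simps set_map image_iff by metis
  also have "\<dots> \<longleftrightarrow> (\<exists>\<beta>. count \<beta> (Suc N) = 1 \<and> facc \<phi> (fseq \<phi> (?w \<beta>) (Suc N)))"
    unfolding set_fseq_ExI by (simp del: fseq.simps count.simps)
  \<comment> \<open>A final count of 1 says that the guess marks exactly one position of the prefix
    and thus encodes some \<open>k \<le> N\<close>; the rest of the guess is free.\<close>
  also have "\<dots> \<longleftrightarrow> (\<exists>\<beta> k. k \<le> N \<and> (\<forall>i<Suc N. \<beta> i \<longleftrightarrow> i = k) \<and> facc \<phi> (fseq \<phi> (?w \<beta>) (Suc N)))"
    unfolding count_1_iff less_Suc_eq_le by blast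
  also have "\<dots> \<longleftrightarrow> (\<exists>\<beta> k. k \<le> N \<and> (\<forall>i<Suc N. \<beta> i \<longleftrightarrow> i = k) \<and> fsat \<phi> N (case_nat k \<kappa>) \<sigma>)"
    using IH by blast
  also have "\<dots> \<longleftrightarrow> fsat (ExI \<phi>) N \<kappa> \<sigma>"
  proof -
    have "\<exists>\<beta>. \<forall>i<Suc N. \<beta> i \<longleftrightarrow> i = k" for k by (rule exI[of _ "\<lambda>i. i = k"]) simp
    then show ?thesis unfolding fsat.simps by blast
  qed
  finally show ?case .
next
  case (ExP \<phi>)
  let ?w = "\<lambda>\<beta> i. (fst (w i), \<beta> i # snd (w i))"
  have IH: "facc \<phi> (fseq \<phi> (?w \<beta>) (Suc N)) \<longleftrightarrow> fsat \<phi> N \<kappa> (case_nat \<beta> \<sigma>)" for \<beta>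
  proof (rule ExP.IH)
    show "\<kappa> i \<le> N" if "i \<in> fvi \<phi>" for i using that ExP.prems(1) by simp
    show "bit_at False (fst (?w \<beta> n)) i \<longleftrightarrow> n = \<kappa> i" if "i \<in> fvi \<phi>" "n \<le> N" for i n
      using that ExP.prems(2) by simp
    show "bit_at False (snd (?w \<beta> n)) X \<longleftrightarrow> (case X of 0 \<Rightarrow> \<beta> | Suc i \<Rightarrow> \<sigma> i) n"
      if "X \<in> fvp \<phi>" "n \<le> N" for X n
      using that ExP.prems(3) by (cases X) auto
  qed
  have "facc (ExP \<phi>) (fseq (ExP \<phi>) w (Suc N)) \<longleftrightarrow>
    (\<exists>t \<in> set (list_decode (fseq (ExP \<phi>) w (Suc N))). facc \<phi> t)"
    unfolding facc.simps set_map image_iff by metis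
  also have "\<dots> \<longleftrightarrow> (\<exists>\<beta>. facc \<phi> (fseq \<phi> (?w \<beta>) (Suc N)))"
    unfolding set_fseq_ExP by (simp del: fseq.simps)
  also have "\<dots> \<longleftrightarrow> fsat (ExP \<phi>) N \<kappa> \<sigma>"
    unfolding IH by simp
  finally show ?case .
qed (auto)

section \<open>Soundness\<close>

lemma bit_at_update_at: "bit_at d (update_at d xs z b) i = (if i = z then b else bit_at d xs i)"
proof (induction d xs z b arbitrary: i rule: update_at.induct)
  case (1 d xs b)
  then show ?case by (cases i; cases xs) auto
next
  case (2 d xs z b)
  then show ?case by (cases i; cases xs) auto
qed

section \<open>Streams of states and outputs\<close>

primrec dseq :: "deriv \<Rightarrow> (nat \<Rightarrow> env) \<Rightarrow> nat \<Rightarrow> nat" where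
  "dseq D a 0 = dinit D"
| "dseq D a (Suc n) = fst (dstep D (dseq D a n) (a n))"

definition dout :: "deriv \<Rightarrow> (nat \<Rightarrow> env) \<Rightarrow> nat \<Rightarrow> move" where
  "dout D a n = snd (dstep D (dseq D a n) (a n))"

definition local_word :: "form \<Rightarrow> (nat \<Rightarrow> env) \<Rightarrow> nat \<Rightarrow> bool list \<times> bool list" where
  "local_word \<phi> a n = ([False, bit_at (fst (a n)) (fst (snd (a n))) (sc_var \<phi>)], fst (snd (snd (a n))))"

text \<open>The word has its only 1 on track 0 at position \<open>n\<close>, so it is the prefix up
  to \<open>n\<close> of an encoding in which variable 0 has the value \<open>n\<close>. Before time
  \<open>n\<close> the local automaton read the letters of \<open>local_word\<close>, with 0 on that
  track.\<close>

definition witness :: "rule \<Rightarrow> form \<Rightarrow> (nat \<Rightarrow> env) \<Rightarrow> nat \<Rightarrow> bool" where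
  "witness r \<phi> a n = facc (local_form r) (fseq (local_form r)
     ((local_word \<phi> a)(n := ([True, bit_at (fst (a n)) (fst (snd (a n))) (sc_var \<phi>)],
       fst (snd (snd (a n)))))) (Suc n))"

lemma dseq_eq: "dseq D a n =
  \<langle>fseq (local_form (drule D)) (local_word (dconcl D) a) n,
   \<langle>if dprems D = [] then 0 else dseq (hd (dprems D)) a n,
    if dprems D = [] then 0 else if tl (dprems D) = [] then 0 else
      dseq (hd (tl (dprems D))) (\<lambda>n. second_env (drule D) (a n) (dout (hd (dprems D)) a n)) n\<rangle>\<rangle>"
proof (induction n)
  case 0
  then show ?case by (subst dseq.simps, subst dinit.simps) simp
next
  case (Suc n)
  show ?case unfolding dseq.simps Suc
    by (subst dstep.simps) (simp add: combine_def local_step_def local_word_def dout_def)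
qed

lemma dout_eq: "dout D a n = coerce (dconcl D) (raw_output (drule D) (dhyps D) (dconcl D) (a n)
   (witness (drule D) (dconcl D) a n)
   (if dprems D = [] then Star else dout (hd (dprems D)) a n)
   (if dprems D = [] then Star else if tl (dprems D) = [] then Star else
      dout (hd (tl (dprems D))) (\<lambda>n. second_env (drule D) (a n) (dout (hd (dprems D)) a n)) n))"
proof -
  have "fseq (local_form (drule D)) ((local_word (dconcl D) a)(n := y)) n =
    fseq (local_form (drule D)) (local_word (dconcl D) a) n" for y
    by (rule fseq_cong) simp
  then show ?thesis unfolding dout_def[of D a] dseq_eq[of D]
    by (subst dstep.simps) (simp add: combine_def local_step_def witness_def dout_def)
qed

definition represents ::
  "(nat \<Rightarrow> nat) \<Rightarrow> (nat \<Rightarrow> nat \<Rightarrow> bool) \<Rightarrow> (nat \<Rightarrow> move) list \<Rightarrow> nat \<Rightarrow> env \<Rightarrow> bool" where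
  "represents \<kappa> \<sigma> Rs n a \<longleftrightarrow> (\<forall>i. bit_at (fst a) (fst (snd a)) i \<longleftrightarrow> n = \<kappa> i) \<and>
     (\<forall>X. bit_at False (fst (snd (snd a))) X \<longleftrightarrow> \<sigma> X n) \<and> snd (snd (snd a)) = map (\<lambda>R. R n) Rs"

text \<open>No context occurs here: environments assign a bit to every variable, so premises with
  additional variables need no change of context.\<close>

definition sound :: "deriv \<Rightarrow> bool" where
  "sound D \<longleftrightarrow> (\<forall>\<kappa> \<sigma> Rs a. realizer_list \<kappa> \<sigma> (dhyps D) Rs \<longrightarrow>
     (\<forall>n. represents \<kappa> \<sigma> Rs n (a n)) \<longrightarrow> realizer (dconcl D) (dout D a) \<kappa> \<sigma>)"

lemma soundD: "sound D \<Longrightarrow> realizer_list \<kappa> \<sigma> (dhyps D) Rs \<Longrightarrow>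
    (\<And>n. represents \<kappa> \<sigma> Rs n (a n)) \<Longrightarrow> realizer (dconcl D) (dout D a) \<kappa> \<sigma>"
  by (simp add: sound_def)

text \<open>Environments are finite, so that only assignments with finitely many exceptions to the
  default values have one.\<close>

definition denotable :: "(nat \<Rightarrow> nat) \<Rightarrow> (nat \<Rightarrow> nat \<Rightarrow> bool) \<Rightarrow> bool" where
  "denotable \<kappa> \<sigma> \<longleftrightarrow> (\<exists>a. \<forall>n. represents \<kappa> \<sigma> [] n (a n))"

lemma represents_hyps: "represents \<kappa> \<sigma> Rs n (d, xs, Xs, ms) \<Longrightarrow>
    represents \<kappa> \<sigma> Rs' n (d, xs, Xs, map (\<lambda>R. R n) Rs')"
  by (simp add: represents_def)

lemma represents_upd_ind: "represents \<kappa> \<sigma> Rs n (d, xs, Xs, ms) \<Longrightarrow>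
    represents (\<kappa>(z := k)) \<sigma> Rs n (d, update_at d xs z (n = k), Xs, ms)"
  by (auto simp: represents_def bit_at_update_at)

lemma represents_upd_pred: "represents \<kappa> \<sigma> Rs n (d, xs, Xs, ms) \<Longrightarrow>
    represents \<kappa> (\<sigma>(Z := S)) Rs n (d, xs, update_at False Xs Z (S n), ms)"
  by (auto simp: represents_def bit_at_update_at)

lemma denotableI:
  assumes "\<And>n. represents \<kappa> \<sigma> Rs n (a n)"
  shows "denotable \<kappa> \<sigma>"
  unfolding denotable_def
proof (intro exI[of _ "\<lambda>n. (fst (a n), fst (snd (a n)), fst (snd (snd (a n))), [])"] allI)
  show "represents \<kappa> \<sigma> [] n (fst (a n), fst (snd (a n)), fst (snd (snd (a n))), [])" for n
    using assms[of n] by (simp add: represents_def)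
qed

lemma denotable_upd: "denotable \<kappa> \<sigma> \<Longrightarrow> denotable (\<kappa>(z := k)) \<sigma>"
proof -
  assume "denotable \<kappa> \<sigma>"
  then obtain a where a: "\<And>n. represents \<kappa> \<sigma> [] n (a n)" unfolding denotable_def by blast
  show "denotable (\<kappa>(z := k)) \<sigma>"
  proof (rule denotableI)
    show "represents (\<kappa>(z := k)) \<sigma> [] n
      (fst (a n), update_at (fst (a n)) (fst (snd (a n))) z (n = k), snd (snd (a n)))" for n
      using a[of n] by (cases "a n") (auto intro: represents_upd_ind)
  qed
qed

text \<open>Soundness becomes preservation of truth: arbitrary realizers of the true hypotheses are
  fed to the machine, and its output is a realizer of the conclusion, which must then be true. An
  environment is required for running the machine, whence the condition
  \<open>denotable\<close>.\<close>

lemma sound_sat: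
  assumes "sound D" "denotable \<kappa> \<sigma>" "\<And>\<psi>. \<psi> \<in> set (dhyps D) \<Longrightarrow> sat \<psi> \<kappa> \<sigma>"
  shows "sat (dconcl D) \<kappa> \<sigma>"
proof -
  obtain a where a: "\<And>n. represents \<kappa> \<sigma> [] n (a n)" using assms(2) unfolding denotable_def by blast
  define Rs where "Rs = map (\<lambda>\<psi>. SOME R. realizer \<psi> R \<kappa> \<sigma>) (dhyps D)"
  have hyps: "realizer_list \<kappa> \<sigma> (dhyps D) Rs"
    unfolding Rs_def list_all2_conv_all_nth using someI_ex[OF sat_realizer[OF assms(3)]] by simp
  have rep: "represents \<kappa> \<sigma> Rs n
    (fst (a n), fst (snd (a n)), fst (snd (snd (a n))), map (\<lambda>R. R n) Rs)" for n
    using a[of n] by (cases "a n") (auto intro: represents_hyps)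
  show ?thesis using soundD[OF assms(1) hyps rep] by (rule realizer_sat)
qed

lemma sound_deterministic:
  assumes "deterministic (dconcl D)"
    and "\<And>\<kappa> \<sigma>. denotable \<kappa> \<sigma> \<Longrightarrow> (\<And>\<psi>. \<psi> \<in> set (dhyps D) \<Longrightarrow> sat \<psi> \<kappa> \<sigma>) \<Longrightarrow> sat (dconcl D) \<kappa> \<sigma>"
  shows "sound D"
  unfolding sound_def
proof (intro allI impI)
  fix \<kappa> \<sigma> Rs a
  assume hyps: "realizer_list \<kappa> \<sigma> (dhyps D) Rs"
    and a: "\<forall>n. represents \<kappa> \<sigma> Rs n (a n)"
  have "sat \<psi> \<kappa> \<sigma>" if "\<psi> \<in> set (dhyps D)" for \<psi>
    using hyps that by (induction) (auto dest: realizer_sat)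
  with assms(2) a have "sat (dconcl D) \<kappa> \<sigma>" by (blast intro: denotableI)
  then show "realizer (dconcl D) (dout D a) \<kappa> \<sigma>"
    unfolding dout_eq[of D, abs_def] by (rule deterministic_realizer[OF assms(1)])
qed

lemma realizer_coerceI: "realizer \<phi> R \<kappa> \<sigma> \<Longrightarrow> realizer \<phi> (\<lambda>n. coerce \<phi> (R n)) \<kappa> \<sigma>"
  by (simp add: realizer_coerce)

lemma realizer_assoc_move:
  assumes "realizer_list \<kappa> \<sigma> \<Gamma> Rs" "\<phi> \<in> set \<Gamma>"
  shows "realizer \<phi> (\<lambda>n. assoc_move \<phi> \<Gamma> (map (\<lambda>R. R n) Rs)) \<kappa> \<sigma>"
  using assms
proof induction
  case (Cons \<psi> \<Gamma> R Rs)
  then show ?case by (cases "\<psi> = \<phi>") auto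
qed simp

lemma realizer_insti: "realizer (insti t \<phi>) R \<kappa> \<sigma> \<longleftrightarrow> realizer \<phi> R (case_nat (\<kappa> t) \<kappa>) \<sigma>"
  by (simp add: insti_def realizer_ren case_nat_inst)

lemma realizer_instp: "realizer (instp Y \<phi>) R \<kappa> \<sigma> \<longleftrightarrow> realizer \<phi> R \<kappa> (case_nat (\<sigma> Y) \<sigma>)"
  by (simp add: instp_def realizer_ren case_nat_inst)

lemma realizer_fresh_i: "z \<notin> fvi \<phi> \<Longrightarrow> realizer \<phi> R (\<kappa>(z := k)) \<sigma> \<longleftrightarrow> realizer \<phi> R \<kappa> \<sigma>"
  by (rule realizer_cong) auto

lemma realizer_fresh_p: "Z \<notin> fvp \<phi> \<Longrightarrow> realizer \<phi> R \<kappa> (\<sigma>(Z := S)) \<longleftrightarrow> realizer \<phi> R \<kappa> \<sigma>"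
  by (rule realizer_cong) auto

lemma realizer_body_fresh_i: "z \<notin> fvi (ExI \<phi>) \<Longrightarrow>
    realizer \<phi> R (case_nat k (\<kappa>(z := j))) \<sigma> \<longleftrightarrow> realizer \<phi> R (case_nat k \<kappa>) \<sigma>"
  by (rule realizer_cong) (auto split: nat.splits)

lemma realizer_body_fresh_p: "Z \<notin> fvp (ExP \<phi>) \<Longrightarrow>
    realizer \<phi> R \<kappa> (case_nat S (\<sigma>(Z := T))) \<longleftrightarrow> realizer \<phi> R \<kappa> (case_nat S \<sigma>)"
  by (rule realizer_cong) (auto split: nat.splits)

lemma sat_substi: "sat (substi x t \<phi>) \<kappa> \<sigma> \<longleftrightarrow> sat \<phi> (\<kappa>(x := \<kappa> t)) \<sigma>"
proof -
  have "(\<lambda>i. \<kappa> ((id(x := t)) i)) = \<kappa>(x := \<kappa> t)" by auto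
  then show ?thesis by (simp add: substi_def sat_ren)
qed

lemma realizer_substi: "realizer (substi x t \<phi>) R \<kappa> \<sigma> \<longleftrightarrow> realizer \<phi> R (\<kappa>(x := \<kappa> t)) \<sigma>"
proof -
  have "(\<lambda>i. \<kappa> ((id(x := t)) i)) = \<kappa>(x := \<kappa> t)" by auto
  then show ?thesis by (simp add: substi_def realizer_ren)
qed

lemma realizer_hyps_cong:
  assumes "realizer_list \<kappa> \<sigma> \<Gamma> Rs"
    and "\<And>\<psi> R. \<psi> \<in> set \<Gamma> \<Longrightarrow> realizer \<psi> R \<kappa> \<sigma> \<Longrightarrow> realizer \<psi> R \<kappa>' \<sigma>'"
  shows "realizer_list \<kappa>' \<sigma>' \<Gamma> Rs"
  using assms by (metis (no_types, lifting) list_all2_conv_all_nth nth_mem)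

section \<open>The witnesses found by the local automata\<close>

lemma witness_Zero:
  assumes "local_form r = Zero 0"
  shows "witness r \<phi> a n \<longleftrightarrow> n = 0"
  unfolding witness_def assms fseq_Zero facc.simps
  by (auto simp: local_word_def less_Suc_eq)

lemma witness_Sc:
  assumes "local_form r = Sc 1 0" "\<And>n. represents \<kappa> \<sigma> Rs n (a n)"
  shows "witness r \<phi> a n \<longleftrightarrow> n = Suc (\<kappa> (sc_var \<phi>))"
proof -
  let ?w = "(local_word \<phi> a)(n := ([True, bit_at (fst (a n)) (fst (snd (a n))) (sc_var \<phi>)],
    fst (snd (snd (a n)))))"
  have y: "bit_at False (fst (?w j)) 0 \<longleftrightarrow> j = n" for j by (simp add: local_word_def)
  have x: "bit_at False (fst (?w j)) 1 \<longleftrightarrow> j = \<kappa> (sc_var \<phi>)" for j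
    using assms(2) by (auto simp: local_word_def represents_def)
  have "(\<forall>j<Suc n. j = n \<longleftrightarrow> 0 < j \<and> j - 1 = k) \<longleftrightarrow> n = Suc k" for k by auto
  then show ?thesis unfolding witness_def assms(1) fseq_Sc facc.simps psnd_pair x y by simp
qed

text \<open>Relativization makes truth at \<open>n\<close> a matter of the segment from 0 to
  \<open>n\<close>, which the automaton has read by time \<open>n\<close>. The only free individual
  variable is the candidate itself, with value \<open>n\<close>, as \<open>facc_fseq\<close>
  demands.\<close>

lemma witness_SyncCompr:
  assumes "fvi (relativize (Le 0 1) \<chi>) \<subseteq> {0}" "\<And>n. represents \<kappa> \<sigma> Rs n (a n)"
  shows "witness (SyncCompr \<chi>) \<phi> a n \<longleftrightarrow> sat (relativize (Le 0 1) \<chi>) (case_nat n \<kappa>) \<sigma>"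
proof -
  have "fvi \<chi> \<subseteq> {0}" using fvi_relativize assms(1) by blast
  then have "witness (SyncCompr \<chi>) \<phi> a n \<longleftrightarrow> fsat \<chi> n (case_nat n \<kappa>) \<sigma>"
    unfolding witness_def local_form.simps using assms(2)
    by (intro facc_fseq) (auto simp: local_word_def represents_def)
  also have "\<dots> \<longleftrightarrow> sat (relativize (Le 0 1) \<chi>) (case_nat n \<kappa>) \<sigma>"
    using sat_relativize[of 0 \<chi> "case_nat n \<kappa>" \<sigma>] by simp
  finally show ?thesis .
qed

text \<open>Induction on the value of \<open>x\<close>, with the eigenvariables \<open>y\<close> and
  \<open>z\<close> set to \<open>k\<close> and \<open>Suc k\<close>. Only these fresh variables are
  moved, and the substitutions pass their values on to \<open>x\<close> inside
  \<open>\<delta>\<close>; the hypotheses keep their truth even if \<open>x\<close> occurs in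
  them.\<close>

lemma sat_Induct:
  assumes "sound d1" "dhyps d1 = \<Gamma> @ [Zero z]" "dconcl d1 = substi x z \<delta>"
    and "sound d2" "dhyps d2 = \<Gamma> @ [Sc y z, substi x y \<delta>]" "dconcl d2 = substi x z \<delta>"
    and "y \<noteq> z" "fresh_i y (\<delta> # \<Gamma>)" "fresh_i z (\<delta> # \<Gamma>)"
    and "denotable \<kappa> \<sigma>" "\<And>\<psi>. \<psi> \<in> set \<Gamma> \<Longrightarrow> sat \<psi> \<kappa> \<sigma>"
  shows "sat \<delta> \<kappa> \<sigma>"
proof -
  have fresh: "y \<notin> fvi \<delta>" "z \<notin> fvi \<delta>" "\<And>\<psi>. \<psi> \<in> set \<Gamma> \<Longrightarrow> y \<notin> fvi \<psi> \<and> z \<notin> fvi \<psi>"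
    using assms by (auto simp: fresh_i_def)
  have "sat \<delta> (\<kappa>(x := k)) \<sigma>" for k
  proof (induction k)
    case 0
    let ?\<kappa> = "\<kappa>(z := 0)"
    have "sat (dconcl d1) ?\<kappa> \<sigma>"
    proof (rule sound_sat[OF assms(1) denotable_upd[OF assms(10)]])
      fix \<psi>
      assume "\<psi> \<in> set (dhyps d1)"
      then consider "\<psi> \<in> set \<Gamma>" | "\<psi> = Zero z" by (auto simp: assms(2))
      then show "sat \<psi> ?\<kappa> \<sigma>"
      proof cases
        case 1
        have "sat \<psi> ?\<kappa> \<sigma> \<longleftrightarrow> sat \<psi> \<kappa> \<sigma>" by (rule sat_cong) (use fresh(3)[OF 1] in auto)
        then show ?thesis using assms(11) 1 by blast
      qed simp
    qed
    then have "sat \<delta> (?\<kappa>(x := 0)) \<sigma>" by (simp add: assms(3) sat_substi)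
    moreover have "sat \<delta> (?\<kappa>(x := 0)) \<sigma> \<longleftrightarrow> sat \<delta> (\<kappa>(x := 0)) \<sigma>"
      by (rule sat_cong) (use fresh in auto)
    ultimately show ?case by blast
  next
    case (Suc k)
    let ?\<kappa> = "\<kappa>(y := k, z := Suc k)"
    have eq: "sat \<delta> (?\<kappa>(x := j)) \<sigma> \<longleftrightarrow> sat \<delta> (\<kappa>(x := j)) \<sigma>" for j
      by (rule sat_cong) (use fresh in auto)
    have "sat (dconcl d2) ?\<kappa> \<sigma>"
    proof (rule sound_sat[OF assms(4) denotable_upd[OF denotable_upd[OF assms(10)]]])
      fix \<psi>
      assume "\<psi> \<in> set (dhyps d2)"
      then consider "\<psi> \<in> set \<Gamma>" | "\<psi> = Sc y z" | "\<psi> = substi x y \<delta>" by (auto simp: assms(5))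
      then show "sat \<psi> ?\<kappa> \<sigma>"
      proof cases
        case 1
        have "sat \<psi> ?\<kappa> \<sigma> \<longleftrightarrow> sat \<psi> \<kappa> \<sigma>" by (rule sat_cong) (use fresh(3)[OF 1] in auto)
        then show ?thesis using assms(11) 1 by blast
      next
        case 2
        then show ?thesis using assms(7) by simp
      next
        case 3
        then have "sat \<psi> ?\<kappa> \<sigma> \<longleftrightarrow> sat \<delta> (?\<kappa>(x := k)) \<sigma>" using assms(7) by (simp add: sat_substi)
        then show ?thesis using Suc eq by blast
      qed
    qed
    then have "sat \<delta> (?\<kappa>(x := Suc k)) \<sigma>" by (simp add: assms(6) sat_substi)
    then show ?case using eq by blast
  qed
  from this[of "\<kappa> x"] show ?thesis by simp
qed

text \<open>There are two patterns of proof: \<open>soundI\<close> where a run has to be produced,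
  and \<open>detI\<close> where the truth of the conclusion already determines its run.\<close>

lemma sound_rule:
  assumes "rule_instance r (map endsequent ds) s" "\<And>d. d \<in> set ds \<Longrightarrow> sound d"
  shows "sound (Infer r s ds)"
proof -
  let ?D = "Infer r s ds"
  have prem: "sound d" "dhyps d = fst (endsequent d)" "dconcl d = snd (endsequent d)" if "d \<in> set ds" for d
    using assms(2) that by (auto simp: dhyps_def dconcl_def)
  have D: "drule ?D = r" "dprems ?D = ds" "dhyps ?D = fst s" "dconcl ?D = snd s"
    by (simp_all add: dhyps_def dconcl_def)
  note out = dout_eq[of ?D, unfolded D]
  have out_fun: "dout ?D a = (\<lambda>n. coerce (snd s) (raw_output r (fst s) (snd s) (a n)
      (witness r (snd s) a n) (if ds = [] then Star else dout (hd ds) a n)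
      (if ds = [] then Star else if tl ds = [] then Star else
        dout (hd (tl ds)) (\<lambda>n. second_env r (a n) (dout (hd ds) a n)) n)))" for a
    by (rule ext) (rule out)
  have soundI: "sound ?D" if "\<And>\<kappa> \<sigma> Rs a. realizer_list \<kappa> \<sigma> (fst s) Rs \<Longrightarrow>
     (\<And>n. represents \<kappa> \<sigma> Rs n (a n)) \<Longrightarrow> realizer (snd s) (dout ?D a) \<kappa> \<sigma>"
    using that by (auto simp: sound_def D)
  \<comment> \<open>The truth of a premise is offered only if it has the hypotheses of the
    conclusion; \<open>NegI\<close> and \<open>Induct\<close> extend them and go through
    \<open>sound_sat\<close> with adjusted assumptions.\<close>
  have detI: "sound ?D" if "deterministic (snd s)"
    "\<And>\<kappa> \<sigma>. denotable \<kappa> \<sigma> \<Longrightarrow> (\<And>\<psi>. \<psi> \<in> set (fst s) \<Longrightarrow> sat \<psi> \<kappa> \<sigma>) \<Longrightarrow>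
      \<forall>d\<in>set ds. fst (endsequent d) = fst s \<longrightarrow> sat (snd (endsequent d)) \<kappa> \<sigma> \<Longrightarrow> sat (snd s) \<kappa> \<sigma>"
  proof (rule sound_deterministic)
    fix \<kappa> \<sigma>
    assume *: "denotable \<kappa> \<sigma>" "\<And>\<psi>. \<psi> \<in> set (dhyps ?D) \<Longrightarrow> sat \<psi> \<kappa> \<sigma>"
    have "sat (snd (endsequent d)) \<kappa> \<sigma>" if "d \<in> set ds" "fst (endsequent d) = fst s" for d
      using sound_sat[of d \<kappa> \<sigma>] prem[OF that(1)] that * D(3) by metis
    then show "sat (dconcl ?D) \<kappa> \<sigma>" using that * D by metis
  qed (use that D in simp)
  have rep_append: "represents \<kappa> \<sigma> (Rs @ [R]) n (second_env Cut x (R n))"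
    if "represents \<kappa> \<sigma> Rs n x" for \<kappa> \<sigma> Rs R x n
    using that by (cases x) (auto simp: represents_def)
  have prem_realizer: "realizer \<psi> (dout d a) \<kappa> \<sigma>" if "realizer_list \<kappa> \<sigma> (fst s) Rs"
    "\<And>n. represents \<kappa> \<sigma> Rs n (a n)" "d \<in> set ds" "endsequent d = (fst s, \<psi>)" for d \<psi> \<kappa> \<sigma> Rs a
    using soundD[OF prem(1), of d \<kappa> \<sigma> Rs a] prem(2,3)[of d] that by simp
  from assms(1) show ?thesis
  proof cases
    case (1 \<phi> \<Gamma>)
    show ?thesis
    proof (rule soundI)
      fix \<kappa> \<sigma> Rs a
      assume hyps: "realizer_list \<kappa> \<sigma> (fst s) Rs"
        and a: "\<And>n. represents \<kappa> \<sigma> Rs n (a n)"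
      have "dout ?D a n = coerce \<phi> (assoc_move \<phi> \<Gamma> (map (\<lambda>R. R n) Rs))" for n
        unfolding out using a[of n] by (cases "a n") (auto simp: 1 represents_def)
      then have "dout ?D a = (\<lambda>n. coerce \<phi> (assoc_move \<phi> \<Gamma> (map (\<lambda>R. R n) Rs)))" by blast
      then show "realizer (snd s) (dout ?D a) \<kappa> \<sigma>"
        using realizer_coerceI[OF realizer_assoc_move] hyps 1 by simp
    qed
  next
    case (2 \<Gamma> \<phi> \<psi>)
    then obtain d1 d2 where ds: "ds = [d1, d2]" "endsequent d1 = (\<Gamma>, \<phi>)"
      "endsequent d2 = (\<Gamma> @ [\<phi>], \<psi>)" by auto
    show ?thesis
    proof (rule soundI)
      fix \<kappa> \<sigma> Rs a
      assume hyps: "realizer_list \<kappa> \<sigma> (fst s) Rs"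
        and a: "\<And>n. represents \<kappa> \<sigma> Rs n (a n)"
      have b1: "realizer \<phi> (dout d1 a) \<kappa> \<sigma>"
        by (rule prem_realizer[OF hyps a]) (simp_all add: ds 2)
      have "represents \<kappa> \<sigma> (Rs @ [dout d1 a]) n (second_env Cut (a n) (dout d1 a n))" for n
        by (rule rep_append[OF a])
      then have "realizer \<psi> (dout d2 (\<lambda>n. second_env Cut (a n) (dout d1 a n))) \<kappa> \<sigma>"
        using soundD[OF prem(1), of d2 \<kappa> \<sigma> "Rs @ [dout d1 a]"] hyps b1 prem(2,3)[of d2]
        by (simp add: ds 2 list_all2_appendI)
      from realizer_coerceI[OF this] show "realizer (snd s) (dout ?D a) \<kappa> \<sigma>"
        unfolding out_fun by (simp add: 2 ds)
    qed
  next
    case (3 \<Gamma> \<phi>)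
    then obtain d1 where ds: "ds = [d1]" "endsequent d1 = (\<Gamma> @ [\<phi>], Bot)" by auto
    show ?thesis
    proof (rule detI)
      show "deterministic (snd s)" by (simp add: 3)
      fix \<kappa> \<sigma>
      assume *: "denotable \<kappa> \<sigma>" "\<And>\<psi>. \<psi> \<in> set (fst s) \<Longrightarrow> sat \<psi> \<kappa> \<sigma>"
      have "\<not> sat \<phi> \<kappa> \<sigma>"
      proof
        assume \<phi>: "sat \<phi> \<kappa> \<sigma>"
        have "sat \<psi> \<kappa> \<sigma>" if "\<psi> \<in> set (dhyps d1)" for \<psi>
          using that prem(2)[of d1] * \<phi> by (auto simp: ds 3)
        from sound_sat[OF prem(1) *(1) this] show False using prem(3)[of d1] by (simp add: ds)
      qed
      then show "sat (snd s) \<kappa> \<sigma>" by (simp add: 3)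
    qed
  next
    case (4 \<Gamma> \<phi>)
    show ?thesis by (rule detI) (use 4 in \<open>auto simp: map_eq_Cons_conv\<close>)
  next
    case (5 \<Gamma> \<phi> \<psi>)
    then obtain d1 d2 where ds: "ds = [d1, d2]" "endsequent d1 = (\<Gamma>, \<phi>)"
      "endsequent d2 = (\<Gamma>, \<psi>)" by auto
    show ?thesis
    proof (rule soundI)
      fix \<kappa> \<sigma> Rs a
      assume hyps: "realizer_list \<kappa> \<sigma> (fst s) Rs"
        and a: "\<And>n. represents \<kappa> \<sigma> Rs n (a n)"
      have "realizer \<phi> (dout d1 a) \<kappa> \<sigma>"
        by (rule prem_realizer[OF hyps a]) (simp_all add: ds 5)
      moreover have "realizer \<psi> (dout d2 a) \<kappa> \<sigma>"
        by (rule prem_realizer[OF hyps a]) (simp_all add: ds 5)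
      ultimately have "realizer (And \<phi> \<psi>) (\<lambda>n. MPair (dout d1 a n) (dout d2 a n)) \<kappa> \<sigma>" by auto
      from realizer_coerceI[OF this] show "realizer (snd s) (dout ?D a) \<kappa> \<sigma>"
        unfolding out_fun by (simp add: 5 ds)
    qed
  next
    case (6 \<Gamma> \<phi> \<psi>)
    then obtain d1 where ds: "ds = [d1]" "endsequent d1 = (\<Gamma>, And \<phi> \<psi>)" by auto
    show ?thesis
    proof (rule soundI)
      fix \<kappa> \<sigma> Rs a
      assume hyps: "realizer_list \<kappa> \<sigma> (fst s) Rs"
        and a: "\<And>n. represents \<kappa> \<sigma> Rs n (a n)"
      have "realizer (And \<phi> \<psi>) (dout d1 a) \<kappa> \<sigma>"
        by (rule prem_realizer[OF hyps a]) (simp_all add: ds 6)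
      then obtain R1 R2 where "dout d1 a = (\<lambda>n. MPair (R1 n) (R2 n))" "realizer \<phi> R1 \<kappa> \<sigma>" by auto
      with realizer_coerceI[OF this(2)] show "realizer (snd s) (dout ?D a) \<kappa> \<sigma>"
        unfolding out_fun by (simp add: 6 ds)
    qed
  next
    case (7 \<Gamma> \<phi> \<psi>)
    then obtain d1 where ds: "ds = [d1]" "endsequent d1 = (\<Gamma>, And \<phi> \<psi>)" by auto
    show ?thesis
    proof (rule soundI)
      fix \<kappa> \<sigma> Rs a
      assume hyps: "realizer_list \<kappa> \<sigma> (fst s) Rs"
        and a: "\<And>n. represents \<kappa> \<sigma> Rs n (a n)"
      have "realizer (And \<phi> \<psi>) (dout d1 a) \<kappa> \<sigma>"
        by (rule prem_realizer[OF hyps a]) (simp_all add: ds 7)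
      then obtain R1 R2 where "dout d1 a = (\<lambda>n. MPair (R1 n) (R2 n))" "realizer \<psi> R2 \<kappa> \<sigma>" by auto
      with realizer_coerceI[OF this(2)] show "realizer (snd s) (dout ?D a) \<kappa> \<sigma>"
        unfolding out_fun by (simp add: 7 ds)
    qed
  next
    case (8 t \<Gamma> \<phi>)
    then obtain d1 where ds: "ds = [d1]" "endsequent d1 = (\<Gamma>, insti t \<phi>)" by auto
    show ?thesis
    proof (rule soundI)
      fix \<kappa> \<sigma> Rs a
      assume hyps: "realizer_list \<kappa> \<sigma> (fst s) Rs"
        and a: "\<And>n. represents \<kappa> \<sigma> Rs n (a n)"
      have "realizer (insti t \<phi>) (dout d1 a) \<kappa> \<sigma>"
        by (rule prem_realizer[OF hyps a]) (simp_all add: ds 8)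
      then have "realizer (ExI \<phi>) (\<lambda>n. MPair (Bit (n = \<kappa> t)) (MPair Star (dout d1 a n))) \<kappa> \<sigma>"
        unfolding realizer_insti realizer.simps by blast
      moreover have "dout ?D a n =
        coerce (ExI \<phi>) (MPair (Bit (n = \<kappa> t)) (MPair Star (dout d1 a n)))" for n
        unfolding out using a[of n] by (cases "a n") (auto simp: 8 ds represents_def)
      then have "dout ?D a =
        (\<lambda>n. coerce (ExI \<phi>) (MPair (Bit (n = \<kappa> t)) (MPair Star (dout d1 a n))))" by blast
      ultimately show "realizer (snd s) (dout ?D a) \<kappa> \<sigma>"
        by (simp only: 8 snd_conv) (rule realizer_coerceI)
    qed
  next
    case (9 z \<phi> \<psi> \<Gamma>)
    then obtain d1 d2 where ds: "ds = [d1, d2]" "endsequent d1 = (\<Gamma>, ExI \<phi>)"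
      "endsequent d2 = (\<Gamma> @ [insti z \<phi>], \<psi>)" by auto
    have fresh: "z \<notin> fvi (ExI \<phi>)" "z \<notin> fvi \<psi>" "\<And>\<psi>. \<psi> \<in> set \<Gamma> \<Longrightarrow> z \<notin> fvi \<psi>"
      using 9 by (auto simp: fresh_i_def)
    show ?thesis
    proof (rule soundI)
      fix \<kappa> \<sigma> Rs a
      assume hyps: "realizer_list \<kappa> \<sigma> (fst s) Rs"
        and a: "\<And>n. represents \<kappa> \<sigma> Rs n (a n)"
      have "realizer (ExI \<phi>) (dout d1 a) \<kappa> \<sigma>"
        by (rule prem_realizer[OF hyps a]) (simp_all add: ds 9)
      then obtain k R where b1: "dout d1 a = (\<lambda>n. MPair (Bit (n = k)) (MPair Star (R n)))"
        and R: "realizer \<phi> R (case_nat k \<kappa>) \<sigma>" by auto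
      \<comment> \<open>The eigenvariable takes the number that the first premise outputs bit by
        bit; freshness makes the hypotheses and both formulae insensitive to this change.\<close>
      let ?\<kappa> = "\<kappa>(z := k)"
      have "realizer (insti z \<phi>) R ?\<kappa> \<sigma>"
        unfolding realizer_insti using R realizer_body_fresh_i[OF fresh(1)] by simp
      moreover have "realizer_list ?\<kappa> \<sigma> \<Gamma> Rs"
        by (rule realizer_hyps_cong[of \<kappa> \<sigma>]) (use hyps 9 realizer_fresh_i[OF fresh(3)] in auto)
      moreover have "represents ?\<kappa> \<sigma> (Rs @ [R]) n (second_env (ExIE z) (a n) (dout d1 a n))" for n
      proof -
        obtain d xs Xs ms where an: "a n = (d, xs, Xs, ms)" by (cases "a n")
        have "represents ?\<kappa> \<sigma> Rs n (d, update_at d xs z (n = k), Xs, ms)"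
          using represents_upd_ind a[of n] by (simp add: an)
        then show ?thesis by (simp add: an b1 represents_def)
      qed
      ultimately have "realizer \<psi> (dout d2 (\<lambda>n. second_env (ExIE z) (a n) (dout d1 a n))) ?\<kappa> \<sigma>"
        using soundD[OF prem(1), of d2 ?\<kappa> \<sigma> "Rs @ [R]"] prem(2,3)[of d2]
        by (simp add: ds 9 list_all2_appendI)
      then have "realizer \<psi> (dout d2 (\<lambda>n. second_env (ExIE z) (a n) (dout d1 a n))) \<kappa> \<sigma>"
        using realizer_fresh_i[OF fresh(2)] by simp
      from realizer_coerceI[OF this] show "realizer (snd s) (dout ?D a) \<kappa> \<sigma>"
        unfolding out_fun by (simp add: 9 ds)
    qed
  next
    case (10 Y \<Gamma> \<phi>)
    then obtain d1 where ds: "ds = [d1]" "endsequent d1 = (\<Gamma>, instp Y \<phi>)" by auto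
    show ?thesis
    proof (rule soundI)
      fix \<kappa> \<sigma> Rs a
      assume hyps: "realizer_list \<kappa> \<sigma> (fst s) Rs"
        and a: "\<And>n. represents \<kappa> \<sigma> Rs n (a n)"
      have "realizer (instp Y \<phi>) (dout d1 a) \<kappa> \<sigma>"
        by (rule prem_realizer[OF hyps a]) (simp_all add: ds 10)
      then have "realizer (ExP \<phi>) (\<lambda>n. MPair (Bit (\<sigma> Y n)) (dout d1 a n)) \<kappa> \<sigma>"
        unfolding realizer_instp realizer.simps by blast
      moreover have "dout ?D a n = coerce (ExP \<phi>) (MPair (Bit (\<sigma> Y n)) (dout d1 a n))" for n
        unfolding out using a[of n] by (cases "a n") (auto simp: 10 ds represents_def)
      then have "dout ?D a = (\<lambda>n. coerce (ExP \<phi>) (MPair (Bit (\<sigma> Y n)) (dout d1 a n)))" by blast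
      ultimately show "realizer (snd s) (dout ?D a) \<kappa> \<sigma>"
        by (simp only: 10 snd_conv) (rule realizer_coerceI)
    qed
  next
    case (11 Z \<phi> \<psi> \<Gamma>)
    then obtain d1 d2 where ds: "ds = [d1, d2]" "endsequent d1 = (\<Gamma>, ExP \<phi>)"
      "endsequent d2 = (\<Gamma> @ [instp Z \<phi>], \<psi>)" by auto
    have fresh: "Z \<notin> fvp (ExP \<phi>)" "Z \<notin> fvp \<psi>" "\<And>\<psi>. \<psi> \<in> set \<Gamma> \<Longrightarrow> Z \<notin> fvp \<psi>"
      using 11 by (auto simp: fresh_p_def)
    show ?thesis
    proof (rule soundI)
      fix \<kappa> \<sigma> Rs a
      assume hyps: "realizer_list \<kappa> \<sigma> (fst s) Rs"
        and a: "\<And>n. represents \<kappa> \<sigma> Rs n (a n)"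
      have "realizer (ExP \<phi>) (dout d1 a) \<kappa> \<sigma>"
        by (rule prem_realizer[OF hyps a]) (simp_all add: ds 11)
      then obtain S R where b1: "dout d1 a = (\<lambda>n. MPair (Bit (S n)) (R n))"
        and R: "realizer \<phi> R \<kappa> (case_nat S \<sigma>)" by auto
      let ?\<sigma> = "\<sigma>(Z := S)"
      have "realizer (instp Z \<phi>) R \<kappa> ?\<sigma>"
        unfolding realizer_instp using R realizer_body_fresh_p[OF fresh(1)] by simp
      moreover have "realizer_list \<kappa> ?\<sigma> \<Gamma> Rs"
        by (rule realizer_hyps_cong[of \<kappa> \<sigma>]) (use hyps 11 realizer_fresh_p[OF fresh(3)] in auto)
      moreover have "represents \<kappa> ?\<sigma> (Rs @ [R]) n (second_env (ExPE Z) (a n) (dout d1 a n))" for n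
      proof -
        obtain d xs Xs ms where an: "a n = (d, xs, Xs, ms)" by (cases "a n")
        have "represents \<kappa> ?\<sigma> Rs n (d, xs, update_at False Xs Z (S n), ms)"
          using represents_upd_pred a[of n] by (simp add: an)
        then show ?thesis by (simp add: an b1 represents_def)
      qed
      ultimately have "realizer \<psi> (dout d2 (\<lambda>n. second_env (ExPE Z) (a n) (dout d1 a n))) \<kappa> ?\<sigma>"
        using soundD[OF prem(1), of d2 \<kappa> ?\<sigma> "Rs @ [R]"] prem(2,3)[of d2]
        by (simp add: ds 11 list_all2_appendI)
      then have "realizer \<psi> (dout d2 (\<lambda>n. second_env (ExPE Z) (a n) (dout d1 a n))) \<kappa> \<sigma>"
        using realizer_fresh_p[OF fresh(2)] by simp
      from realizer_coerceI[OF this] show "realizer (snd s) (dout ?D a) \<kappa> \<sigma>"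
        unfolding out_fun by (simp add: 11 ds)
    qed
  next
    case (12 \<Gamma> x)
    show ?thesis by (rule detI) (use 12 in auto)
  next
    case (13 x y z \<phi> \<Gamma>)
    then obtain d1 d2 where ds: "ds = [d1, d2]" "endsequent d1 = (\<Gamma>, substi x y \<phi>)"
      "endsequent d2 = (\<Gamma>, Eq y z)" by auto
    show ?thesis
    proof (rule soundI)
      fix \<kappa> \<sigma> Rs a
      assume hyps: "realizer_list \<kappa> \<sigma> (fst s) Rs"
        and a: "\<And>n. represents \<kappa> \<sigma> Rs n (a n)"
      have "realizer (substi x y \<phi>) (dout d1 a) \<kappa> \<sigma>"
        by (rule prem_realizer[OF hyps a]) (simp_all add: ds 13)
      moreover have "realizer (Eq y z) (dout d2 a) \<kappa> \<sigma>"
        by (rule prem_realizer[OF hyps a]) (simp_all add: ds 13)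
      ultimately have "realizer (substi x z \<phi>) (dout d1 a) \<kappa> \<sigma>" by (simp add: realizer_substi)
      from realizer_coerceI[OF this] show "realizer (snd s) (dout ?D a) \<kappa> \<sigma>"
        unfolding out_fun by (simp add: 13 ds)
    qed
  next
    case (14 \<Gamma> x)
    show ?thesis by (rule detI) (use 14 in auto)
  next
    case (15 \<Gamma> x y z)
    show ?thesis by (rule detI) (use 15 in \<open>auto simp: map_eq_Cons_conv\<close>)
  next
    case (16 \<Gamma> x y)
    show ?thesis by (rule detI) (use 16 in \<open>auto simp: map_eq_Cons_conv\<close>)
  next
    case (17 \<Gamma>)
    show ?thesis
    proof (rule soundI)
      fix \<kappa> \<sigma> Rs a
      \<comment> \<open>The raw output is \<open>MPair (Bit (n = 0)) Star\<close>; coercing it gives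
        the same move as coercing the fully shaped one.\<close>
      have "dout ?D a = (\<lambda>n. coerce (ExI (Zero 0)) (MPair (Bit (n = 0)) (MPair Star Star)))"
        unfolding out_fun by (simp add: 17 witness_Zero)
      moreover have "realizer (ExI (Zero 0)) (\<lambda>n. MPair (Bit (n = 0)) (MPair Star Star)) \<kappa> \<sigma>"
        unfolding realizer.simps by (intro exI[of _ 0] exI[of _ "\<lambda>n. Star"]) simp
      ultimately show "realizer (snd s) (dout ?D a) \<kappa> \<sigma>"
        by (simp only: 17 snd_conv) (rule realizer_coerceI)
    qed
  next
    case (18 \<Gamma> x y)
    show ?thesis by (rule detI) (use 18 in \<open>auto simp: map_eq_Cons_conv\<close>)
  next
    case (19 \<Gamma> x)
    show ?thesis
    proof (rule soundI)
      fix \<kappa> \<sigma> Rs a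
      assume a: "\<And>n. represents \<kappa> \<sigma> Rs n (a n)"
      have "dout ?D a = (\<lambda>n. coerce (ExI (Sc (Suc x) 0)) (MPair (Bit (n = Suc (\<kappa> x))) (MPair Star Star)))"
        unfolding out_fun using witness_Sc[OF _ a, of ScEx "ExI (Sc (Suc x) 0)"] by (simp add: 19)
      moreover have "realizer (ExI (Sc (Suc x) 0)) (\<lambda>n. MPair (Bit (n = Suc (\<kappa> x))) (MPair Star Star)) \<kappa> \<sigma>"
        unfolding realizer.simps by (intro exI[of _ "Suc (\<kappa> x)"] exI[of _ "\<lambda>n. Star"]) simp
      ultimately show "realizer (snd s) (dout ?D a) \<kappa> \<sigma>"
        by (simp only: 19 snd_conv) (rule realizer_coerceI)
    qed
  next
    case (20 \<Gamma> x y z)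
    show ?thesis by (rule detI) (use 20 in \<open>auto simp: map_eq_Cons_conv\<close>)
  next
    case (21 \<Gamma> x z y)
    show ?thesis by (rule detI) (use 21 in \<open>auto simp: map_eq_Cons_conv\<close>)
  next
    case (22 \<Gamma> x y)
    show ?thesis by (rule detI) (use 22 in \<open>auto simp: map_eq_Cons_conv\<close>)
  next
    case (23 \<Gamma> x y)
    show ?thesis by (rule detI) (use 23 in \<open>auto simp: map_eq_Cons_conv\<close>)
  next
    case (24 \<Gamma> y y' x)
    show ?thesis by (rule detI) (use 24 in \<open>auto simp: map_eq_Cons_conv\<close>)
  next
    case (25 \<psi> \<Gamma> \<phi>)
    show ?thesis
    proof (rule detI)
      fix \<kappa> \<sigma>
      assume "\<forall>d\<in>set ds. fst (endsequent d) = fst s \<longrightarrow> sat (snd (endsequent d)) \<kappa> \<sigma>"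
      \<comment> \<open>The witness is the set of all \<open>n\<close> at which
        \<open>\<psi>\<close> is true. It may depend on the future of the input, which is harmless
        below a double negation.\<close>
      then have "sat (substp 0 \<psi> \<phi>) \<kappa> \<sigma>" using 25 by (auto simp: map_eq_Cons_conv)
      then show "sat (snd s) \<kappa> \<sigma>" by (auto simp: 25 sat_substp insert_at_0)
    qed (simp add: 25)
  next
    case (26 \<delta> y z \<Gamma> x)
    then obtain d1 d2 where ds: "ds = [d1, d2]" "endsequent d1 = (\<Gamma> @ [Zero z], substi x z \<delta>)"
      "endsequent d2 = (\<Gamma> @ [Sc y z, substi x y \<delta>], substi x z \<delta>)" by auto
    show ?thesis
    proof (rule detI)
      fix \<kappa> \<sigma>
      assume "denotable \<kappa> \<sigma>" "\<And>\<psi>. \<psi> \<in> set (fst s) \<Longrightarrow> sat \<psi> \<kappa> \<sigma>"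
      then show "sat (snd s) \<kappa> \<sigma>"
        using sat_Induct[of d1 \<Gamma> z x \<delta> d2 y \<kappa> \<sigma>] prem[of d1] prem[of d2] 26 by (simp add: ds)
    qed (use 26 in simp)
  next
    case (27 \<delta> \<Gamma>)
    show ?thesis by (rule detI) (use 27 in \<open>auto simp: map_eq_Cons_conv\<close>)
  next
    case (28 \<chi> \<Gamma> \<psi>)
    let ?\<chi> = "relativize (Le 0 1) \<chi>"
    obtain d1 where ds: "ds = [d1]" "endsequent d1 = (\<Gamma>, substp 0 ?\<chi> \<psi>)" using 28 by auto
    show ?thesis
    proof (rule soundI)
      fix \<kappa> \<sigma> Rs a
      assume hyps: "realizer_list \<kappa> \<sigma> (fst s) Rs"
        and a: "\<And>n. represents \<kappa> \<sigma> Rs n (a n)"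
      \<comment> \<open>The set to be comprehended; by \<open>witness_SyncCompr\<close>, the local
        automaton outputs exactly this bit at time \<open>n\<close>.\<close>
      let ?T = "\<lambda>n. sat ?\<chi> (case_nat n \<kappa>) \<sigma>"
      have "realizer (substp 0 ?\<chi> \<psi>) (dout d1 a) \<kappa> \<sigma>"
        by (rule prem_realizer[OF hyps a]) (simp_all add: ds 28)
      from realizer_substp[OF this]
      have "realizer (ExP \<psi>) (\<lambda>n. MPair (Bit (?T n)) (coerce \<psi> (dout d1 a n))) \<kappa> \<sigma>"
        unfolding insert_at_0 realizer.simps
        by (intro exI[of _ ?T] exI[of _ "\<lambda>n. coerce \<psi> (dout d1 a n)"]) simp
      moreover have "dout ?D a = (\<lambda>n. MPair (Bit (?T n)) (coerce \<psi> (dout d1 a n)))"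
        unfolding out_fun using witness_SyncCompr[OF _ a] 28 by (simp add: ds)
      ultimately show "realizer (snd s) (dout ?D a) \<kappa> \<sigma>" by (simp only: 28 snd_conv)
    qed
  qed
qed

lemma smso_derivation_sound: "smso_derivation D \<Longrightarrow> sound D"
  by (induction rule: smso_derivation.induct) (auto intro: sound_rule)

section \<open>The extracted table as a Mealy machine\<close>

lemma dinit_in_dstates: "dinit D \<in> set (dstates D)"
proof (induction D rule: dinit.induct)
  case (1 D)
  then show ?case by (subst dinit.simps, subst dstates.simps) (simp add: finit_in_fstates)
qed

lemma dstep_in_dstates: "s \<in> set (dstates D) \<Longrightarrow> fst (dstep D s a) \<in> set (dstates D)"
proof (induction D s a rule: dstep.induct)
  case (1 D s a)
  let ?S1 = "if dprems D = [] then [0] else dstates (hd (dprems D))"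
  let ?S2 = "if dprems D = [] then [0] else
    if tl (dprems D) = [] then [0] else dstates (hd (tl (dprems D)))"
  have "s \<in> set (pairs (fstates (local_form (drule D))) (pairs ?S1 ?S2))"
    using 1(4) by (subst (asm) dstates.simps)
  note s = in_pairsD[OF this]
  show ?case using 1(1-3) conjunct1[OF s] in_pairsD[OF conjunct2[OF s]]
    by (subst dstep.simps, subst dstates.simps)
      (auto simp: combine_def local_step_def fstep_in_fstates split: if_splits)
qed

lemma dstep_output_in_M: "snd (dstep D s a) \<in> M (dconcl D)"
  by (subst dstep.simps) (simp add: combine_def coerce_in_M)

lemma set_bool_lists: "set (bool_lists n) = {xs. length xs = n}"
proof (induction n)
  case (Suc n)
  then show ?case by (auto simp: length_Suc_conv)
qed simp

lemma set_move_list: "set (move_list \<phi>) = M \<phi>"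
  by (induction \<phi>) auto

lemma set_move_lists: "set (move_lists \<Gamma>) = {ms. list_all2 (\<lambda>m \<phi>. m \<in> M \<phi>) ms \<Gamma>}"
  by (induction \<Gamma>) (auto simp: set_move_list list_all2_Cons2)

lemma stars_replicate: "stars n = replicate n Star"
  by (induction n) auto

lemma set_input_list: "set (input_list l p \<Gamma>) = inputs l p \<Gamma>"
  by (auto simp: input_list_def inputs_def set_bool_lists set_move_lists stars_replicate)

lemma map_of_graph: "x \<in> set xs \<Longrightarrow> map_of (map (\<lambda>x. (x, f x)) xs) x = Some (f x)"
  by (induction xs) auto

lemma map_of_machine:
  assumes "q \<in> set (mstates (machine D l p))" "a \<in> inputs l p (dhyps D)"
  shows "map_of (mtable (machine D l p)) (q, a) = Some (top_step D q a)"
proof -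
  have "mtable (machine D l p) = map (\<lambda>x. (x, case x of (q, a) \<Rightarrow> top_step D q a))
    (List.product (mstates (machine D l p)) (input_list l p (dhyps D)))"
    by (simp add: machine_def product_concat_map map_concat comp_def)
  then show ?thesis using assms
    by (simp add: map_of_graph[where f = "\<lambda>x. case x of (q, a) \<Rightarrow> top_step D q a"] set_input_list)
qed

lemma top_step_in:
  assumes "q \<in> set (mstates (machine D l p))"
  shows "fst (top_step D q a) \<in> set (mstates (machine D l p))"
  using assms by (auto simp: machine_def top_step_def Let_def dest!: in_pairsD intro: dstep_in_dstates)

lemma mealy_machine_machine: "mealy_machine (inputs l p (dhyps D)) (M (dconcl D)) (machine D l p)"
  unfolding mealy_machine_def
proof (intro conjI ballI)
  show "minit (machine D l p) \<in> set (mstates (machine D l p))"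
    by (simp add: machine_def dinit_in_dstates)
  fix q a
  assume q: "q \<in> set (mstates (machine D l p))" and a: "a \<in> inputs l p (dhyps D)"
  have "snd (top_step D q a) \<in> M (dconcl D)"
    by (simp add: top_step_def Let_def dstep_output_in_M)
  then show "\<exists>q'\<in>set (mstates (machine D l p)). \<exists>b\<in>M (dconcl D).
    map_of (mtable (machine D l p)) (q, a) = Some (q', b)"
    using map_of_machine[OF q a] top_step_in[OF q, of a] by (metis prod.collapse)
qed

lemma mealy_fun_machine:
  assumes "\<And>n. w n \<in> inputs l p (dhyps D)"
  shows "mealy_fun (machine D l p) w =
    dout D (\<lambda>n. (n = 0, fst (w n), fst (snd (w n)), snd (snd (snd (w n)))))"
proof -
  let ?m = "machine D l p"
  let ?a = "\<lambda>n. (n = 0, fst (w n), fst (snd (w n)), snd (snd (snd (w n))))"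
  have trans: "mtrans ?m q (w n) = top_step D q (w n)" if "q \<in> set (mstates ?m)" for q n
    using map_of_machine[OF that assms] by (simp add: mtrans_def)
  \<comment> \<open>The table is known to agree with \<open>top_step\<close> only on listed states,
    so membership of the current state is carried through the induction.\<close>
  have states: "mstate_seq ?m w n = \<langle>of_bool (0 < n), dseq D ?a n\<rangle> \<and> mstate_seq ?m w n \<in> set (mstates ?m)" for n
  proof (induction n)
    case 0
    then show ?case by (simp add: machine_def dinit_in_dstates)
  next
    case (Suc n)
    then have "mstate_seq ?m w n \<in> set (mstates ?m)" by blast
    then have "mstate_seq ?m w (Suc n) = fst (top_step D (mstate_seq ?m w n) (w n))"
      by (simp only: mstate_seq.simps trans)
    moreover have "fst (top_step D (mstate_seq ?m w n) (w n)) \<in> set (mstates ?m)"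
      using Suc top_step_in by blast
    moreover have "fst (top_step D \<langle>of_bool (0 < n), dseq D ?a n\<rangle> (w n)) = \<langle>1, dseq D ?a (Suc n)\<rangle>"
      by (simp add: top_step_def Let_def)
    ultimately show ?case using Suc by simp
  qed
  show ?thesis
  proof
    fix n
    have "mealy_fun ?m w n = snd (top_step D (mstate_seq ?m w n) (w n))"
      by (simp only: mealy_fun_def trans[OF conjunct2[OF states]])
    then show "mealy_fun ?m w n = dout D ?a n"
      by (simp only: conjunct1[OF states]) (simp add: dout_def top_step_def Let_def)
  qed
qed

lemma bit_at_map: "bit_at d (map f xs) i = (if i < length xs then f (xs ! i) else d)"
proof (induction xs arbitrary: i)
  case (Cons x xs)
  then show ?case by (cases i) auto
qed simp

lemma realizes_machine:
  assumes "smso_derivation D"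
    and fv: "\<forall>\<psi>\<in>set (dconcl D # dhyps D). fvi \<psi> \<subseteq> {..<l} \<and> fvp \<psi> \<subseteq> {..<p}"
  shows "realizes l p (dhyps D) (mealy_fun (machine D l p)) (dconcl D)"
  unfolding realizes_def
proof (intro allI impI; elim conjE)
  fix As A ks \<sigma>s Rs
  assume As: "list_all2 (\<lambda>\<psi> B. interp \<psi> l p B) (dhyps D) As" and A: "interp (dconcl D) l p A"
    and len: "length ks = l" "length \<sigma>s = p"
    and runs: "list_all2 (\<lambda>R B. accepting_run R B (word ks \<sigma>s)) Rs As"
  \<comment> \<open>The default values match the environments of the machine: the number 0 has the
    bit \<open>n = 0\<close> at position \<open>n\<close>, and the empty set has the bit
    \<open>False\<close>.\<close>
  define \<kappa> where "\<kappa> i = (if i < l then ks ! i else 0)" for i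
  define \<sigma> where "\<sigma> X = (if X < p then \<sigma>s ! X else (\<lambda>n. False))" for X
  have run: "accepting_run R B (word ks \<sigma>s) \<longleftrightarrow> realizer \<psi> R \<kappa> \<sigma>"
    if "interp \<psi> l p B" "\<psi> \<in> set (dconcl D # dhyps D)" for \<psi> B R
  proof -
    have "realizer \<psi> R ((!) ks) ((!) \<sigma>s) \<longleftrightarrow> realizer \<psi> R \<kappa> \<sigma>"
      by (rule realizer_cong) (use fv that(2) in \<open>auto simp: \<kappa>_def \<sigma>_def\<close>)
    then show ?thesis using interp_accepting_run[OF that(1) len] by simp
  qed
  have hyps: "realizer_list \<kappa> \<sigma> (dhyps D) Rs"
    unfolding list_all2_conv_all_nth
  proof (intro conjI allI impI)
    show lens: "length (dhyps D) = length Rs" using As runs by (metis list_all2_lengthD)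
    fix i
    assume i: "i < length (dhyps D)"
    have "interp (dhyps D ! i) l p (As ! i)" using As i by (simp add: list_all2_conv_all_nth)
    moreover have "accepting_run (Rs ! i) (As ! i) (word ks \<sigma>s)"
      using runs i lens by (simp add: list_all2_conv_all_nth)
    ultimately show "realizer (dhyps D ! i) (Rs ! i) \<kappa> \<sigma>" using run i by simp
  qed
  let ?w = "input_stream ks \<sigma>s Rs"
  \<comment> \<open>A realizer is fixed by \<open>coerce\<close>, whose values lie in
    \<open>M\<close>, so accepting runs stay within the input alphabet.\<close>
  have "list_all2 (\<lambda>m \<phi>. m \<in> M \<phi>) (map (\<lambda>R. R n) Rs) (dhyps D)" for n
    using hyps
  proof induction
    case (Cons \<psi> \<Gamma> R Rs)
    then show ?case using realizer_coerce[OF Cons(1), of n] coerce_in_M[of \<psi> "R n"] by simp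
  qed simp
  then have "?w n \<in> inputs l p (dhyps D)" for n
    using len by (simp add: input_stream_def inputs_def)
  from mealy_fun_machine[of ?w l p D, OF this]
  have eq: "mealy_fun (machine D l p) ?w =
    dout D (\<lambda>n. (n = 0, map (\<lambda>k. n = k) ks, map (\<lambda>\<sigma>. \<sigma> n) \<sigma>s, map (\<lambda>R. R n) Rs))"
    by (simp add: input_stream_def)
  have "represents \<kappa> \<sigma> Rs n (n = 0, map (\<lambda>k. n = k) ks, map (\<lambda>\<sigma>. \<sigma> n) \<sigma>s, map (\<lambda>R. R n) Rs)" for n
    using len by (auto simp: represents_def bit_at_map \<kappa>_def \<sigma>_def)
  from soundD[OF smso_derivation_sound[OF assms(1)] hyps this]
  show "accepting_run (mealy_fun (machine D l p) ?w) A (word ks \<sigma>s)"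
    unfolding eq using run[OF A] by simp
qed

theorem theorem5p10:
  shows "\<exists>extract :: recf.
    \<forall>(D :: deriv) (\<Gamma> :: form list) (\<phi> :: form) (l :: nat) (p :: nat).
      smso_derivation D \<and> endsequent D = (\<Gamma>, \<phi>) \<and>
      (\<forall>\<psi>\<in>set (\<phi> # \<Gamma>). fvi \<psi> \<subseteq> {..<l} \<and> fvp \<psi> \<subseteq> {..<p}) \<longrightarrow>
      (\<exists>m :: (input, move) mealy.
         computes extract [code_deriv D, l, p] (code_mealy m) \<and>
         mealy_machine (inputs l p \<Gamma>) (M \<phi>) m \<and>
         realizes l p \<Gamma> (mealy_fun m) \<phi>)"
proof -
  obtain r where r: "\<And>D l p. computes r [code_deriv D, l, p] (code_mealy (machine D l p))"
    using machine_recursive by blast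
  show ?thesis
  proof (intro exI[of _ r] allI impI; elim conjE)
    fix D \<Gamma> \<phi> l p
    assume D: "smso_derivation D" "endsequent D = (\<Gamma>, \<phi>)"
      and fv: "\<forall>\<psi>\<in>set (\<phi> # \<Gamma>). fvi \<psi> \<subseteq> {..<l} \<and> fvp \<psi> \<subseteq> {..<p}"
    have "dhyps D = \<Gamma>" "dconcl D = \<phi>" using D(2) by (simp_all add: dhyps_def dconcl_def)
    then show "\<exists>m. computes r [code_deriv D, l, p] (code_mealy m) \<and>
      mealy_machine (inputs l p \<Gamma>) (M \<phi>) m \<and> realizes l p \<Gamma> (mealy_fun m) \<phi>"
      using r mealy_machine_machine[of l p D] realizes_machine[OF D(1), of l p] fv by blast
  qed
qed

end
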